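(* Let $(\mathcal{M}^8,g,H,\Phi,F)$ be an 8-dimensional Riemannian manifold for which all $\hat\nabla$-parallel spinors are Killing spinors. Suppose that the holonomy group of $\hat\nabla$ is strictly one of $G_2$, $SU(3)$, $SU(2)$, with parallel spinors represented respectively by $\{1+e_{1234},\ e_1+e_{234}\}$ for $G_2$, $\{1,\ e_1\}$ for $SU(3)$, $\{1,\ e_{12},\ e_1,\ e_2\}$ for $SU(2)$, and that $i_{\vec\kappa_1}i_{\vec\kappa_2}dH=0$ for any two 1-form bilinears $\kappa_1$ and $\kappa_2$. Then $\mathcal{M}^8$ admits the action of a Euclidean signature Lie algebra $\mathfrak{g}$ generated by the 1-form bilinears (i.e. by their dual vector fields), and $\mathfrak{g}$ is: - $\mathfrak{g}=\mathbb{R}$ (dimension 1) for holonomy $G_2$; - $\mathfrak{g}=\mathbb{R}^2$ (dimension 2) for holonomy $SU(3)$; - $\mathfrak{g}=\mathbb{R}^4$ (dimension 4) for holonomy $SU(2)$.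
   Context: All manifolds are smooth, oriented, spin and simply connected. $g$ is a Riemannian metric, $H$ a 3-form, $\Phi$ a function (dilaton), $F$ the curvature of a gauge connection. $\hat\nabla_XY=\nabla_XY+\frac12\vec H(X,Y)$, with $\nabla$ the Levi-Civita connection and $g(Z,\vec H(X,Y))=H(Z,X,Y)$. For a 1-form $\kappa$, $\vec\kappa$ is the $g$-dual vector field. The Killing spinor equations (KSEs) are $\hat\nabla_X\epsilon=0$ (gravitino), $(\mathrm{cl}(d\Phi)-\frac1{12}\mathrm{cl}(H))\epsilon=0$ (dilatino), $\mathrm{cl}(F)\epsilon=0$ (gaugino), with $\mathrm{cl}(\omega)=\omega_{a_1\dots a_k}\Gamma^{a_1\dots a_k}$ the Clifford element associated with a form $\omega$ (and $\mathrm{cl}(X)=X^a\Gamma_a$ for a vector field $X$); $\epsilon$ is a section of the spinor bundle associated with the real representation $\Delta_{\mathbf{16}}=\Delta_{\mathbf 8}^+\oplus\Delta_{\mathbf 8}^-$ of $\mathrm{Spin}(8)$. Solutions of all three are Killing spinors. Realisation of spinors: $\mathrm{Cliff}(\mathbb{R}^8)$ acts on $\Lambda^*(\mathbb{C}^4)$ with Hermitian basis $e_1,\dots,e_4$ by $\Gamma_i\zeta=e_i\wedge\zeta+e_i\bar\wedge\zeta$, $\Gamma_{i+4}\zeta=i(e_i\wedge\zeta-e_i\bar\wedge\zeta)$, $i=1,\dots,4$, where $e_i\bar\wedge$ is the inner derivation with $e_i\bar\wedge e_j=\delta_{ij}$. $\Delta^{\pm}_{\mathbf 8}$ are the fixed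 subspaces of $\Gamma_{5678}*$ ($*$ complex conjugation) in even/odd degree forms. If a complex spinor is listed, both its real and imaginary parts are meant. The form bilinears of Killing spinors $\epsilon_1,\epsilon_2$ are $\omega(X_1,\dots,X_k)=\frac1{k!}\langle\epsilon_1,\sum_\sigma(-1)^{|\sigma|}\mathrm{cl}(X_{\sigma(1)})\cdots\mathrm{cl}(X_{\sigma(k)})\epsilon_2\rangle$, with $\langle\cdot,\cdot\rangle$ the $\mathrm{Spin}(8)$-invariant inner product; they are $\hat\nabla$-covariantly constant. "1-form bilinears" are those with $k=1$ (and their real linear combinations). "Strictly" means that the holonomy group of $\hat\nabla$ does not reduce further to a proper subgroup. A Euclidean signature Lie algebra is one equipped with the positive definite invariant inner product induced by $g$. *)

theory Defs
  imports "HOL-Analysis.Analysis" "HOL-Library.Function_Algebras"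
begin

section \<open>Smooth manifolds of dimension 8\<close>

text \<open>Real-valued functions, tangent vectors and vector fields are all (iterated) functions into
  the reals and are added, multiplied and scaled pointwise.\<close>

instantiation "fun" :: (type, real_vector) real_vector
begin
definition scaleR_fun :: "real \<Rightarrow> ('a \<Rightarrow> 'b) \<Rightarrow> 'a \<Rightarrow> 'b" where
  "scaleR_fun c f = (\<lambda>x. c *\<^sub>R f x)"
instance
  by standard (simp_all add: scaleR_fun_def fun_eq_iff scaleR_add_right scaleR_add_left)
end

primrec Ck_on :: "nat \<Rightarrow> 'a::euclidean_space set \<Rightarrow> ('a \<Rightarrow> 'b::real_normed_vector) \<Rightarrow> bool" where
  "Ck_on 0 S f \<longleftrightarrow> continuous_on S f"
| "Ck_on (Suc k) S f \<longleftrightarrow> (\<forall>x\<in>S. f differentiable (at x)) \<and>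
      (\<forall>b\<in>Basis. Ck_on k S (\<lambda>x. frechet_derivative f (at x) b))"

text \<open>Only used for open sets.\<close>
definition smooth_on :: "'a::euclidean_space set \<Rightarrow> ('a \<Rightarrow> 'b::real_normed_vector) \<Rightarrow> bool" where
  "smooth_on S f \<longleftrightarrow> (\<forall>k. Ck_on k S f)"

text \<open>The manifold is the whole type \<open>'m\<close>.\<close>

type_synonym 'm atlas = "('m set \<times> ('m \<Rightarrow> real^8)) set"

definition smooth_atlas :: "'m::topological_space atlas \<Rightarrow> bool" where
  "smooth_atlas A \<longleftrightarrow>
     (\<forall>(V, \<phi>)\<in>A. open V \<and> open (\<phi> ` V) \<and> (\<exists>\<psi>. homeomorphism V (\<phi> ` V) \<phi> \<psi>)) \<and>
     (\<Union>(V, \<phi>)\<in>A. V) = UNIV \<and>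
     (\<forall>(V, \<phi>)\<in>A. \<forall>(W, \<psi>)\<in>A. smooth_on (\<phi> ` (V \<inter> W)) (\<psi> \<circ> inv_into V \<phi>))"

definition oriented_smooth_atlas :: "'m::topological_space atlas \<Rightarrow> bool" where
  "oriented_smooth_atlas A \<longleftrightarrow> smooth_atlas A \<and>
     (\<forall>(V, \<phi>)\<in>A. \<forall>(W, \<psi>)\<in>A. \<forall>x\<in>\<phi> ` (V \<inter> W).
        0 < det (matrix (frechet_derivative (\<psi> \<circ> inv_into V \<phi>) (at x))))"

definition smooth_fun ::
  "'m::topological_space atlas \<Rightarrow> 'm set \<Rightarrow> ('m \<Rightarrow> 'b::real_normed_vector) \<Rightarrow> bool" where
  "smooth_fun A W f \<longleftrightarrow> (\<forall>(V, \<phi>)\<in>A. smooth_on (\<phi> ` (V \<inter> W)) (f \<circ> inv_into V \<phi>))"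

definition smooth_near :: "'m::topological_space atlas \<Rightarrow> 'm \<Rightarrow> ('m \<Rightarrow> 'b::real_normed_vector) \<Rightarrow> bool" where
  "smooth_near A p f \<longleftrightarrow> (\<exists>W. open W \<and> p \<in> W \<and> smooth_fun A W f)"


section \<open>Tangent vectors, vector fields, forms\<close>

text \<open>A tangent vector at \<open>p\<close> is a derivation of the algebra of germs of smooth functions at \<open>p\<close>,
  made total by the value 0 on functions that are not smooth near \<open>p\<close>.\<close>

type_synonym 'm tvec = "('m \<Rightarrow> real) \<Rightarrow> real"
type_synonym 'm vfield = "'m \<Rightarrow> 'm tvec"

definition tangent :: "'m::topological_space atlas \<Rightarrow> 'm \<Rightarrow> 'm tvec set" where
  "tangent A p = {v.
     (\<forall>f. \<not> smooth_near A p f \<longrightarrow> v f = 0) \<and>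
     (\<forall>f h. smooth_near A p f \<longrightarrow> smooth_near A p h \<longrightarrow>
        ((\<forall>\<^sub>F q in nhds p. f q = h q) \<longrightarrow> v f = v h) \<and>
        v (f + h) = v f + v h \<and> v (f * h) = f p * v h + h p * v f) \<and>
     (\<forall>c f. smooth_near A p f \<longrightarrow> v (c *\<^sub>R f) = c * v f)}"

text \<open>Vector fields on an open set \<open>U\<close>; values outside \<open>U\<close> are irrelevant.\<close>
definition vector_fields :: "'m::topological_space atlas \<Rightarrow> 'm set \<Rightarrow> 'm vfield set" where
  "vector_fields A U = {X. (\<forall>p\<in>U. X p \<in> tangent A p) \<and>
     (\<forall>W f. open W \<longrightarrow> W \<subseteq> U \<longrightarrow> smooth_fun A W f \<longrightarrow> smooth_fun A W (\<lambda>p. X p f))}"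

definition lie_bracket :: "'m::topological_space atlas \<Rightarrow> 'm vfield \<Rightarrow> 'm vfield \<Rightarrow> 'm vfield" where
  "lie_bracket A X Y p f =
     (if smooth_near A p f then X p (\<lambda>q. Y q f) - Y p (\<lambda>q. X q f) else 0)"

definition linear_at :: "'m::topological_space atlas \<Rightarrow> 'm \<Rightarrow> ('m tvec \<Rightarrow> 'b::real_vector) \<Rightarrow> bool" where
  "linear_at A p \<alpha> \<longleftrightarrow> (\<forall>u\<in>tangent A p. \<forall>v\<in>tangent A p. \<alpha> (u + v) = \<alpha> u + \<alpha> v) \<and>
     (\<forall>c. \<forall>u\<in>tangent A p. \<alpha> (c *\<^sub>R u) = c *\<^sub>R \<alpha> u)"

type_synonym 'm metric_tensor = "'m \<Rightarrow> 'm tvec \<Rightarrow> 'm tvec \<Rightarrow> real"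
type_synonym 'm form1 = "'m \<Rightarrow> 'm tvec \<Rightarrow> real"
type_synonym 'm form3 = "'m \<Rightarrow> 'm tvec \<Rightarrow> 'm tvec \<Rightarrow> 'm tvec \<Rightarrow> real"

definition riemannian_metric :: "'m::topological_space atlas \<Rightarrow> 'm metric_tensor \<Rightarrow> bool" where
  "riemannian_metric A g \<longleftrightarrow>
     (\<forall>p. \<forall>u\<in>tangent A p. linear_at A p (g p u) \<and> (\<forall>v\<in>tangent A p. g p u v = g p v u) \<and>
        (u \<noteq> 0 \<longrightarrow> 0 < g p u u)) \<and>
     (\<forall>U X Y. open U \<longrightarrow> X \<in> vector_fields A U \<longrightarrow> Y \<in> vector_fields A U \<longrightarrow>
        smooth_fun A U (\<lambda>p. g p (X p) (Y p)))"

definition three_form :: "'m::topological_space atlas \<Rightarrow> 'm form3 \<Rightarrow> bool" where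
  "three_form A H \<longleftrightarrow>
     (\<forall>p. \<forall>u\<in>tangent A p. \<forall>v\<in>tangent A p. linear_at A p (H p u v) \<and>
        (\<forall>w\<in>tangent A p. H p u v w = - H p v u w \<and> H p u v w = - H p u w v)) \<and>
     (\<forall>U X Y Z. open U \<longrightarrow> X \<in> vector_fields A U \<longrightarrow> Y \<in> vector_fields A U \<longrightarrow>
        Z \<in> vector_fields A U \<longrightarrow> smooth_fun A U (\<lambda>p. H p (X p) (Y p) (Z p)))"

text \<open>The exterior derivative of a 3-form by the invariant (Cartan/Palais) formula.\<close>
definition ext_deriv3 :: "'m::topological_space atlas \<Rightarrow> 'm form3 \<Rightarrow>
    'm vfield \<Rightarrow> 'm vfield \<Rightarrow> 'm vfield \<Rightarrow> 'm vfield \<Rightarrow> 'm \<Rightarrow> real" where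
  "ext_deriv3 A H X0 X1 X2 X3 p =
     X0 p (\<lambda>q. H q (X1 q) (X2 q) (X3 q)) - X1 p (\<lambda>q. H q (X0 q) (X2 q) (X3 q))
     + X2 p (\<lambda>q. H q (X0 q) (X1 q) (X3 q)) - X3 p (\<lambda>q. H q (X0 q) (X1 q) (X2 q))
     - H p (lie_bracket A X0 X1 p) (X2 p) (X3 p) + H p (lie_bracket A X0 X2 p) (X1 p) (X3 p)
     - H p (lie_bracket A X0 X3 p) (X1 p) (X2 p) - H p (lie_bracket A X1 X2 p) (X0 p) (X3 p)
     + H p (lie_bracket A X1 X3 p) (X0 p) (X2 p) - H p (lie_bracket A X2 X3 p) (X0 p) (X1 p)"

definition sharp :: "'m::topological_space atlas \<Rightarrow> 'm metric_tensor \<Rightarrow> 'm \<Rightarrow> ('m tvec \<Rightarrow> real) \<Rightarrow> 'm tvec" where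
  "sharp A g p \<alpha> = (THE v. v \<in> tangent A p \<and> (\<forall>w\<in>tangent A p. g p v w = \<alpha> w))"

definition dual_field :: "'m::topological_space atlas \<Rightarrow> 'm metric_tensor \<Rightarrow> 'm form1 \<Rightarrow> 'm vfield" where
  "dual_field A g \<kappa> p = sharp A g p (\<kappa> p)"

definition orthonormal_basis_at ::
  "'m::topological_space atlas \<Rightarrow> 'm metric_tensor \<Rightarrow> 'm \<Rightarrow> (8 \<Rightarrow> 'm tvec) \<Rightarrow> bool" where
  "orthonormal_basis_at A g p b \<longleftrightarrow> (\<forall>k. b k \<in> tangent A p) \<and>
     (\<forall>k l. g p (b k) (b l) = (if k = l then 1 else 0)) \<and>
     (\<forall>v\<in>tangent A p. v = (\<Sum>k\<in>UNIV. g p (b k) v *\<^sub>R b k))"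

definition orthonormal_frame ::
  "'m::topological_space atlas \<Rightarrow> 'm metric_tensor \<Rightarrow> 'm set \<Rightarrow> (8 \<Rightarrow> 'm vfield) \<Rightarrow> bool" where
  "orthonormal_frame A g U E \<longleftrightarrow> (\<forall>k. E k \<in> vector_fields A U) \<and>
     (\<forall>p\<in>U. orthonormal_basis_at A g p (\<lambda>k. E k p))"

definition oriented_frame :: "'m::topological_space atlas \<Rightarrow> 'm set \<Rightarrow> (8 \<Rightarrow> 'm vfield) \<Rightarrow> bool" where
  "oriented_frame A U E \<longleftrightarrow> (\<forall>(V, \<phi>)\<in>A. \<forall>p\<in>U \<inter> V.
     0 < det ((\<chi> k l. E k p (\<lambda>q. \<phi> q $ l)) :: real^8^8))"


section \<open>Connections and holonomy\<close>

text \<open>\<open>D p v Y\<close> is the derivative at \<open>p\<close>, in the direction of \<open>v\<close>, of a vector field \<open>Y\<close> defined on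
  an open neighbourhood of \<open>p\<close>.\<close>
type_synonym 'm connection = "'m \<Rightarrow> 'm tvec \<Rightarrow> 'm vfield \<Rightarrow> 'm tvec"

definition affine_connection :: "'m::topological_space atlas \<Rightarrow> 'm connection \<Rightarrow> bool" where
  "affine_connection A D \<longleftrightarrow> (\<forall>U. open U \<longrightarrow>
     (\<forall>Y\<in>vector_fields A U.
        (\<forall>p\<in>U. linear_at A p (\<lambda>v. D p v Y)) \<and>
        (\<forall>X\<in>vector_fields A U. (\<lambda>p. D p (X p) Y) \<in> vector_fields A U) \<and>
        (\<forall>Z\<in>vector_fields A U. \<forall>p\<in>U. \<forall>v\<in>tangent A p. D p v (Y + Z) = D p v Y + D p v Z) \<and>
        (\<forall>f. smooth_fun A U f \<longrightarrow> (\<forall>p\<in>U. \<forall>v\<in>tangent A p.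
           D p v (\<lambda>q. f q *\<^sub>R Y q) = v f *\<^sub>R Y p + f p *\<^sub>R D p v Y))))"

definition levi_civita :: "'m::topological_space atlas \<Rightarrow> 'm metric_tensor \<Rightarrow> 'm connection \<Rightarrow> bool" where
  "levi_civita A g D \<longleftrightarrow> affine_connection A D \<and>
     (\<forall>U. open U \<longrightarrow> (\<forall>X\<in>vector_fields A U. \<forall>Y\<in>vector_fields A U. \<forall>p\<in>U.
        D p (X p) Y - D p (Y p) X = lie_bracket A X Y p \<and>
        (\<forall>v\<in>tangent A p. v (\<lambda>q. g q (X q) (Y q)) = g p (D p v X) (Y p) + g p (X p) (D p v Y))))"

definition H_vec :: "'m::topological_space atlas \<Rightarrow> 'm metric_tensor \<Rightarrow> 'm form3 \<Rightarrow>
    'm \<Rightarrow> 'm tvec \<Rightarrow> 'm tvec \<Rightarrow> 'm tvec" where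
  "H_vec A g H p u v = sharp A g p (\<lambda>z. H p z u v)"

definition nabla_hat :: "'m::topological_space atlas \<Rightarrow> 'm metric_tensor \<Rightarrow> 'm form3 \<Rightarrow>
    'm connection \<Rightarrow> 'm connection" where
  "nabla_hat A g H D p v Y = D p v Y + (1/2) *\<^sub>R H_vec A g H p v (Y p)"

definition smooth_curve :: "'m::topological_space atlas \<Rightarrow> (real \<Rightarrow> 'm) \<Rightarrow> bool" where
  "smooth_curve A c \<longleftrightarrow> (\<exists>I. open I \<and> {0..1} \<subseteq> I \<and> continuous_on I c \<and>
     (\<forall>W f. open W \<longrightarrow> smooth_fun A W (f :: 'm \<Rightarrow> real) \<longrightarrow> smooth_on (I \<inter> c -` W) (f \<circ> c)))"

definition velocity :: "'m::topological_space atlas \<Rightarrow> (real \<Rightarrow> 'm) \<Rightarrow> real \<Rightarrow> 'm tvec" where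
  "velocity A c t f = (if smooth_near A (c t) f then deriv (f \<circ> c) t else 0)"

text \<open>In every local orthonormal frame \<open>E\<close> the components \<open>V\<^sup>k = g(E\<^sub>k, V)\<close> of a
  parallel field satisfy \<open>dV\<^sup>k/dt + g(E\<^sub>k, \<nabla>\<^sub>c\<^sub>'E\<^sub>l) V\<^sup>l = 0\<close>.\<close>
definition parallel_along :: "'m::topological_space atlas \<Rightarrow> 'm metric_tensor \<Rightarrow> 'm connection \<Rightarrow>
    (real \<Rightarrow> 'm) \<Rightarrow> (real \<Rightarrow> 'm tvec) \<Rightarrow> bool" where
  "parallel_along A g N c V \<longleftrightarrow> (\<forall>t\<in>{0..1}. V t \<in> tangent A (c t)) \<and>
     (\<forall>U E. open U \<longrightarrow> orthonormal_frame A g U E \<longrightarrow> (\<forall>t\<in>{0..1}. c t \<in> U \<longrightarrow>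
        (\<forall>k. ((\<lambda>s. g (c s) (E k (c s)) (V s)) has_real_derivative
             - (\<Sum>l\<in>UNIV. g (c t) (E k (c t)) (N (c t) (velocity A c t) (E l)) *
                           g (c t) (E l (c t)) (V t)))
            (at t within {0..1}))))"

text \<open>Parallel transport from \<open>p\<close> along piecewise smooth curves, i.e. along finite concatenations
  of smooth curves.  Only the restriction of \<open>\<tau>\<close> to the tangent space at \<open>p\<close> matters.\<close>
inductive transport :: "'m::topological_space atlas \<Rightarrow> 'm metric_tensor \<Rightarrow> 'm connection \<Rightarrow>
    'm \<Rightarrow> 'm \<Rightarrow> ('m tvec \<Rightarrow> 'm tvec) \<Rightarrow> bool" for A g N p where
  refl: "transport A g N p p id"
| step: "transport A g N p q \<tau> \<Longrightarrow> smooth_curve A c \<Longrightarrow> c 0 = q \<Longrightarrow> c 1 = r \<Longrightarrow>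
     (\<forall>v\<in>tangent A q. \<exists>V. parallel_along A g N c V \<and> V 0 = v \<and> V 1 = \<sigma> v) \<Longrightarrow>
     transport A g N p r (\<sigma> \<circ> \<tau>)"

definition holonomy_matrices :: "'m::topological_space atlas \<Rightarrow> 'm metric_tensor \<Rightarrow> 'm connection \<Rightarrow>
    'm \<Rightarrow> (8 \<Rightarrow> 'm tvec) \<Rightarrow> (real^8^8) set" where
  "holonomy_matrices A g N p b = {M. \<exists>\<tau>. transport A g N p p \<tau> \<and>
     (\<forall>x. \<tau> (\<Sum>k\<in>UNIV. x $ k *\<^sub>R b k) = (\<Sum>k\<in>UNIV. (M *v x) $ k *\<^sub>R b k))}"

text \<open>The holonomy group equals \<open>G\<close> in a suitable orthonormal basis of each tangent space; equality
  (rather than inclusion) expresses that the holonomy is strictly \<open>G\<close>.\<close>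
definition holonomy_group_is :: "'m::topological_space atlas \<Rightarrow> 'm metric_tensor \<Rightarrow> 'm connection \<Rightarrow>
    (real^8^8) set \<Rightarrow> bool" where
  "holonomy_group_is A g N G \<longleftrightarrow>
     (\<forall>p. \<exists>b. orthonormal_basis_at A g p b \<and> holonomy_matrices A g N p b = G)"


section \<open>The groups $G_2$, $SU(3)$, $SU(2)$ inside $SO(8)$\<close>

text \<open>The index types \<open>8\<close> and \<open>4\<close> are the integers modulo 8 and 4, so the last index is equal to
  0.  \<open>pos\<close> recovers the conventional label in \<open>1,\<dots>,8\<close> resp. \<open>1,\<dots>,4\<close>.\<close>
definition pos :: "'k::semiring_1 \<Rightarrow> nat" where
  "pos k = (LEAST n. 0 < n \<and> of_nat n = k)"

definition to_complex :: "real^8 \<Rightarrow> complex^4" where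
  "to_complex x = (\<chi> k. Complex (x $ of_nat (pos k)) (x $ of_nat (pos k + 4)))"

definition SU4 :: "(complex^4^4) set" where
  "SU4 = {U. det U = 1 \<and>
     (\<forall>k l. (\<Sum>m\<in>UNIV. cnj (U $ m $ k) * U $ m $ l) = (if k = l then 1 else 0))}"

definition realification :: "(complex^4^4) set \<Rightarrow> (real^8^8) set" where
  "realification G = {M. \<exists>U\<in>G. \<forall>x. to_complex (M *v x) = U *v to_complex x}"

definition SU3_in_SO8 :: "(real^8^8) set" where
  "SU3_in_SO8 = realification {U\<in>SU4. U *v axis 1 1 = axis 1 1}"

definition SU2_in_SO8 :: "(real^8^8) set" where
  "SU2_in_SO8 = realification {U\<in>SU4. U *v axis 1 1 = axis 1 1 \<and> U *v axis 2 1 = axis 2 1}"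

definition wedge3 :: "8 \<Rightarrow> 8 \<Rightarrow> 8 \<Rightarrow> real^8 \<Rightarrow> real^8 \<Rightarrow> real^8 \<Rightarrow> real" where
  "wedge3 i j k x y z = x $ i * (y $ j * z $ k - y $ k * z $ j)
     - x $ j * (y $ i * z $ k - y $ k * z $ i) + x $ k * (y $ i * z $ j - y $ j * z $ i)"

text \<open>The fundamental 3-form
  $dx^{123}+dx^{145}+dx^{167}+dx^{246}-dx^{257}-dx^{347}-dx^{356}$ on $\<real>^7$, with indices shifted by
  one: $\<real>^7$ is the orthogonal complement of the first basis vector.\<close>
definition G2_form :: "real^8 \<Rightarrow> real^8 \<Rightarrow> real^8 \<Rightarrow> real" where
  "G2_form x y z = wedge3 2 3 4 x y z + wedge3 2 5 6 x y z + wedge3 2 7 8 x y z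
     + wedge3 3 5 7 x y z - wedge3 3 6 8 x y z - wedge3 4 5 8 x y z - wedge3 4 6 7 x y z"

definition G2_in_SO8 :: "(real^8^8) set" where
  "G2_in_SO8 = {M. orthogonal_matrix M \<and> M *v axis 1 1 = axis 1 1 \<and>
     (\<forall>x y z. G2_form (M *v x) (M *v y) (M *v z) = G2_form x y z)}"


section \<open>Spinors of $\mathrm{Spin}(8)$ as polyforms\<close>

text \<open>Polyforms on $\<complex>^4$: the component \<open>\<zeta> $ S\<close> is the coefficient of the wedge product of the
  $e_i$, $i \<in> S$, taken in the order $e_1, e_2, e_3, e_4$.\<close>
type_synonym spinor = "complex^(4 set)"

abbreviation e_wedge :: "4 set \<Rightarrow> spinor" where
  "e_wedge S \<equiv> axis S 1"

definition koszul_sign :: "4 \<Rightarrow> 4 set \<Rightarrow> complex" where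
  "koszul_sign k S = (- 1) ^ card {j\<in>S. pos j < pos k}"

definition ext_mult :: "4 \<Rightarrow> spinor \<Rightarrow> spinor" where
  "ext_mult k \<zeta> = (\<chi> S. if k \<in> S then koszul_sign k S * \<zeta> $ (S - {k}) else 0)"

definition inner_derivation :: "4 \<Rightarrow> spinor \<Rightarrow> spinor" where
  "inner_derivation k \<zeta> = (\<chi> S. if k \<notin> S then koszul_sign k S * \<zeta> $ (insert k S) else 0)"

definition Gam :: "8 \<Rightarrow> spinor \<Rightarrow> spinor" where
  "Gam a \<zeta> = (if pos a \<le> 4
     then ext_mult (of_nat (pos a)) \<zeta> + inner_derivation (of_nat (pos a)) \<zeta>
     else \<i> *s (ext_mult (of_nat (pos a - 4)) \<zeta> - inner_derivation (of_nat (pos a - 4)) \<zeta>))"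

text \<open>The real structure $\Gamma_{5678}*$ and its fixed space $\Delta_{16}$, which is the sum of
  its even part $\Delta_8^+$ and its odd part $\Delta_8^-$.\<close>
definition spinor_conj :: "spinor \<Rightarrow> spinor" where
  "spinor_conj \<zeta> = Gam 5 (Gam 6 (Gam 7 (Gam 8 (\<chi> S. cnj (\<zeta> $ S)))))"

definition Delta16 :: "spinor set" where
  "Delta16 = {\<zeta>. spinor_conj \<zeta> = \<zeta>}"

definition real_part :: "spinor \<Rightarrow> spinor" where
  "real_part \<zeta> = (1/2) *s (\<zeta> + spinor_conj \<zeta>)"

definition imag_part :: "spinor \<Rightarrow> spinor" where
  "imag_part \<zeta> = (1/(2*\<i>)) *s (\<zeta> - spinor_conj \<zeta>)"

definition listed_spinors :: "spinor set \<Rightarrow> spinor set" where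
  "listed_spinors L = span (real_part ` L \<union> imag_part ` L)"

text \<open>Components with respect to an orthonormal basis.  For the 2- and 3-forms the components are
  antisymmetric, so that $\omega_{ab}\Gamma^{ab} = \omega_{ab}\Gamma^a\Gamma^b$ etc.\<close>

definition cl1 :: "(8 \<Rightarrow> real) \<Rightarrow> spinor \<Rightarrow> spinor" where
  "cl1 w \<zeta> = (\<Sum>a\<in>UNIV. w a *\<^sub>R Gam a \<zeta>)"

definition cl2 :: "(8 \<Rightarrow> 8 \<Rightarrow> real) \<Rightarrow> spinor \<Rightarrow> spinor" where
  "cl2 w \<zeta> = (\<Sum>a\<in>UNIV. \<Sum>b\<in>UNIV. w a b *\<^sub>R Gam a (Gam b \<zeta>))"

definition cl3 :: "(8 \<Rightarrow> 8 \<Rightarrow> 8 \<Rightarrow> real) \<Rightarrow> spinor \<Rightarrow> spinor" where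
  "cl3 w \<zeta> = (\<Sum>a\<in>UNIV. \<Sum>b\<in>UNIV. \<Sum>c\<in>UNIV. w a b c *\<^sub>R Gam a (Gam b (Gam c \<zeta>)))"

text \<open>Even products of unit vectors.\<close>
inductive_set Spin8 :: "(spinor \<Rightarrow> spinor) set" where
  "id \<in> Spin8"
| "s \<in> Spin8 \<Longrightarrow> norm (u::real^8) = 1 \<Longrightarrow> norm (v::real^8) = 1 \<Longrightarrow>
     (\<lambda>\<zeta>. s (cl1 (($) u) (cl1 (($) v) \<zeta>))) \<in> Spin8"


section \<open>Spin structures and spinor fields\<close>

text \<open>A spin structure is given by local oriented orthonormal frames together with a Spin(8)-valued
  cocycle lifting the SO(8)-valued transition functions of the frames.  Over \<open>patch S i\<close> a spinor
  field is represented by a function \<open>\<epsilon> i\<close> into $\Delta_{16}$.\<close>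

record ('m, 'i) spin_data =
  patch :: "'i \<Rightarrow> 'm set"
  frame :: "'i \<Rightarrow> 8 \<Rightarrow> 'm vfield"
  lift :: "'i \<Rightarrow> 'i \<Rightarrow> 'm \<Rightarrow> spinor \<Rightarrow> spinor"

type_synonym ('m, 'i) spinor_field = "'i \<Rightarrow> 'm \<Rightarrow> spinor"

definition spin_structure ::
  "'m::topological_space atlas \<Rightarrow> 'm metric_tensor \<Rightarrow> ('m, 'i) spin_data \<Rightarrow> bool" where
  "spin_structure A g S \<longleftrightarrow>
     (\<forall>i. open (patch S i)) \<and> (\<Union>i. patch S i) = UNIV \<and>
     (\<forall>i. orthonormal_frame A g (patch S i) (frame S i) \<and> oriented_frame A (patch S i) (frame S i)) \<and>
     (\<forall>i j. (\<forall>\<zeta>. smooth_fun A (patch S i \<inter> patch S j) (\<lambda>p. lift S i j p \<zeta>)) \<and>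
        (\<forall>p\<in>patch S i \<inter> patch S j. lift S i j p \<in> Spin8 \<and>
           (\<forall>b \<zeta>. lift S i j p (Gam b \<zeta>) =
              (\<Sum>a\<in>UNIV. g p (frame S i a p) (frame S j b p) *\<^sub>R Gam a (lift S i j p \<zeta>))))) \<and>
     (\<forall>i j k. \<forall>p\<in>patch S i \<inter> patch S j \<inter> patch S k.
        lift S i j p \<circ> lift S j k p = lift S i k p)"

definition spinor_section ::
  "'m::topological_space atlas \<Rightarrow> ('m, 'i) spin_data \<Rightarrow> ('m, 'i) spinor_field \<Rightarrow> bool" where
  "spinor_section A S \<epsilon> \<longleftrightarrow>
     (\<forall>i. smooth_fun A (patch S i) (\<epsilon> i) \<and> (\<forall>p\<in>patch S i. \<epsilon> i p \<in> Delta16)) \<and>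
     (\<forall>i j. \<forall>p\<in>patch S i \<inter> patch S j. \<epsilon> i p = lift S i j p (\<epsilon> j p))"

definition spinor_deriv :: "'m tvec \<Rightarrow> ('m \<Rightarrow> spinor) \<Rightarrow> spinor" where
  "spinor_deriv v \<psi> = (\<chi> S. Complex (v (\<lambda>q. Re (\<psi> q $ S))) (v (\<lambda>q. Im (\<psi> q $ S))))"

text \<open>The spin connection: $\nabla_v\epsilon = v(\epsilon) + \frac14\Omega_{v,ab}\Gamma^{ab}\epsilon$
  with $\Omega_{v,ab} = g(e_a,\nabla_v e_b)$.\<close>
definition spin_nabla :: "'m metric_tensor \<Rightarrow> 'm connection \<Rightarrow> ('m, 'i) spin_data \<Rightarrow>
    ('m, 'i) spinor_field \<Rightarrow> 'i \<Rightarrow> 'm \<Rightarrow> 'm tvec \<Rightarrow> spinor" where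
  "spin_nabla g N S \<epsilon> i p v = spinor_deriv v (\<epsilon> i) +
     (1/4) *\<^sub>R cl2 (\<lambda>a b. g p (frame S i a p) (N p v (frame S i b))) (\<epsilon> i p)"

definition parallel_spinor :: "'m::topological_space atlas \<Rightarrow> 'm metric_tensor \<Rightarrow> 'm connection \<Rightarrow>
    ('m, 'i) spin_data \<Rightarrow> ('m, 'i) spinor_field \<Rightarrow> bool" where
  "parallel_spinor A g N S \<epsilon> \<longleftrightarrow> spinor_section A S \<epsilon> \<and>
     (\<forall>i. \<forall>p\<in>patch S i. \<forall>v\<in>tangent A p. spin_nabla g N S \<epsilon> i p v = 0)"

text \<open>The values of the parallel spinors are, up to a change of spin frame, the real span of the
  listed representatives.\<close>
definition parallel_spinors_represented_by :: "'m::topological_space atlas \<Rightarrow> 'm metric_tensor \<Rightarrow>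
    'm connection \<Rightarrow> ('m, 'i) spin_data \<Rightarrow> spinor set \<Rightarrow> bool" where
  "parallel_spinors_represented_by A g N S L \<longleftrightarrow> (\<forall>i. \<forall>p\<in>patch S i. \<exists>s\<in>Spin8.
     {\<epsilon> i p |\<epsilon>. parallel_spinor A g N S \<epsilon>} = s ` listed_spinors L)"


section \<open>Gauge connections\<close>

text \<open>A connection on a principal bundle whose structure group is a closed subgroup \<open>K\<close> of
  $GL(n,\<real>)$: local potentials $A_i$ with values in the Lie algebra of \<open>K\<close>, related by
  $A_j = k_{ij}^{-1}A_ik_{ij} + k_{ij}^{-1}dk_{ij}$.\<close>

definition linear_lie_group :: "(real^'n^'n) set \<Rightarrow> bool" where
  "linear_lie_group K \<longleftrightarrow> closedin (top_of_set {k. invertible k}) K \<and> mat 1 \<in> K \<and>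
     (\<forall>k\<in>K. \<forall>l\<in>K. k ** l \<in> K) \<and> (\<forall>k\<in>K. matrix_inv k \<in> K)"

definition lie_algebra_of :: "(real^'n^'n) set \<Rightarrow> (real^'n^'n) set" where
  "lie_algebra_of K = {B. \<exists>\<gamma>. (\<forall>t. \<gamma> t \<in> K) \<and> \<gamma> 0 = mat 1 \<and> (\<gamma> has_vector_derivative B) (at 0)}"

record ('m, 'j, 'n) gauge_data =
  gpatch :: "'j \<Rightarrow> 'm set"
  gtrans :: "'j \<Rightarrow> 'j \<Rightarrow> 'm \<Rightarrow> real^'n^'n"
  gpot :: "'j \<Rightarrow> 'm \<Rightarrow> 'm tvec \<Rightarrow> real^'n^'n"

definition gauge_connection :: "'m::topological_space atlas \<Rightarrow> (real^'n^'n) set \<Rightarrow>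
    ('m, 'j, 'n::finite) gauge_data \<Rightarrow> bool" where
  "gauge_connection A K B \<longleftrightarrow>
     (\<forall>i. open (gpatch B i)) \<and> (\<Union>i. gpatch B i) = UNIV \<and>
     (\<forall>i j. smooth_fun A (gpatch B i \<inter> gpatch B j) (gtrans B i j) \<and>
        (\<forall>p\<in>gpatch B i \<inter> gpatch B j. gtrans B i j p \<in> K)) \<and>
     (\<forall>i j k. \<forall>p\<in>gpatch B i \<inter> gpatch B j \<inter> gpatch B k.
        gtrans B i j p ** gtrans B j k p = gtrans B i k p) \<and>
     (\<forall>i. \<forall>p\<in>gpatch B i. linear_at A p (gpot B i p) \<and>
        (\<forall>v\<in>tangent A p. gpot B i p v \<in> lie_algebra_of K)) \<and>
     (\<forall>i U X. open U \<longrightarrow> U \<subseteq> gpatch B i \<longrightarrow> X \<in> vector_fields A U \<longrightarrow>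
        smooth_fun A U (\<lambda>p. gpot B i p (X p))) \<and>
     (\<forall>i j. \<forall>p\<in>gpatch B i \<inter> gpatch B j. \<forall>v\<in>tangent A p.
        gtrans B i j p ** gpot B j p v =
          gpot B i p v ** gtrans B i j p + (\<chi> r s. v (\<lambda>q. gtrans B i j q $ r $ s)))"

text \<open>$F = dA + A \wedge A$ over a trivialising patch.\<close>
definition gauge_curvature :: "'m::topological_space atlas \<Rightarrow> ('m, 'j, 'n::finite) gauge_data \<Rightarrow> 'j \<Rightarrow>
    'm vfield \<Rightarrow> 'm vfield \<Rightarrow> 'm \<Rightarrow> real^'n^'n" where
  "gauge_curvature A B j X Y p =
     (\<chi> r s. X p (\<lambda>q. gpot B j q (Y q) $ r $ s) - Y p (\<lambda>q. gpot B j q (X q) $ r $ s))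
     - gpot B j p (lie_bracket A X Y p)
     + (gpot B j p (X p) ** gpot B j p (Y p) - gpot B j p (Y p) ** gpot B j p (X p))"


section \<open>Killing spinors and 1-form bilinears\<close>

definition dilatino :: "'m form3 \<Rightarrow> ('m \<Rightarrow> real) \<Rightarrow> ('m, 'i) spin_data \<Rightarrow>
    ('m, 'i) spinor_field \<Rightarrow> bool" where
  "dilatino H \<Phi> S \<epsilon> \<longleftrightarrow> (\<forall>i. \<forall>p\<in>patch S i.
     cl1 (\<lambda>a. frame S i a p \<Phi>) (\<epsilon> i p) -
     (1/12) *\<^sub>R cl3 (\<lambda>a b c. H p (frame S i a p) (frame S i b p) (frame S i c p)) (\<epsilon> i p) = 0)"

definition gaugino :: "'m::topological_space atlas \<Rightarrow> ('m, 'j, 'n::finite) gauge_data \<Rightarrow>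
    ('m, 'i) spin_data \<Rightarrow> ('m, 'i) spinor_field \<Rightarrow> bool" where
  "gaugino A B S \<epsilon> \<longleftrightarrow> (\<forall>i j. \<forall>p\<in>patch S i \<inter> gpatch B j. \<forall>r s.
     cl2 (\<lambda>a b. gauge_curvature A B j (frame S i a) (frame S i b) p $ r $ s) (\<epsilon> i p) = 0)"

definition killing_spinor :: "'m::topological_space atlas \<Rightarrow> 'm metric_tensor \<Rightarrow> 'm form3 \<Rightarrow>
    ('m \<Rightarrow> real) \<Rightarrow> 'm connection \<Rightarrow> ('m, 'i) spin_data \<Rightarrow> ('m, 'j, 'n::finite) gauge_data \<Rightarrow>
    ('m, 'i) spinor_field \<Rightarrow> bool" where
  "killing_spinor A g H \<Phi> D S B \<epsilon> \<longleftrightarrow>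
     parallel_spinor A g (nabla_hat A g H D) S \<epsilon> \<and> dilatino H \<Phi> S \<epsilon> \<and> gaugino A B S \<epsilon>"

text \<open>The form $v \mapsto \langle\epsilon_1, \mathrm{cl}(v)\epsilon_2\rangle$, evaluated in an
  arbitrary patch around the point.  The invariant inner product on $\Delta_{16}$ is the
  restriction of the Hermitian one, which is real there.\<close>
definition bilinear1 :: "'m::topological_space atlas \<Rightarrow> 'm metric_tensor \<Rightarrow> ('m, 'i) spin_data \<Rightarrow>
    ('m, 'i) spinor_field \<Rightarrow> ('m, 'i) spinor_field \<Rightarrow> 'm form1" where
  "bilinear1 A g S \<epsilon>1 \<epsilon>2 p v = (if v \<in> tangent A p then
     (let i = (SOME i. p \<in> patch S i)
      in inner (\<epsilon>1 i p) (cl1 (\<lambda>a. g p (frame S i a p) v) (\<epsilon>2 i p))) else 0)"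

definition one_form_bilinears :: "'m::topological_space atlas \<Rightarrow> 'm metric_tensor \<Rightarrow> 'm form3 \<Rightarrow>
    ('m \<Rightarrow> real) \<Rightarrow> 'm connection \<Rightarrow> ('m, 'i) spin_data \<Rightarrow> ('m, 'j, 'n::finite) gauge_data \<Rightarrow>
    'm form1 set" where
  "one_form_bilinears A g H \<Phi> D S B = span {bilinear1 A g S \<epsilon>1 \<epsilon>2 |\<epsilon>1 \<epsilon>2.
     killing_spinor A g H \<Phi> D S B \<epsilon>1 \<and> killing_spinor A g H \<Phi> D S B \<epsilon>2}"

text \<open>$i_{\vec\kappa_1} i_{\vec\kappa_2} dH = 0$\<close>
definition double_contraction_vanishes :: "'m::topological_space atlas \<Rightarrow> 'm metric_tensor \<Rightarrow>
    'm form3 \<Rightarrow> 'm form1 \<Rightarrow> 'm form1 \<Rightarrow> bool" where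
  "double_contraction_vanishes A g H \<kappa>1 \<kappa>2 \<longleftrightarrow>
     (\<forall>U. open U \<longrightarrow> (\<forall>Z\<in>vector_fields A U. \<forall>W\<in>vector_fields A U. \<forall>p\<in>U.
        ext_deriv3 A H (dual_field A g \<kappa>2) (dual_field A g \<kappa>1) Z W p = 0))"


section \<open>Lie algebras of vector fields\<close>

definition generated_lie_algebra ::
  "'m::topological_space atlas \<Rightarrow> 'm vfield set \<Rightarrow> 'm vfield set" where
  "generated_lie_algebra A B = \<Inter>{L. B \<subseteq> L \<and> subspace L \<and> (\<forall>X\<in>L. \<forall>Y\<in>L. lie_bracket A X Y \<in> L)}"

definition euclidean_lie_algebra :: "('v::euclidean_space \<Rightarrow> 'v \<Rightarrow> 'v) \<Rightarrow> bool" where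
  "euclidean_lie_algebra br \<longleftrightarrow> bilinear br \<and> (\<forall>x. br x x = 0) \<and>
     (\<forall>x y z. br x (br y z) + br y (br z x) + br z (br x y) = 0) \<and>
     (\<forall>x y z. inner (br x y) z = inner x (br y z))"

text \<open>An action on the manifold of a Lie algebra with invariant positive definite inner product,
  whose inner product is the one induced by \<open>g\<close>; in particular the action is faithful.\<close>
definition euclidean_lie_action :: "'m::topological_space atlas \<Rightarrow> 'm metric_tensor \<Rightarrow>
    ('v::euclidean_space \<Rightarrow> 'v \<Rightarrow> 'v) \<Rightarrow> ('v \<Rightarrow> 'm vfield) \<Rightarrow> bool" where
  "euclidean_lie_action A g br \<rho> \<longleftrightarrow> euclidean_lie_algebra br \<and> linear \<rho> \<and>
     (\<forall>x. \<rho> x \<in> vector_fields A UNIV) \<and>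
     (\<forall>x y. \<rho> (br x y) = lie_bracket A (\<rho> x) (\<rho> y)) \<and>
     (\<forall>p x y. g p (\<rho> x p) (\<rho> y p) = inner x y)"

definition abelian_bracket :: "'v::real_vector \<Rightarrow> 'v \<Rightarrow> 'v" where
  "abelian_bracket x y = 0"

end

theory Submission
  imports Defs
begin

text \<open>The bilinears have values in the directions \<open>F\<close> along which Clifford
  multiplication preserves the space \<open>L\<close> of values of the parallel spinors.  The dilatino operator
  \<open>Q = cl(d\<Phi>) - cl(H)/12\<close> kills \<open>L\<close>, hence so do $\{Q, cl(u)\}$ and $[\{Q, cl(u)\}, cl(w)]$ for
  \<open>u, w\<close> in \<open>F\<close>.  The latter is a multiple of $cl(i_w i_u H)$, so $i_w i_u H = 0$.  As the
  bracket of two $\hat\nabla$-parallel fields is $-\vec H(X, Y)$, bilinears commute.  Their inner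
  products are constant because $\hat\nabla$ is metric and the manifold is connected, so the dimension
  of the span of the bilinears can be read off at one point.\<close>

section \<open>The Clifford action on polyforms\<close>

text \<open>The parallel spinors are known only up to a spin frame change \<open>s\<close> that
  depends on the point, with no control over how. So no adapted frame is built: each pointwise
  argument is made for the image of \<open>L\<close> under \<open>s\<close>, and only conclusions
  that do not depend on \<open>s\<close>, such as a vanishing contraction of \<open>H\<close> or an
  inner product of bilinear vectors, are compared between points. The directions \<open>F\<close>
  are stable for a simple reason. In the listed representatives each frame direction either permutes
  the spinors up to complex factors or sends \<open>L\<close> into its orthogonal complement.
  Bilinear vectors therefore have components only in the directions of the first kind, the set
  \<open>I\<close>, and the dimensions 1, 2, 4 are the sizes of \<open>I\<close>. That nothing else
  occurs away from the chosen point follows from lengths alone: a parallel field that has the same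
  length as its projection onto an orthonormal parallel family at one point has it everywhere, and
  so equals the projection.\<close>

lemma exhaust_8: fixes x :: 8
  shows "x = 1 \<or> x = 2 \<or> x = 3 \<or> x = 4 \<or> x = 5 \<or> x = 6 \<or> x = 7 \<or> x = 8"
proof (cases x)
  case (of_int z)
  then have "z = 0 \<or> z = 1 \<or> z = 2 \<or> z = 3 \<or> z = 4 \<or> z = 5 \<or> z = 6 \<or> z = 7" by auto
  then show ?thesis using of_int by auto
qed

lemma pos_eq:
  assumes "0 < n" "of_nat n = k" "\<And>m. 0 < m \<Longrightarrow> m < n \<Longrightarrow> of_nat m \<noteq> k"
  shows "pos k = n"
  unfolding pos_def using assms by (intro Least_equality) (auto simp: not_less[symmetric])

lemma pos_8 [simp]: "pos (1::8) = 1" "pos (2::8) = 2" "pos (3::8) = 3" "pos (4::8) = 4"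
  "pos (5::8) = 5" "pos (6::8) = 6" "pos (7::8) = 7" "pos (8::8) = 8"
  by (rule pos_eq; auto simp: less_Suc_eq numeral_eq_Suc)+

lemma pos_4 [simp]: "pos (1::4) = 1" "pos (2::4) = 2" "pos (3::4) = 3" "pos (4::4) = 4"
  by (rule pos_eq; auto simp: less_Suc_eq numeral_eq_Suc)+

lemma pos_inj_4: "pos (i::4) = pos j \<longleftrightarrow> i = j"
  using exhaust_4[of i] exhaust_4[of j] by auto

lemma distinct_4 [simp]: "(1::4) \<noteq> 2" "(1::4) \<noteq> 3" "(1::4) \<noteq> 4" "(2::4) \<noteq> 3" "(2::4) \<noteq> 4" "(3::4) \<noteq> 4"
  "(2::4) \<noteq> 1" "(3::4) \<noteq> 1" "(4::4) \<noteq> 1" "(3::4) \<noteq> 2" "(4::4) \<noteq> 2" "(4::4) \<noteq> 3"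
  by (auto simp flip: pos_inj_4)

text \<open>The effect of one gamma matrix on index sets: wedging adds the index and inner
  derivation removes it.\<close>

definition toggle :: "'a \<Rightarrow> 'a set \<Rightarrow> 'a set" where
  "toggle k S = (if k \<in> S then S - {k} else insert k S)"

lemma mem_toggle: "j \<in> toggle k S \<longleftrightarrow> (if j = k then j \<notin> S else j \<in> S)"
  by (auto simp: toggle_def)

lemma toggle_toggle [simp]: "toggle k (toggle k S) = S"
  by (auto simp: toggle_def)

lemma toggle_commute: "toggle j (toggle k S) = toggle k (toggle j S)"
  by (auto simp: set_eq_iff mem_toggle)

text \<open>\<open>Gam a\<close> and \<open>Gam (a + 4)\<close> act on the same complex direction and differ by a phase.\<close>
definition cidx :: "8 \<Rightarrow> 4" where
  "cidx a = (if pos a \<le> 4 then of_nat (pos a) else of_nat (pos a - 4))"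

definition phase :: "8 \<Rightarrow> 4 set \<Rightarrow> complex" where
  "phase a S = (if pos a \<le> 4 then 1 else if cidx a \<in> S then \<i> else - \<i>)"

lemma cidx_simps [simp]: "cidx 1 = 1" "cidx 2 = 2" "cidx 3 = 3" "cidx 4 = 4"
  "cidx 5 = 1" "cidx 6 = 2" "cidx 7 = 3" "cidx 8 = 4"
  by (simp_all add: cidx_def)

lemma cidx_inj: "cidx a = cidx b \<Longrightarrow> (pos a \<le> 4 \<longleftrightarrow> pos b \<le> 4) \<Longrightarrow> a = b"
  using exhaust_8[of a] exhaust_8[of b] by (elim disjE) (simp_all)

lemma koszul_sign_empty [simp]: "koszul_sign k {} = 1"
  by (simp add: koszul_sign_def)

lemma koszul_sign_insert:
  assumes "j \<notin> S"
  shows "koszul_sign k (insert j S) = (if pos j < pos k then - koszul_sign k S else koszul_sign k S)"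
proof -
  have "{i \<in> insert j S. pos i < pos k} =
      (if pos j < pos k then insert j {i \<in> S. pos i < pos k} else {i \<in> S. pos i < pos k})" by auto
  then show ?thesis using assms by (simp add: koszul_sign_def)
qed

text \<open>The sign counts the elements below \<open>k\<close> modulo 2, so only toggling a smaller
  index matters.\<close>

lemma koszul_sign_toggle:
  "koszul_sign k (toggle j S) = (if pos j < pos k then - koszul_sign k S else koszul_sign k S)"
proof (cases "j \<in> S")
  case True
  then have "S = insert j (S - {j})" by auto
  then show ?thesis using koszul_sign_insert[of j "S - {j}" k] True by (auto simp: toggle_def)
qed (simp add: koszul_sign_insert toggle_def)

lemma koszul_sign_square [simp]: "koszul_sign k S * koszul_sign k S = 1"
  by (simp add: koszul_sign_def flip: power_mult_distrib)

lemma cnj_koszul_sign [simp]: "cnj (koszul_sign k S) = koszul_sign k S"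
  by (simp add: koszul_sign_def)

text \<open>At each \<open>S\<close> only one of the two terms of \<open>Gam\<close> survives, the
  exterior one if the index lies in \<open>S\<close> and the inner derivation otherwise. Hence
  \<open>Gam a\<close> permutes coefficients up to factors, and the Clifford relations reduce to
  bookkeeping of \<open>phase\<close> and \<open>koszul_sign\<close>.\<close>

lemma Gam_nth: "Gam a \<zeta> $ S = phase a S * koszul_sign (cidx a) S * \<zeta> $ toggle (cidx a) S"
  by (auto simp: Gam_def ext_mult_def inner_derivation_def phase_def cidx_def toggle_def)

lemma phase_toggle: "phase a (toggle (cidx b) S) = (if cidx a = cidx b then cnj (phase a S) else phase a S)"
  by (auto simp: phase_def mem_toggle)

lemma phase_square [simp]: "phase a S * cnj (phase a S) = 1"
  by (simp add: phase_def)

text \<open>The two Koszul signs agree and cancel, so only phases remain. This covers both the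
  square of a generator and the product of the two generators over one complex direction.\<close>

lemma Gam_Gam_same_idx:
  assumes "cidx a = cidx b"
  shows "Gam a (Gam b \<zeta>) $ S = phase a S * phase b (toggle (cidx b) S) * \<zeta> $ S"
proof -
  have "Gam a (Gam b \<zeta>) $ S = (phase a S * phase b (toggle (cidx b) S)) *
      (koszul_sign (cidx b) S * koszul_sign (cidx b) S) * \<zeta> $ S"
    unfolding Gam_nth assms koszul_sign_toggle by (simp only: toggle_toggle less_irrefl if_False mult_ac)
  then show ?thesis by simp
qed

lemma Gam_Gam: "Gam a (Gam a \<zeta>) = \<zeta>"
  by (simp add: vec_eq_iff Gam_Gam_same_idx phase_toggle)

text \<open>Over one complex direction one phase is 1 and the other is i or -i, with its sign
  flipped by the toggle. Over two different directions, toggling the smaller index flips the Koszul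
  sign of the larger but not conversely, so the two orders differ by a sign.\<close>

lemma Gam_anticommute:
  assumes "a \<noteq> b" shows "Gam a (Gam b \<zeta>) = - Gam b (Gam a \<zeta>)"
proof (cases "cidx a = cidx b")
  case True
  then have *: "(pos a \<le> 4) = (\<not> pos b \<le> 4)" using cidx_inj assms by blast
  have "phase a S * phase b (toggle (cidx b) S) = - (phase b S * phase a (toggle (cidx a) S))" for S
    using True * by (cases "pos a \<le> 4") (auto simp: phase_def mem_toggle)
  then show ?thesis using True by (simp add: vec_eq_iff Gam_Gam_same_idx)
next
  case False
  then have "pos (cidx a) < pos (cidx b) \<or> pos (cidx b) < pos (cidx a)"
    using pos_inj_4 nat_neq_iff by blast
  then have "Gam a (Gam b \<zeta>) $ S = - Gam b (Gam a \<zeta>) $ S" for S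
    using False by (auto simp: Gam_nth koszul_sign_toggle phase_toggle toggle_commute[of "cidx a"])
  then show ?thesis by (simp add: vec_eq_iff)
qed

lemma Gam_clifford: "Gam a (Gam b \<zeta>) + Gam b (Gam a \<zeta>) = (if a = b then 2 else 0) *\<^sub>R \<zeta>"
  using Gam_anticommute[of a b \<zeta>] by (auto simp: Gam_Gam scaleR_2)

lemma Gam_scale: "Gam a (c *s \<zeta>) = c *s Gam a \<zeta>"
  by (simp add: vec_eq_iff Gam_nth)

lemma linear_Gam: "linear (Gam a)"
  by (rule linearI) (simp_all add: vec_eq_iff Gam_nth distrib_left)

lemmas Gam_linear = linear_add[OF linear_Gam] linear_diff[OF linear_Gam] linear_cmul[OF linear_Gam]
  linear_neg[OF linear_Gam] linear_0[OF linear_Gam] linear_sum[OF linear_Gam]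

lemma inner_complex_mult: "inner (c * z) w = inner z (cnj c * w)" for z w c :: complex
  by (simp add: inner_complex_def algebra_simps)

text \<open>Reindexing by the toggle exchanges the two coefficients that \<open>Gam a\<close> links.
  It conjugates the phase and keeps the Koszul sign, which is what moving a factor across the real
  inner product requires.\<close>

lemma inner_Gam: "inner (Gam a \<zeta>) \<xi> = inner \<zeta> (Gam a \<xi>)"
proof -
  let ?t = "toggle (cidx a)"
  have "inner (Gam a \<zeta>) \<xi> = (\<Sum>S\<in>UNIV. inner (Gam a \<zeta> $ ?t S) (\<xi> $ ?t S))"
    unfolding inner_vec_def
    by (rule sum.reindex_bij_witness[of _ ?t ?t]) auto
  also have "\<dots> = (\<Sum>S\<in>UNIV. inner (\<zeta> $ S) (Gam a \<xi> $ S))"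
    by (rule sum.cong)
      (simp_all add: Gam_nth phase_toggle koszul_sign_toggle inner_complex_mult flip: mult.assoc)
  finally show ?thesis by (simp add: inner_vec_def)
qed

subsection \<open>Clifford elements of forms\<close>

lemma cl1_linear:
  "cl1 w (\<zeta> + \<xi>) = cl1 w \<zeta> + cl1 w \<xi>" "cl1 w (\<zeta> - \<xi>) = cl1 w \<zeta> - cl1 w \<xi>"
  "cl1 w (c *\<^sub>R \<zeta>) = c *\<^sub>R cl1 w \<zeta>" "cl1 w (- \<zeta>) = - cl1 w \<zeta>" "cl1 w 0 = 0"
  by (simp_all add: cl1_def Gam_linear scaleR_add_right scaleR_diff_right sum.distrib sum_subtractf
      scaleR_sum_right sum_negf mult.commute)

lemma cl1_clifford:
  "cl1 v (cl1 w \<zeta>) + cl1 w (cl1 v \<zeta>) = (2 * (\<Sum>a\<in>UNIV. v a * w a)) *\<^sub>R \<zeta>"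
proof -
  have "cl1 v (cl1 w \<zeta>) = (\<Sum>a\<in>UNIV. \<Sum>b\<in>UNIV. (v a * w b) *\<^sub>R Gam a (Gam b \<zeta>))"
    by (simp add: cl1_def Gam_linear scaleR_sum_right)
  moreover have "cl1 w (cl1 v \<zeta>) = (\<Sum>a\<in>UNIV. \<Sum>b\<in>UNIV. (v a * w b) *\<^sub>R Gam b (Gam a \<zeta>))"
    by (subst sum.swap) (simp add: cl1_def Gam_linear scaleR_sum_right mult.commute)
  ultimately have "cl1 v (cl1 w \<zeta>) + cl1 w (cl1 v \<zeta>) =
      (\<Sum>a\<in>UNIV. \<Sum>b\<in>UNIV. (v a * w b) *\<^sub>R (Gam a (Gam b \<zeta>) + Gam b (Gam a \<zeta>)))"
    by (simp add: scaleR_add_right sum.distrib)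
  also have "\<dots> = (\<Sum>a\<in>UNIV. \<Sum>b\<in>UNIV. if b = a then (2 * (v a * w a)) *\<^sub>R \<zeta> else 0)"
    unfolding Gam_clifford by (intro sum.cong) auto
  also have "\<dots> = (2 * (\<Sum>a\<in>UNIV. v a * w a)) *\<^sub>R \<zeta>"
    by (simp add: sum_distrib_left scaleR_sum_left)
  finally show ?thesis .
qed

lemma cl1_cl1: "cl1 w (cl1 w \<zeta>) = (\<Sum>a\<in>UNIV. (w a)\<^sup>2) *\<^sub>R \<zeta>"
proof -
  have "2 *\<^sub>R cl1 w (cl1 w \<zeta>) = 2 *\<^sub>R ((\<Sum>a\<in>UNIV. (w a)\<^sup>2) *\<^sub>R \<zeta>)"
    by (simp only: scaleR_2[of "cl1 _ _"] cl1_clifford scaleR_scaleR power2_eq_square)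
  then show ?thesis by (simp only: scaleR_cancel_left) simp
qed

text \<open>\<open>cl1 w\<close> squares to the squared length of \<open>w\<close>, so a single
  nonzero spinor in its kernel is enough. This closes the algebraic vanishing argument.\<close>

lemma cl1_eq_0D:
  assumes "cl1 w \<zeta> = 0" "\<zeta> \<noteq> 0" shows "w a = 0"
proof -
  have "(\<Sum>a\<in>UNIV. (w a)\<^sup>2) *\<^sub>R \<zeta> = 0" using assms cl1_cl1[of w \<zeta>] by (simp add: cl1_linear)
  then have "(\<Sum>a\<in>UNIV. (w a)\<^sup>2) = 0" using assms by simp
  then show ?thesis by (simp add: sum_nonneg_eq_0_iff)
qed

lemma inner_cl1: "inner (cl1 w \<zeta>) \<xi> = inner \<zeta> (cl1 w \<xi>)"
  by (simp add: cl1_def inner_sum_left inner_sum_right inner_Gam)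

text \<open>Moving \<open>Gam m\<close> across two factors uses two Clifford relations. Each leaves
  one contraction of \<open>f\<close> with \<open>m\<close>, and skewness makes both contribute the
  same 2, whence 4.\<close>

lemma cl2_Gam_commutator:
  assumes anti: "\<And>a b. f a b = - f b a"
  shows "cl2 f (Gam m \<zeta>) - Gam m (cl2 f \<zeta>) = - (4 *\<^sub>R cl1 (f m) \<zeta>)"
proof -
  have *: "Gam a (Gam b (Gam m \<zeta>)) - Gam m (Gam a (Gam b \<zeta>)) =
      (if b = m then 2 else 0) *\<^sub>R Gam a \<zeta> - (if a = m then 2 else 0) *\<^sub>R Gam b \<zeta>" for a b
  proof -
    \<comment> \<open>Here \<open>y\<close> is the product with \<open>Gam m\<close> in the middle;
      it cancels between the two Clifford relations.\<close>
    have alg: "x + y = p \<Longrightarrow> y + z = q \<Longrightarrow> x - z = p - q" for x y z p q :: spinor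
      by auto
    show ?thesis
      by (rule alg[OF _ Gam_clifford]) (simp only: Gam_clifford flip: Gam_linear)
  qed
  have "cl2 f (Gam m \<zeta>) - Gam m (cl2 f \<zeta>) = (\<Sum>a\<in>UNIV. \<Sum>b\<in>UNIV. f a b *\<^sub>R
      (Gam a (Gam b (Gam m \<zeta>)) - Gam m (Gam a (Gam b \<zeta>))))"
    by (simp add: cl2_def Gam_linear scaleR_diff_right sum_subtractf)
  also have "\<dots> = (\<Sum>a\<in>UNIV. \<Sum>b\<in>UNIV. (if b = m then (2 * f a m) *\<^sub>R Gam a \<zeta> else 0))
      - (\<Sum>a\<in>UNIV. \<Sum>b\<in>UNIV. (if a = m then (2 * f m b) *\<^sub>R Gam b \<zeta> else 0))"
    unfolding * by (simp only: scaleR_diff_right sum_subtractf)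
      (intro arg_cong2[where f="(-)"] sum.cong; simp)
  also have "(\<Sum>a\<in>UNIV. \<Sum>b\<in>UNIV. (if a = m then (2 * f m b) *\<^sub>R Gam b \<zeta> else 0)) =
      (\<Sum>b\<in>UNIV. \<Sum>a\<in>UNIV. (if a = m then (2 * f m b) *\<^sub>R Gam b \<zeta> else 0))" by (rule sum.swap)
  also have "(\<Sum>a\<in>UNIV. \<Sum>b\<in>UNIV. (if b = m then (2 * f a m) *\<^sub>R Gam a \<zeta> else 0)) - \<dots> =
      - (2 *\<^sub>R cl1 (f m) \<zeta>) - 2 *\<^sub>R cl1 (f m) \<zeta>"
    by (simp add: cl1_def anti[of _ m] scaleR_sum_right sum_negf)
  also have "\<dots> = - (4 *\<^sub>R cl1 (f m) \<zeta>)"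
    using scaleR_add_left[of 2 2 "cl1 (f m) \<zeta>"] by simp
  finally show ?thesis .
qed

text \<open>Crossing three factors changes the sign three times, so an anticommutator appears. The
  three contractions coincide by antisymmetry and give three times 2.\<close>

lemma cl3_Gam_anticommutator:
  assumes anti: "\<And>a b c. h a b c = - h b a c" "\<And>a b c. h a b c = - h a c b"
  shows "cl3 h (Gam m \<zeta>) + Gam m (cl3 h \<zeta>) = 6 *\<^sub>R cl2 (h m) \<zeta>"
proof -
  have *: "Gam a (Gam b (Gam c (Gam m \<zeta>))) + Gam m (Gam a (Gam b (Gam c \<zeta>))) =
      (if c = m then 2 else 0) *\<^sub>R Gam a (Gam b \<zeta>) - (if b = m then 2 else 0) *\<^sub>R Gam a (Gam c \<zeta>)
      + (if a = m then 2 else 0) *\<^sub>R Gam b (Gam c \<zeta>)" for a b c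
  proof -
    have alg: "x + y = p \<Longrightarrow> y + z = q \<Longrightarrow> z + w = r \<Longrightarrow> x + w = p - q + r" for x y z w p q r :: spinor
      by auto
    show ?thesis
      by (rule alg[where y = "Gam a (Gam b (Gam m (Gam c \<zeta>)))", OF _ _ Gam_clifford]) (simp_all only: Gam_clifford flip: Gam_linear)
  qed
  \<comment> \<open>Bringing the contracted index to the front takes two transpositions from the
    last slot and one from the middle slot; these signs undo the alternating signs of the expansion
    above.\<close>
  have c: "h a b m = h m a b" "h a m b = - h m a b" for a b
    using anti(2)[of a b m] anti(1)[of a m b] by simp_all
  have k: "h a b c * (if c = m then 2 else 0) = (if c = m then 2 * h m a b else 0)"
    "h a b c * (if b = m then 2 else 0) = - (if b = m then 2 * h m a c else 0)"
    "h a b c * (if a = m then 2 else 0) = (if a = m then 2 * h m b c else 0)" for a b c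
    using c[of a b] c[of a c] by auto
  have t: "h a b c *\<^sub>R ((if c = m then 2 else 0) *\<^sub>R x - (if b = m then 2 else 0) *\<^sub>R y
      + (if a = m then 2 else 0) *\<^sub>R z) = (if c = m then (2 * h m a b) *\<^sub>R x else 0)
      + (if b = m then (2 * h m a c) *\<^sub>R y else 0) + (if a = m then (2 * h m b c) *\<^sub>R z else 0)"
    for a b c and x y z :: spinor
    unfolding scaleR_add_right scaleR_diff_right scaleR_scaleR k by simp
  have "cl3 h (Gam m \<zeta>) + Gam m (cl3 h \<zeta>) = (\<Sum>a\<in>UNIV. \<Sum>b\<in>UNIV. \<Sum>c\<in>UNIV. h a b c *\<^sub>R
      (Gam a (Gam b (Gam c (Gam m \<zeta>))) + Gam m (Gam a (Gam b (Gam c \<zeta>)))))"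
    by (simp add: cl3_def Gam_linear scaleR_add_right sum.distrib)
  also have "\<dots> = (\<Sum>a\<in>UNIV. \<Sum>b\<in>UNIV. \<Sum>c\<in>UNIV. if c = m then (2 * h m a b) *\<^sub>R Gam a (Gam b \<zeta>) else 0)
      + (\<Sum>a\<in>UNIV. \<Sum>b\<in>UNIV. \<Sum>c\<in>UNIV. if b = m then (2 * h m a c) *\<^sub>R Gam a (Gam c \<zeta>) else 0)
      + (\<Sum>a\<in>UNIV. \<Sum>b\<in>UNIV. \<Sum>c\<in>UNIV. if a = m then (2 * h m b c) *\<^sub>R Gam b (Gam c \<zeta>) else 0)"
    unfolding * sum.distrib[symmetric] by (intro sum.cong; simp only: t)
  also have "(\<Sum>a\<in>UNIV. \<Sum>b\<in>UNIV. \<Sum>c\<in>UNIV. if b = m then (2 * h m a c) *\<^sub>R Gam a (Gam c \<zeta>) else 0)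
     = (\<Sum>a\<in>UNIV. \<Sum>c\<in>UNIV. \<Sum>b\<in>UNIV. if b = m then (2 * h m a c) *\<^sub>R Gam a (Gam c \<zeta>) else 0)"
    by (rule sum.cong[OF HOL.refl], rule sum.swap)
  also have "(\<Sum>a\<in>UNIV. \<Sum>b\<in>UNIV. \<Sum>c\<in>UNIV. if a = m then (2 * h m b c) *\<^sub>R Gam b (Gam c \<zeta>) else 0)
     = (\<Sum>b\<in>UNIV. \<Sum>c\<in>UNIV. \<Sum>a\<in>UNIV. if a = m then (2 * h m b c) *\<^sub>R Gam b (Gam c \<zeta>) else 0)"
    by (subst sum.swap, rule sum.cong[OF HOL.refl], rule sum.swap)
  also have "(\<Sum>a\<in>UNIV. \<Sum>b\<in>UNIV. \<Sum>c\<in>UNIV. if c = m then (2 * h m a b) *\<^sub>R Gam a (Gam b \<zeta>) else 0)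
      + (\<Sum>a\<in>UNIV. \<Sum>c\<in>UNIV. \<Sum>b\<in>UNIV. if b = m then (2 * h m a c) *\<^sub>R Gam a (Gam c \<zeta>) else 0)
      + (\<Sum>b\<in>UNIV. \<Sum>c\<in>UNIV. \<Sum>a\<in>UNIV. if a = m then (2 * h m b c) *\<^sub>R Gam b (Gam c \<zeta>) else 0)
      = 2 *\<^sub>R cl2 (h m) \<zeta> + 2 *\<^sub>R cl2 (h m) \<zeta> + 2 *\<^sub>R cl2 (h m) \<zeta>"
    by (simp add: cl2_def scaleR_sum_right)
  also have "\<dots> = 6 *\<^sub>R cl2 (h m) \<zeta>"
    using scaleR_add_left[of 2 2 "cl2 (h m) \<zeta>"] scaleR_add_left[of 4 2 "cl2 (h m) \<zeta>"] by simp
  finally show ?thesis .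
qed

lemma sum_apply: "(\<Sum>a\<in>A. f a) x = (\<Sum>a\<in>A. f a x)" for f :: "'a \<Rightarrow> 'b \<Rightarrow> 'c::comm_monoid_add"
  by (induct A rule: infinite_finite_induct) simp_all

lemma scaleR_apply: "(c *\<^sub>R f) x = c *\<^sub>R f x"
  by (simp add: scaleR_fun_def)

text \<open>\<open>contract u f\<close> is the interior product $i_u f$, in components.\<close>
definition contract :: "('a::finite \<Rightarrow> real) \<Rightarrow> ('a \<Rightarrow> 'b::real_vector) \<Rightarrow> 'b" where
  "contract u f = (\<Sum>a\<in>UNIV. u a *\<^sub>R f a)"

lemma contract_apply: "contract u f b = (\<Sum>a\<in>UNIV. u a *\<^sub>R f a b)"
  by (simp add: contract_def sum_apply scaleR_apply)

lemma cl2_cl1_commutator: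
  assumes "\<And>a b. f a b = - f b a"
  shows "cl2 f (cl1 u \<zeta>) - cl1 u (cl2 f \<zeta>) = - (4 *\<^sub>R cl1 (contract u f) \<zeta>)"
proof -
  have lin: "cl2 f (\<Sum>a\<in>A. c a *\<^sub>R x a) = (\<Sum>a\<in>A. c a *\<^sub>R cl2 f (x a))" for c x and A :: "8 set"
    by (induct A rule: infinite_finite_induct)
      (simp_all add: cl2_def Gam_linear scaleR_add_right sum.distrib scaleR_sum_right mult.commute)
  have "cl2 f (cl1 u \<zeta>) - cl1 u (cl2 f \<zeta>) = (\<Sum>a\<in>UNIV. u a *\<^sub>R (cl2 f (Gam a \<zeta>) - Gam a (cl2 f \<zeta>)))"
    by (simp add: cl1_def[of u] lin scaleR_diff_right sum_subtractf)
  also have "\<dots> = - (4 *\<^sub>R (\<Sum>a\<in>UNIV. u a *\<^sub>R cl1 (f a) \<zeta>))"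
    unfolding cl2_Gam_commutator[OF assms] by (simp add: sum_negf scaleR_sum_right mult.commute)
  also have "(\<Sum>a\<in>UNIV. u a *\<^sub>R cl1 (f a) \<zeta>) = cl1 (contract u f) \<zeta>"
    unfolding cl1_def contract_apply scaleR_sum_right
    by (subst sum.swap) (simp add: scaleR_sum_left)
  finally show ?thesis .
qed

lemma cl3_cl1_anticommutator:
  assumes "\<And>a b c. h a b c = - h b a c" "\<And>a b c. h a b c = - h a c b"
  shows "cl3 h (cl1 u \<zeta>) + cl1 u (cl3 h \<zeta>) = 6 *\<^sub>R cl2 (contract u h) \<zeta>"
proof -
  have lin: "cl3 h (\<Sum>a\<in>A. c a *\<^sub>R x a) = (\<Sum>a\<in>A. c a *\<^sub>R cl3 h (x a))" for c x and A :: "8 set"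
    by (induct A rule: infinite_finite_induct)
      (simp_all add: cl3_def Gam_linear scaleR_add_right sum.distrib scaleR_sum_right mult.commute)
  have "cl3 h (cl1 u \<zeta>) + cl1 u (cl3 h \<zeta>) = (\<Sum>a\<in>UNIV. u a *\<^sub>R (cl3 h (Gam a \<zeta>) + Gam a (cl3 h \<zeta>)))"
    by (simp add: cl1_def lin scaleR_add_right sum.distrib)
  also have "\<dots> = 6 *\<^sub>R (\<Sum>a\<in>UNIV. u a *\<^sub>R cl2 (h a) \<zeta>)"
    unfolding cl3_Gam_anticommutator[OF assms] by (simp add: scaleR_sum_right mult.commute)
  also have "(\<Sum>a\<in>UNIV. u a *\<^sub>R cl2 (h a) \<zeta>) = cl2 (contract u h) \<zeta>"
  proof -
    have "(\<Sum>a\<in>UNIV. u a *\<^sub>R cl2 (h a) \<zeta>) =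
        (\<Sum>b\<in>UNIV. \<Sum>a\<in>UNIV. \<Sum>c\<in>UNIV. (u a * h a b c) *\<^sub>R Gam b (Gam c \<zeta>))"
      by (subst sum.swap) (simp add: cl2_def scaleR_sum_right)
    also have "\<dots> = (\<Sum>b\<in>UNIV. \<Sum>c\<in>UNIV. \<Sum>a\<in>UNIV. (u a * h a b c) *\<^sub>R Gam b (Gam c \<zeta>))"
      by (rule sum.cong[OF HOL.refl], rule sum.swap)
    finally show ?thesis by (simp add: cl2_def contract_apply sum_apply scaleR_apply scaleR_sum_left)
  qed
  finally show ?thesis .
qed

text \<open>If \<open>Q = cl(\<phi>) - cl(h)/12\<close> kills a space of spinors that is stable under \<open>cl(u)\<close>
  and \<open>cl(w)\<close>, then so do the anticommutator \<open>{Q, cl(u)}\<close> and its commutator with \<open>cl(w)\<close>,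
  which is a multiple of \<open>cl(i_w i_u h)\<close>.\<close>
lemma contract_three_form_eq_0:
  assumes anti: "\<And>a b c. h a b c = - h b a c" "\<And>a b c. h a b c = - h a c b"
    and Q: "\<And>\<zeta>. \<zeta> \<in> L \<Longrightarrow> cl1 \<phi> \<zeta> - (1/12) *\<^sub>R cl3 h \<zeta> = 0"
    and u: "\<And>\<zeta>. \<zeta> \<in> L \<Longrightarrow> cl1 u \<zeta> \<in> L" and w: "\<And>\<zeta>. \<zeta> \<in> L \<Longrightarrow> cl1 w \<zeta> \<in> L"
    and "\<eta> \<in> L" "\<eta> \<noteq> 0"
  shows "contract w (contract u h) c = 0"
proof -
  \<comment> \<open>The anticommutator of \<open>cl1 \<phi>\<close> and \<open>cl1 u\<close> is the
    scalar \<open>k\<close>; the weights 12 and 6 then make the two-form act on \<open>L\<close> as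
    twice \<open>k\<close>. A scalar commutes with \<open>cl1 w\<close>, which the second step
    exploits.\<close>
  define k where "k = 2 * (\<Sum>a\<in>UNIV. \<phi> a * u a)"
  have 1: "cl2 (contract u h) \<zeta> = (2 * k) *\<^sub>R \<zeta>" if "\<zeta> \<in> L" for \<zeta>
  proof -
    have "cl3 h \<xi> = 12 *\<^sub>R cl1 \<phi> \<xi>" if "\<xi> \<in> L" for \<xi> using Q[OF that] by simp
    then have "6 *\<^sub>R cl2 (contract u h) \<zeta> = 12 *\<^sub>R (cl1 \<phi> (cl1 u \<zeta>) + cl1 u (cl1 \<phi> \<zeta>))"
      using cl3_cl1_anticommutator[where h = h and u = u and \<zeta> = \<zeta>, OF anti] u that
      by (simp add: cl1_linear scaleR_add_right)
    also have "\<dots> = 6 *\<^sub>R ((2 * k) *\<^sub>R \<zeta>)" by (simp add: cl1_clifford k_def)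
    finally show ?thesis by (simp only: scaleR_cancel_left) simp
  qed
  have skew: "contract u h a b = - contract u h b a" for a b
    by (simp add: contract_apply sum_apply scaleR_apply anti(2)[of _ a b] flip: sum_negf)
  have "cl2 (contract u h) (cl1 w \<eta>) - cl1 w (cl2 (contract u h) \<eta>) = 0"
    using 1[OF \<open>\<eta> \<in> L\<close>] 1[OF w[OF \<open>\<eta> \<in> L\<close>]] by (simp add: cl1_linear)
  then have "cl1 (contract w (contract u h)) \<eta> = 0"
    unfolding cl2_cl1_commutator[where f = "contract u h" and u = w and \<zeta> = \<eta>, OF skew] by simp
  then show ?thesis using cl1_eq_0D \<open>\<eta> \<noteq> 0\<close> by blast
qed

subsection \<open>The spin group\<close>

text \<open>The covering of the rotations, by induction on the word of unit vectors. Conjugating by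
  a unit vector \<open>u\<close> turns the Clifford element of \<open>w\<close> into that of minus
  the reflection of \<open>w\<close> in the hyperplane normal to \<open>u\<close>; this is
  \<open>\<rho>\<close>. Each new pair acts before \<open>s\<close>, hence the order of
  composition.\<close>

lemma Spin8_rotation:
  assumes "s \<in> Spin8"
  shows "linear s \<and> (\<forall>\<zeta> \<xi>. inner (s \<zeta>) (s \<xi>) = inner \<zeta> \<xi>) \<and>
    (\<exists>R. orthogonal_transformation R \<and> (\<forall>w \<zeta>. cl1 (($) (R w)) (s \<zeta>) = s (cl1 (($) w) \<zeta>)))"
  using assms
proof induction
  case 1
  have "orthogonal_transformation (id :: real^8 \<Rightarrow> real^8)" by (simp add: orthogonal_transformation_def linear_id)
  then show ?case using linear_ident by (auto intro!: exI[of _ id])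
next
  case (2 s u v)
  define \<rho> where "\<rho> u w = (2 * inner u w) *\<^sub>R u - w" for u w :: "real^8"
  have sq: "(\<Sum>a\<in>UNIV. (u $ a)\<^sup>2) = 1" if "norm u = 1" for u :: "real^8"
    using that by (simp add: norm_eq_1 inner_vec_def power2_eq_square)
  have \<rho>: "cl1 (($) (\<rho> u w)) (cl1 (($) u) \<zeta>) = cl1 (($) u) (cl1 (($) w) \<zeta>)" if "norm u = 1" for u w \<zeta>
  proof -
    have "cl1 (($) (\<rho> u w)) \<xi> = (2 * inner u w) *\<^sub>R cl1 (($) u) \<xi> - cl1 (($) w) \<xi>" for \<xi>
      by (simp add: cl1_def \<rho>_def scaleR_diff_left sum_subtractf scaleR_sum_right)
    moreover have "(2 * inner u w) *\<^sub>R \<zeta> = cl1 (($) u) (cl1 (($) w) \<zeta>) + cl1 (($) w) (cl1 (($) u) \<zeta>)"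
      by (simp add: cl1_clifford inner_vec_def)
    ultimately show ?thesis using sq[OF that] by (simp add: cl1_cl1)
  qed
  have orth: "orthogonal_transformation (\<rho> u)" if "norm u = 1" for u
  proof -
    have "inner u u = 1" using that by (simp add: norm_eq_1)
    then show ?thesis unfolding orthogonal_transformation_def
      by (auto intro!: linearI simp: \<rho>_def inner_diff inner_add_right algebra_simps inner_commute)
  qed
  have iso: "inner (cl1 (($) u) \<zeta>) (cl1 (($) u) \<xi>) = inner \<zeta> \<xi>" if "norm u = 1" for u :: "real^8" and \<zeta> \<xi>
    using sq[OF that] by (simp add: inner_cl1 cl1_cl1)
  obtain R where R: "orthogonal_transformation R" "\<And>w \<zeta>. cl1 (($) (R w)) (s \<zeta>) = s (cl1 (($) w) \<zeta>)"
    using 2 by blast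
  have "orthogonal_transformation (R \<circ> (\<rho> u \<circ> \<rho> v))"
    using orth 2 R by (intro orthogonal_transformation_compose) auto
  moreover have "cl1 (($) ((R \<circ> (\<rho> u \<circ> \<rho> v)) w)) (s (cl1 (($) u) (cl1 (($) v) \<zeta>)))
      = s (cl1 (($) u) (cl1 (($) v) (cl1 (($) w) \<zeta>)))" for w \<zeta>
    using 2 by (simp add: R \<rho>)
  moreover have "linear (\<lambda>\<zeta>. s (cl1 (($) u) (cl1 (($) v) \<zeta>)))"
    using 2 by (auto intro!: linearI simp: cl1_linear linear_add linear_cmul)
  moreover have "inner (s (cl1 (($) u) (cl1 (($) v) \<zeta>))) (s (cl1 (($) u) (cl1 (($) v) \<xi>))) = inner \<zeta> \<xi>" for \<zeta> \<xi>
    using 2 iso by simp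
  ultimately show ?case by blast
qed

subsection \<open>The listed spinors\<close>

lemma spinor_conj_linear:
  "spinor_conj (\<zeta> + \<xi>) = spinor_conj \<zeta> + spinor_conj \<xi>"
  "spinor_conj (c *s \<zeta>) = cnj c *s spinor_conj \<zeta>"
  "spinor_conj (r *\<^sub>R \<zeta>) = r *\<^sub>R spinor_conj \<zeta>"
proof -
  have "(\<chi> S. cnj ((\<zeta> + \<xi>) $ S)) = (\<chi> S. cnj (\<zeta> $ S)) + (\<chi> S. cnj (\<xi> $ S))"
    "(\<chi> S. cnj ((c *s \<zeta>) $ S)) = cnj c *s (\<chi> S. cnj (\<zeta> $ S))"
    "(\<chi> S. cnj ((r *\<^sub>R \<zeta>) $ S)) = r *\<^sub>R (\<chi> S. cnj (\<zeta> $ S))"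
    by (simp_all add: vec_eq_iff)
  then show "spinor_conj (\<zeta> + \<xi>) = spinor_conj \<zeta> + spinor_conj \<xi>"
    "spinor_conj (c *s \<zeta>) = cnj c *s spinor_conj \<zeta>"
    "spinor_conj (r *\<^sub>R \<zeta>) = r *\<^sub>R spinor_conj \<zeta>"
    unfolding spinor_conj_def by (simp_all only: Gam_linear Gam_scale)
qed

text \<open>Oriented by \<open>pos\<close>, so that rewriting sorts a product of gamma matrices and
  terminates.\<close>

lemma Gam_reorder: "pos a < pos b \<Longrightarrow> Gam b (Gam a \<zeta>) = - Gam a (Gam b \<zeta>)"
  by (rule Gam_anticommute) auto

text \<open>Complex conjugation fixes the first four gamma matrices and negates the last four. The
  product of the last four commutes with the former (four sign changes) and anticommutes with the
  latter (three), so the total sign is always plus.\<close>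

lemma spinor_conj_Gam: "spinor_conj (Gam a \<zeta>) = Gam a (spinor_conj \<zeta>)"
proof -
  define \<xi> :: spinor where "\<xi> = (\<chi> S. cnj (\<zeta> $ S))"
  have *: "(\<chi> S. cnj (Gam a \<zeta> $ S)) = (if pos a \<le> 4 then Gam a \<xi> else - Gam a \<xi>)"
    by (auto simp: vec_eq_iff Gam_nth phase_def \<xi>_def)
  show ?thesis
    unfolding spinor_conj_def * \<xi>_def[symmetric]
    using exhaust_8[of a] by (elim disjE) (simp_all add: Gam_reorder Gam_Gam Gam_linear)
qed

text \<open>The four gamma matrices in \<open>spinor_conj\<close> toggle each complex direction
  once, so index sets go to their complements.\<close>

lemma spinor_conj_nth: "\<exists>c. \<forall>\<zeta>. spinor_conj \<zeta> $ S = c * cnj (\<zeta> $ (- S))"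
proof -
  have "toggle (4::4) (toggle 3 (toggle 2 (toggle 1 S))) = - S"
    using exhaust_4 by (auto simp: set_eq_iff mem_toggle)
  then show ?thesis by (auto simp: spinor_conj_def Gam_nth mult.assoc)
qed

lemma real_part_scale: "real_part (c *s \<zeta>) = Re c *\<^sub>R real_part \<zeta> - Im c *\<^sub>R imag_part \<zeta>"
  by (simp add: vec_eq_iff real_part_def imag_part_def spinor_conj_linear)
    (simp add: complex_eq_iff field_simps)

lemma imag_part_scale: "imag_part (c *s \<zeta>) = Re c *\<^sub>R imag_part \<zeta> + Im c *\<^sub>R real_part \<zeta>"
  by (simp add: vec_eq_iff real_part_def imag_part_def spinor_conj_linear)
    (simp add: complex_eq_iff field_simps)

lemma Gam_real_part: "Gam a (real_part \<zeta>) = real_part (Gam a \<zeta>)"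
  by (simp add: real_part_def Gam_scale Gam_linear spinor_conj_Gam)

lemma Gam_imag_part: "Gam a (imag_part \<zeta>) = imag_part (Gam a \<zeta>)"
  by (simp add: imag_part_def Gam_scale Gam_linear spinor_conj_Gam)

text \<open>\<open>I\<close> indexes the frame directions that the bilinears of \<open>L\<close> span.\<close>
definition clifford_stable :: "8 set \<Rightarrow> spinor set \<Rightarrow> bool" where
  "clifford_stable I L \<longleftrightarrow> subspace L \<and> L \<noteq> {0} \<and> (\<forall>\<zeta>\<in>L. \<forall>a\<in>I. Gam a \<zeta> \<in> L) \<and>
     (\<forall>\<zeta>\<in>L. \<forall>\<xi>\<in>L. \<forall>k. k \<notin> I \<longrightarrow> inner \<zeta> (Gam k \<xi>) = 0)"

text \<open>It is enough to look at the listed complex spinors: gamma matrices commute with taking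
  real and imaginary parts, and a complex factor only recombines the two.\<close>

lemma listed_spinors_Gam:
  assumes L: "\<And>x. x \<in> L \<Longrightarrow> \<exists>c. \<exists>y\<in>L. Gam a x = c *s y" and "\<zeta> \<in> listed_spinors L"
  shows "Gam a \<zeta> \<in> listed_spinors L"
  using assms(2) unfolding listed_spinors_def
proof (induct rule: span_induct_alt)
  case base
  then show ?case by (simp add: Gam_linear span_zero)
next
  case (step r x y)
  obtain z where z: "z \<in> L" "x = real_part z \<or> x = imag_part z" using step(1) by auto
  obtain c y' where "y' \<in> L" "Gam a z = c *s y'" using L[OF z(1)] by blast
  moreover have base: "real_part w \<in> span (real_part ` L \<union> imag_part ` L)"
    "imag_part w \<in> span (real_part ` L \<union> imag_part ` L)" if "w \<in> L" for w
    using that by (auto intro: span_base)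
  ultimately have "Gam a x \<in> span (real_part ` L \<union> imag_part ` L)"
    using z(2) base by (auto simp: Gam_real_part Gam_imag_part real_part_scale imag_part_scale
        intro!: span_diff span_add span_scale)
  then show ?case using step(2) by (simp add: Gam_linear span_add span_scale)
qed

text \<open>Real and imaginary parts bring in the complementary index sets, hence the closure of
  \<open>P\<close> under complement.\<close>

lemma listed_spinors_support:
  assumes L: "\<And>x S. x \<in> L \<Longrightarrow> x $ S \<noteq> 0 \<Longrightarrow> P S" and P: "\<And>S. P (- S) = P S"
    and "\<zeta> \<in> listed_spinors L" "\<not> P S"
  shows "\<zeta> $ S = 0"
  using assms(3) unfolding listed_spinors_def
proof (induct rule: span_induct_alt)
  case (step r x y)
  have "spinor_conj z $ S = 0" "z $ S = 0" if "z \<in> L" for z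
    using spinor_conj_nth[of S] L[OF that, of S] L[OF that, of "- S"] P[of S] \<open>\<not> P S\<close> by auto
  then show ?case using step by (auto simp: real_part_def imag_part_def)
qed simp

lemma inner_Gam_support:
  assumes "\<And>S. \<not> P S \<Longrightarrow> \<zeta> $ S = 0" "\<And>S. \<not> P S \<Longrightarrow> \<xi> $ S = 0" "\<And>S. \<not> (P S \<and> P (toggle (cidx k) S))"
  shows "inner \<zeta> (Gam k \<xi>) = 0"
  unfolding inner_vec_def
proof (rule sum.neutral, rule ballI)
  fix S show "inner (\<zeta> $ S) (Gam k \<xi> $ S) = 0"
    using assms(1)[of S] assms(2)[of "toggle (cidx k) S"] assms(3)[of S] by (auto simp: Gam_nth)
qed

text \<open>\<open>P\<close> is a condition shared by the listed index sets and their complements. A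
  direction outside \<open>I\<close> leads out of \<open>P\<close>, so supports become disjoint and
  that component of every bilinear is zero.\<close>

lemma listed_e_wedge_stable:
  assumes tog: "\<And>S a. S \<in> W \<Longrightarrow> a \<in> I \<Longrightarrow> toggle (cidx a) S \<in> W"
    and P: "\<And>S. S \<in> W \<Longrightarrow> P S" "\<And>S. P (- S) = P S" "\<And>k S. k \<notin> I \<Longrightarrow> P S \<Longrightarrow> \<not> P (toggle (cidx k) S)"
    and "{} \<in> W"
  shows "clifford_stable I (listed_spinors (e_wedge ` W))"
proof -
  let ?L = "listed_spinors (e_wedge ` W)"
  have "\<exists>c. \<exists>y\<in>e_wedge ` W. Gam a x = c *s y" if x: "x \<in> e_wedge ` W" and a: "a \<in> I" for x a
  proof -
    obtain S where S: "S \<in> W" "x = e_wedge S" using x by blast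
    let ?T = "toggle (cidx a) S"
    have "Gam a x = (phase a ?T * koszul_sign (cidx a) ?T) *s e_wedge ?T"
      by (auto simp: vec_eq_iff Gam_nth S axis_def)
    then show ?thesis using tog[OF S(1) a] by blast
  qed
  then have "Gam a \<zeta> \<in> ?L" if "\<zeta> \<in> ?L" "a \<in> I" for a \<zeta>
    using listed_spinors_Gam that by blast
  moreover have "\<zeta> $ S = 0" if "\<zeta> \<in> ?L" "\<not> P S" for \<zeta> S
    using that by (rule listed_spinors_support[rotated 2]) (auto simp: P axis_def split: if_splits)
  then have "inner \<zeta> (Gam k \<xi>) = 0" if "\<zeta> \<in> ?L" "\<xi> \<in> ?L" "k \<notin> I" for \<zeta> \<xi> k
    using that P(3) by (intro inner_Gam_support[of P]) auto
  moreover have "real_part (e_wedge {}) \<in> ?L"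
    using \<open>{} \<in> W\<close> by (auto simp: listed_spinors_def intro: span_base)
  moreover have "real_part (e_wedge {}) \<noteq> 0"
  proof -
    \<comment> \<open>The empty set is not its own complement, so conjugation cannot cancel its
      coefficient.\<close>
    have "spinor_conj (e_wedge {}) $ {} = 0"
      using spinor_conj_nth[of "{}"] by (auto simp: axis_def)
    then have "real_part (e_wedge {}) $ {} \<noteq> 0" by (simp add: real_part_def axis_def)
    then show ?thesis by force
  qed
  ultimately show ?thesis
    unfolding clifford_stable_def by (auto simp: listed_spinors_def)
qed

text \<open>The listed polyforms use only the first two complex directions, so 3 and 4 are both
  absent, or both present in a complement. A single gamma matrix over direction 3 or 4 breaks
  this.\<close>

lemma SU2_stable:
  "clifford_stable {1,2,5,6} (listed_spinors {e_wedge {}, e_wedge {1,2}, e_wedge {1}, e_wedge {2}})"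
proof -
  have "clifford_stable {1,2,5,6} (listed_spinors (e_wedge ` {{}, {1,2}, {1}, {2}}))"
  proof (rule listed_e_wedge_stable[where P = "\<lambda>S. 3 \<in> S \<longleftrightarrow> 4 \<in> S"])
    fix k :: 8 and S :: "4 set" assume "k \<notin> {1,2,5,6}" "3 \<in> S \<longleftrightarrow> 4 \<in> S"
    then show "\<not> (3 \<in> toggle (cidx k) S \<longleftrightarrow> 4 \<in> toggle (cidx k) S)"
      using exhaust_8[of k] by (auto simp: mem_toggle)
  qed (auto simp: toggle_def)
  then show ?thesis by simp
qed

lemma SU3_stable: "clifford_stable {1,5} (listed_spinors {e_wedge {}, e_wedge {1}})"
proof -
  have "clifford_stable {1,5} (listed_spinors (e_wedge ` {{}, {1}}))"
  proof (rule listed_e_wedge_stable[where P = "\<lambda>S. (2 \<in> S \<longleftrightarrow> 3 \<in> S) \<and> (3 \<in> S \<longleftrightarrow> 4 \<in> S)"])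
    fix k :: 8 and S :: "4 set" assume "k \<notin> {1,5}" "(2 \<in> S \<longleftrightarrow> 3 \<in> S) \<and> (3 \<in> S \<longleftrightarrow> 4 \<in> S)"
    then show "\<not> ((2 \<in> toggle (cidx k) S \<longleftrightarrow> 3 \<in> toggle (cidx k) S) \<and>
        (3 \<in> toggle (cidx k) S \<longleftrightarrow> 4 \<in> toggle (cidx k) S))"
      using exhaust_8[of k] by (auto simp: mem_toggle)
  qed (auto simp: toggle_def)
  then show ?thesis by simp
qed

lemma Gam_e_wedge:
  "Gam a (e_wedge S) = (phase a (toggle (cidx a) S) * koszul_sign (cidx a) S) *s e_wedge (toggle (cidx a) S)"
  by (auto simp: vec_eq_iff Gam_nth axis_def koszul_sign_toggle)

text \<open>Supports rule out the directions over the second to fourth complex direction. Direction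
  5 lies over the same complex direction as 1, so there reality is used instead: both spinors are
  fixed by the real structure and have real coefficients, which \<open>Gam 5\<close> makes
  imaginary.\<close>

lemma G2_stable:
  "clifford_stable {1} (listed_spinors {e_wedge {} + e_wedge {1,2,3,4}, e_wedge {1} + e_wedge {2,3,4}})"
    (is "clifford_stable _ (listed_spinors {?x, ?y})")
proof -
  let ?L = "listed_spinors {?x, ?y}"
  have xy: "Gam 1 ?x = ?y" "Gam 1 ?y = ?x"
    by (simp_all add: Gam_linear Gam_e_wedge koszul_sign_insert phase_def toggle_def insert_Diff_if)
  have "(\<chi> S. cnj (?x $ S)) = ?x" by (simp add: vec_eq_iff axis_def)
  then have cx: "spinor_conj ?x = ?x"
    by (simp add: spinor_conj_def Gam_linear Gam_e_wedge koszul_sign_insert phase_def toggle_def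
        insert_Diff_if Gam_scale)
  have cy: "spinor_conj ?y = ?y" using cx by (simp flip: xy(1) add: spinor_conj_Gam)
  have parts: "real_part ?x = ?x" "real_part ?y = ?y" "imag_part ?x = 0" "imag_part ?y = 0"
    unfolding real_part_def imag_part_def cx cy by (simp_all add: vec_eq_iff)
  have real: "Im (\<zeta> $ S) = 0" if "\<zeta> \<in> ?L" for \<zeta> S
    using that unfolding listed_spinors_def
  proof (induct rule: span_induct_alt)
    case (step r z w)
    then have "z \<in> {?x, ?y, 0}" by (auto simp: parts)
    then have "Im (z $ S) = 0" by (auto simp: axis_def)
    then show ?case using step by simp
  qed simp
  have "Gam a \<zeta> \<in> ?L" if "\<zeta> \<in> ?L" "a \<in> {1}" for a \<zeta>
  proof -
    have "\<exists>c. \<exists>w\<in>{?x, ?y}. Gam a z = c *s w" if "z \<in> {?x, ?y}" for z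
      using that xy \<open>a \<in> {1}\<close> by (auto intro!: exI[of _ 1])
    then show ?thesis using listed_spinors_Gam that by blast
  qed
  moreover have "inner \<zeta> (Gam k \<xi>) = 0" if "\<zeta> \<in> ?L" "\<xi> \<in> ?L" "k \<notin> {1}" for \<zeta> \<xi> k
  proof (cases "k = 5")
    case True
    have "Im (koszul_sign (cidx k) S) = 0" for S
      using cnj_koszul_sign[of "cidx k" S] by (simp add: complex_eq_iff del: cnj_koszul_sign)
    then have "inner (\<zeta> $ S) (Gam k \<xi> $ S) = 0" for S
      using real that True by (simp add: inner_complex_def Gam_nth phase_def)
    then show ?thesis by (simp add: inner_vec_def)
  next
    case False
    define P :: "4 set \<Rightarrow> bool" where "P S \<longleftrightarrow> (2 \<in> S \<longleftrightarrow> 3 \<in> S) \<and> (3 \<in> S \<longleftrightarrow> 4 \<in> S)" for S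
    have "\<zeta> $ S = 0" if "\<zeta> \<in> ?L" "\<not> P S" for \<zeta> S
      using that by (rule listed_spinors_support[rotated 2]) (auto simp: P_def axis_def split: if_splits)
    moreover have "\<not> (P S \<and> P (toggle (cidx k) S))" for S
      using exhaust_8[of k] False that(3) by (auto simp: P_def mem_toggle)
    ultimately show ?thesis using that by (intro inner_Gam_support[of P]) auto
  qed
  moreover have "?x \<in> ?L"
  proof -
    have "real_part ?x \<in> ?L" by (auto simp: listed_spinors_def intro: span_base)
    then show ?thesis by (simp only: parts)
  qed
  moreover have "?x \<noteq> 0"
  proof
    assume "?x = 0"
    then have "?x $ {} = 0" by simp
    then show False by (simp add: axis_def)
  qed
  ultimately show ?thesis
    unfolding clifford_stable_def by (auto simp: listed_spinors_def)
qed

section \<open>Calculus on the manifold\<close>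

lemma Ck_on_mono: "T \<subseteq> S \<Longrightarrow> Ck_on k S f \<Longrightarrow> Ck_on k T f"
  by (induct k arbitrary: f) (auto intro: continuous_on_subset)

lemma Ck_on_local:
  assumes "\<And>x. x \<in> S \<Longrightarrow> \<exists>T. open T \<and> x \<in> T \<and> Ck_on k T f"
  shows "Ck_on k S f"
  using assms
proof (induct k arbitrary: f)
  case 0
  then have "isCont f x" if "x \<in> S" for x
    using that continuous_on_eq_continuous_at by (metis Ck_on.simps(1))
  then show ?case by (simp add: continuous_at_imp_continuous_on)
next
  case (Suc k)
  have "f differentiable (at x)" if "x \<in> S" for x
    using Suc.prems[OF that] by auto
  moreover have "Ck_on k S (\<lambda>x. frechet_derivative f (at x) b)" if b: "b \<in> Basis" for b
  proof (rule Suc.hyps)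
    fix x assume "x \<in> S"
    then obtain T where "open T" "x \<in> T" "Ck_on (Suc k) T f" using Suc.prems by blast
    then show "\<exists>T. open T \<and> x \<in> T \<and> Ck_on k T (\<lambda>x. frechet_derivative f (at x) b)"
      using b by auto
  qed
  ultimately show ?case by simp
qed

lemma Ck_on_cong:
  assumes "open S" "\<And>x. x \<in> S \<Longrightarrow> f x = g x" "Ck_on k S f"
  shows "Ck_on k S g"
  using assms(2,3)
proof (induct k arbitrary: f g)
  case 0
  then show ?case using continuous_on_eq[of S f g] by simp
next
  case (Suc k)
  have d: "f differentiable (at x)" if "x \<in> S" for x using Suc.prems(2) that by simp
  have eq: "frechet_derivative f (at x) = frechet_derivative g (at x)" if "x \<in> S" for x
    using frechet_derivative_transform_within_open[OF d[OF that] \<open>open S\<close> that] Suc.prems(1) by blast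
  have "g differentiable (at x)" if "x \<in> S" for x
    unfolding differentiable_def
    by (intro exI, rule has_derivative_transform_within_open[OF iffD1[OF frechet_derivative_works d[OF that]]
          \<open>open S\<close> that]) (rule Suc.prems(1))
  moreover have "Ck_on k S (\<lambda>x. frechet_derivative g (at x) b)" if "b \<in> Basis" for b
  proof (rule Suc.hyps)
    show "Ck_on k S (\<lambda>x. frechet_derivative f (at x) b)" using Suc.prems(2) that by simp
  qed (simp only: eq)
  ultimately show ?case by simp
qed

lemma Ck_on_SucD: "Ck_on (Suc k) S f \<Longrightarrow> Ck_on k S f"
proof (induct k arbitrary: f)
  case 0
  then show ?case
    by (auto intro!: continuous_at_imp_continuous_on differentiable_imp_continuous_within)
next
  case (Suc k)
  have "\<forall>b\<in>Basis. Ck_on (Suc k) S (\<lambda>x. frechet_derivative f (at x) b)"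
    using Suc.prems Ck_on.simps(2) by blast
  then have "\<forall>b\<in>Basis. Ck_on k S (\<lambda>x. frechet_derivative f (at x) b)"
    using Suc.hyps by blast
  then show ?case using Suc.prems by simp
qed

lemma Ck_on_const: "Ck_on k S (\<lambda>x. c)"
proof (induct k arbitrary: c)
  case (Suc k)
  have "frechet_derivative (\<lambda>x. c) (at x) = (\<lambda>h. 0)" for x :: 'a
    by (intro frechet_derivative_at[symmetric] has_derivative_const)
  then show ?case using Suc by simp
qed simp

lemma Ck_on_add:
  assumes "open S" "Ck_on k S f" "Ck_on k S g"
  shows "Ck_on k S (\<lambda>x. f x + g x)"
  using assms(2,3)
proof (induct k arbitrary: f g)
  case (Suc k)
  have d: "f differentiable (at x)" "g differentiable (at x)" if "x \<in> S" for x
    using Suc.prems that by auto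
  have D: "((\<lambda>x. f x + g x) has_derivative (\<lambda>h. frechet_derivative f (at x) h + frechet_derivative g (at x) h)) (at x)"
    if "x \<in> S" for x
    using d[OF that] by (intro has_derivative_add iffD1[OF frechet_derivative_works])
  have eq: "frechet_derivative f (at x) b + frechet_derivative g (at x) b
      = frechet_derivative (\<lambda>x. f x + g x) (at x) b" if "x \<in> S" for x b
    using fun_cong[OF frechet_derivative_at[OF D[OF that]]] .
  have C: "Ck_on k S (\<lambda>x. frechet_derivative f (at x) b + frechet_derivative g (at x) b)"
    if "b \<in> Basis" for b
    by (rule Suc.hyps) (use Suc.prems that in simp_all)
  have "Ck_on k S (\<lambda>x. frechet_derivative (\<lambda>x. f x + g x) (at x) b)" if "b \<in> Basis" for b
    by (rule Ck_on_cong[OF \<open>open S\<close> _ C[OF that]]) (rule eq)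
  then show ?case using d by (simp add: differentiable_add)
qed (auto intro: continuous_intros)

text \<open>Each term of the Leibniz rule pairs a derivative with an undifferentiated factor.
  \<open>Ck_on_SucD\<close> lowers the order of the latter, so that the induction hypothesis, kept
  general in both functions, applies.\<close>

lemma (in bounded_bilinear) Ck_on:
  assumes "open S" "Ck_on k S f" "Ck_on k S g"
  shows "Ck_on k S (\<lambda>x. prod (f x) (g x))"
  using assms(2,3)
proof (induct k arbitrary: f g)
  case (Suc k)
  have d: "f differentiable (at x)" "g differentiable (at x)" if "x \<in> S" for x
    using Suc.prems that by auto
  have D: "((\<lambda>x. prod (f x) (g x)) has_derivative (\<lambda>h. prod (f x) (frechet_derivative g (at x) h)
      + prod (frechet_derivative f (at x) h) (g x))) (at x)" if "x \<in> S" for x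
    using d[OF that] by (intro FDERIV iffD1[OF frechet_derivative_works])
  have eq: "prod (f x) (frechet_derivative g (at x) b) + prod (frechet_derivative f (at x) b) (g x)
      = frechet_derivative (\<lambda>x. prod (f x) (g x)) (at x) b" if "x \<in> S" for x b
    using fun_cong[OF frechet_derivative_at[OF D[OF that]]] .
  have C: "Ck_on k S (\<lambda>x. prod (f x) (frechet_derivative g (at x) b)
      + prod (frechet_derivative f (at x) b) (g x))" if "b \<in> Basis" for b
    using Suc.prems that Ck_on_SucD[OF Suc.prems(1)] Ck_on_SucD[OF Suc.prems(2)]
    by (intro Ck_on_add[OF \<open>open S\<close>] Suc.hyps) auto
  have "Ck_on k S (\<lambda>x. frechet_derivative (\<lambda>x. prod (f x) (g x)) (at x) b)" if "b \<in> Basis" for b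
    by (rule Ck_on_cong[OF \<open>open S\<close> _ C[OF that]]) (rule eq)
  then show ?case using D by (auto intro!: differentiableI)
qed (auto intro: continuous_on)

text \<open>The bilinear case with the constant 1 as first factor.\<close>

lemma (in bounded_linear) Ck_on:
  assumes "open S" "Ck_on k S g"
  shows "Ck_on k S (\<lambda>x. f (g x))"
proof -
  interpret b: bounded_bilinear "\<lambda>(r::real) x. r *\<^sub>R f x"
    by (rule bounded_bilinear.comp[OF bounded_bilinear_scaleR bounded_linear_ident bounded_linear_axioms])
  show ?thesis using b.Ck_on[OF assms(1) Ck_on_const[of _ _ 1] assms(2)] by simp
qed

section \<open>Charts and smooth functions on the manifold\<close>

lemma
  assumes "smooth_atlas A" "(V, \<phi>) \<in> A"
  shows chart_open: "open V"
    and chart_inj: "inj_on \<phi> V"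
    and chart_image_open: "open W \<Longrightarrow> open (\<phi> ` (V \<inter> W))"
    and chart_continuous: "continuous_on V \<phi>"
proof -
  obtain \<psi> where V: "open V" "open (\<phi> ` V)" and h: "homeomorphism V (\<phi> ` V) \<phi> \<psi>"
    using assms unfolding smooth_atlas_def by blast
  show "open V" by fact
  show "inj_on \<phi> V" using h by (auto simp: homeomorphism_def intro: inj_on_inverseI)
  show "continuous_on V \<phi>" using h by (simp add: homeomorphism_def)
  show "open (\<phi> ` (V \<inter> W))" if "open W"
    using homeomorphism_imp_open_map[OF h, of "V \<inter> W"] V that
    by (metis openin_open_Int openin_open_eq)
qed

lemma smooth_funI:
  "(\<And>V \<phi> k. (V, \<phi>) \<in> A \<Longrightarrow> Ck_on k (\<phi> ` (V \<inter> W)) (\<lambda>x. f (inv_into V \<phi> x))) \<Longrightarrow> smooth_fun A W f"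
  by (auto simp: smooth_fun_def smooth_on_def o_def)

lemma smooth_funD:
  "smooth_fun A W f \<Longrightarrow> (V, \<phi>) \<in> A \<Longrightarrow> Ck_on k (\<phi> ` (V \<inter> W)) (\<lambda>x. f (inv_into V \<phi> x))"
  by (auto simp: smooth_fun_def smooth_on_def o_def)

lemma smooth_fun_subset:
  assumes "W' \<subseteq> W" "smooth_fun A W f" shows "smooth_fun A W' f"
  by (rule smooth_funI, rule Ck_on_mono[OF _ smooth_funD[OF assms(2)]]) (use assms(1) in auto)

lemma smooth_fun_const: "smooth_fun A W (\<lambda>q. c)"
  by (rule smooth_funI) (rule Ck_on_const)

locale manifold =
  fixes A :: "'m::topological_space atlas"
  assumes atlas: "smooth_atlas A"
begin

lemma smooth_fun_add:
  assumes "open W" "smooth_fun A W f" "smooth_fun A W h" shows "smooth_fun A W (\<lambda>q. f q + h q)"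
  by (rule smooth_funI, rule Ck_on_add)
    (erule chart_image_open[OF atlas _ assms(1)] smooth_funD[OF assms(2)] smooth_funD[OF assms(3)])+

lemma smooth_fun_linear:
  assumes "bounded_linear T" "open W" "smooth_fun A W f" shows "smooth_fun A W (\<lambda>q. T (f q))"
  by (rule smooth_funI, rule bounded_linear.Ck_on[OF assms(1)])
    (erule chart_image_open[OF atlas _ assms(2)] smooth_funD[OF assms(3)])+

lemma smooth_fun_bilinear:
  assumes "bounded_bilinear P" "open W" "smooth_fun A W f" "smooth_fun A W h"
  shows "smooth_fun A W (\<lambda>q. P (f q) (h q))"
  by (rule smooth_funI, rule bounded_bilinear.Ck_on[OF assms(1)])
    (erule chart_image_open[OF atlas _ assms(2)] smooth_funD[OF assms(3)] smooth_funD[OF assms(4)])+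

lemma smooth_fun_sum:
  "open W \<Longrightarrow> (\<And>a. a \<in> I \<Longrightarrow> smooth_fun A W (f a)) \<Longrightarrow> smooth_fun A W (\<lambda>q. \<Sum>a\<in>I. f a q)"
  by (induct I rule: infinite_finite_induct) (auto simp: smooth_fun_const smooth_fun_add)

text \<open>Lets smoothness be checked patch by patch, where a spin frame is at hand.\<close>

lemma smooth_fun_local:
  assumes "\<And>p. p \<in> W \<Longrightarrow> \<exists>W'. open W' \<and> p \<in> W' \<and> smooth_fun A W' f"
  shows "smooth_fun A W f"
  unfolding smooth_fun_def smooth_on_def
proof (clarify)
  fix V \<phi> k assume V: "(V, \<phi>) \<in> A"
  show "Ck_on k (\<phi> ` (V \<inter> W)) (f \<circ> inv_into V \<phi>)"
  proof (rule Ck_on_local)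
    fix x assume "x \<in> \<phi> ` (V \<inter> W)"
    then obtain q where q: "q \<in> V" "q \<in> W" "x = \<phi> q" by auto
    obtain W' where W': "open W'" "q \<in> W'" "smooth_fun A W' f" using assms q by blast
    have "Ck_on k (\<phi> ` (V \<inter> W')) (f \<circ> inv_into V \<phi>)"
      using W'(3) V unfolding smooth_fun_def smooth_on_def by blast
    then show "\<exists>T. open T \<and> x \<in> T \<and> Ck_on k T (f \<circ> inv_into V \<phi>)"
      using chart_image_open[OF atlas V W'(1)] q W' by blast
  qed
qed

lemma smooth_fun_cong:
  assumes "open W" "\<And>q. q \<in> W \<Longrightarrow> f q = h q" "smooth_fun A W f"
  shows "smooth_fun A W h"
  unfolding smooth_fun_def smooth_on_def
proof (clarify)
  fix V \<phi> k assume V: "(V, \<phi>) \<in> A"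
  show "Ck_on k (\<phi> ` (V \<inter> W)) (h \<circ> inv_into V \<phi>)"
  proof (rule Ck_on_cong)
    show "open (\<phi> ` (V \<inter> W))" by (rule chart_image_open[OF atlas V \<open>open W\<close>])
    show "Ck_on k (\<phi> ` (V \<inter> W)) (f \<circ> inv_into V \<phi>)"
      using assms(3) V unfolding smooth_fun_def smooth_on_def by blast
    show "(f \<circ> inv_into V \<phi>) x = (h \<circ> inv_into V \<phi>) x" if "x \<in> \<phi> ` (V \<inter> W)" for x
      using that assms(2) chart_inj[OF atlas V] by auto
  qed
qed

lemma smooth_nearI: "open W \<Longrightarrow> p \<in> W \<Longrightarrow> smooth_fun A W f \<Longrightarrow> smooth_near A p f"
  unfolding smooth_near_def by blast

lemma smooth_near_const: "smooth_near A p (\<lambda>q. c)"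
  by (rule smooth_nearI[of UNIV]) (auto simp: smooth_fun_const)

lemma smooth_near_bilinear:
  assumes "bounded_bilinear P" "smooth_near A p f" "smooth_near A p h"
  shows "smooth_near A p (\<lambda>q. P (f q) (h q))"
proof -
  obtain W where W: "open W" "p \<in> W" "smooth_fun A W f"
    using assms(2) unfolding smooth_near_def by blast
  obtain W' where W': "open W'" "p \<in> W'" "smooth_fun A W' h"
    using assms(3) unfolding smooth_near_def by blast
  have "smooth_fun A (W \<inter> W') (\<lambda>q. P (f q) (h q))"
    by (intro smooth_fun_bilinear[OF assms(1) open_Int[OF W(1) W'(1)] smooth_fun_subset[OF _ W(3)]
          smooth_fun_subset[OF _ W'(3)]]) auto
  then show ?thesis using W W' by (intro smooth_nearI[of "W \<inter> W'"]) auto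
qed

lemma smooth_near_linear:
  assumes "bounded_linear T" "smooth_near A p f" shows "smooth_near A p (\<lambda>q. T (f q))"
proof -
  obtain W where W: "open W" "p \<in> W" "smooth_fun A W f"
    using assms(2) unfolding smooth_near_def by blast
  show ?thesis by (rule smooth_nearI[OF W(1,2) smooth_fun_linear[OF assms(1) W(1,3)]])
qed

lemma smooth_near_add:
  assumes "smooth_near A p f" "smooth_near A p h" shows "smooth_near A p (\<lambda>q. f q + h q)"
proof -
  obtain W where W: "open W" "p \<in> W" "smooth_fun A W f"
    using assms(1) unfolding smooth_near_def by blast
  obtain W' where W': "open W'" "p \<in> W'" "smooth_fun A W' h"
    using assms(2) unfolding smooth_near_def by blast
  have "smooth_fun A (W \<inter> W') (\<lambda>q. f q + h q)"
    by (intro smooth_fun_add[OF open_Int[OF W(1) W'(1)] smooth_fun_subset[OF _ W(3)] smooth_fun_subset[OF _ W'(3)]]) auto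
  then show ?thesis using W W' by (intro smooth_nearI[of "W \<inter> W'"]) auto
qed

lemmas smooth_near_mult = smooth_near_bilinear[OF bounded_bilinear_mult]
lemmas smooth_near_cmult = smooth_near_linear[OF bounded_linear_mult_right]

lemma smooth_near_sum: "(\<And>a. a \<in> I \<Longrightarrow> smooth_near A p (f a)) \<Longrightarrow> smooth_near A p (\<lambda>q. \<Sum>a\<in>I. f a q)"
proof (induct I rule: infinite_finite_induct)
  case (insert a I)
  then have "smooth_near A p (\<lambda>q. f a q + (\<Sum>a\<in>I. f a q))"
    by (intro smooth_near_add insert) auto
  then show ?case by (simp only: sum.insert[OF insert(1,2)])
next
  case (infinite I)
  show ?case unfolding sum.infinite[OF infinite(1)] by (rule smooth_near_const)
next
  case empty
  show ?case unfolding sum.empty by (rule smooth_near_const)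
qed

subsection \<open>Tangent vectors\<close>

context
  fixes p v assumes v: "v \<in> tangent A p"
begin

lemma tangentD:
  assumes "smooth_near A p f" "smooth_near A p h"
  shows "(\<forall>\<^sub>F q in nhds p. f q = h q) \<longrightarrow> v f = v h" "v (f + h) = v f + v h"
    "v (f * h) = f p * v h + h p * v f" "v (c *\<^sub>R f) = c * v f"
proof -
  note v' = v[unfolded tangent_def mem_Collect_eq, THEN conjunct2]
  note * = v'[THEN conjunct1, THEN spec, THEN spec, THEN mp, THEN mp, OF assms]
  show "(\<forall>\<^sub>F q in nhds p. f q = h q) \<longrightarrow> v f = v h" "v (f + h) = v f + v h"
    "v (f * h) = f p * v h + h p * v f"
    by (rule *[THEN conjunct1] *[THEN conjunct2, THEN conjunct1] *[THEN conjunct2, THEN conjunct2])+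
  show "v (c *\<^sub>R f) = c * v f"
    by (rule v'[THEN conjunct2, THEN spec, THEN spec, THEN mp, OF assms(1)])
qed

text \<open>Frame identities hold only over a patch; this is how they are differentiated.\<close>

lemma tangent_germ:
  assumes "open W" "p \<in> W" "\<And>q. q \<in> W \<Longrightarrow> f q = h q" "smooth_near A p f" "smooth_near A p h"
  shows "v f = v h"
  using tangentD(1)[OF assms(4,5)] assms(1-3) unfolding eventually_nhds by blast

lemma tangent_add: "smooth_near A p f \<Longrightarrow> smooth_near A p h \<Longrightarrow> v (\<lambda>q. f q + h q) = v f + v h"
  using tangentD(2)[of f h] by (simp add: plus_fun_def)

lemma tangent_mult:
  "smooth_near A p f \<Longrightarrow> smooth_near A p h \<Longrightarrow> v (\<lambda>q. f q * h q) = f p * v h + h p * v f"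
  using tangentD(3)[of f h] by (simp add: times_fun_def)

lemma tangent_const: "v (\<lambda>q. c) = 0"
proof -
  have "v (\<lambda>q. 1) = 0"
    using tangent_mult[OF smooth_near_const[of p 1] smooth_near_const[of p 1]] by simp
  moreover have "v (c *\<^sub>R (\<lambda>q. 1)) = c * v (\<lambda>q. 1)"
    by (rule tangentD(4)) (rule smooth_near_const)+
  ultimately show ?thesis by (simp add: scaleR_fun_def)
qed

lemma tangent_cmult: "smooth_near A p f \<Longrightarrow> v (\<lambda>q. c * f q) = c * v f"
  using tangent_mult[OF smooth_near_const[of p c]] by (simp add: tangent_const)

lemma tangent_sum:
  "(\<And>a. a \<in> I \<Longrightarrow> smooth_near A p (f a)) \<Longrightarrow> v (\<lambda>q. \<Sum>a\<in>I. f a q) = (\<Sum>a\<in>I. v (f a))"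
proof (induct I rule: infinite_finite_induct)
  case (insert a I)
  have "v (\<lambda>q. f a q + (\<Sum>a\<in>I. f a q)) = v (f a) + v (\<lambda>q. \<Sum>a\<in>I. f a q)"
    by (intro tangent_add smooth_near_sum insert.prems) auto
  then show ?case using insert by simp
next
  case (infinite I)
  show ?case unfolding sum.infinite[OF infinite(1)] by (rule tangent_const)
next
  case empty
  show ?case unfolding sum.empty by (rule tangent_const)
qed

end

lemma tangent_not_smooth: "v \<in> tangent A p \<Longrightarrow> \<not> smooth_near A p f \<Longrightarrow> v f = 0"
  unfolding tangent_def mem_Collect_eq by (drule conjunct1) blast

lemma tangentI:
  assumes "\<And>f. \<not> smooth_near A p f \<Longrightarrow> v f = 0"
    and "\<And>f h. smooth_near A p f \<Longrightarrow> smooth_near A p h \<Longrightarrow> \<forall>\<^sub>F q in nhds p. f q = h q \<Longrightarrow> v f = v h"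
    and "\<And>f h. smooth_near A p f \<Longrightarrow> smooth_near A p h \<Longrightarrow> v (f + h) = v f + v h"
    and "\<And>f h. smooth_near A p f \<Longrightarrow> smooth_near A p h \<Longrightarrow> v (f * h) = f p * v h + h p * v f"
    and "\<And>c f. smooth_near A p f \<Longrightarrow> v (c *\<^sub>R f) = c * v f"
  shows "v \<in> tangent A p"
  unfolding tangent_def mem_Collect_eq by (intro conjI allI impI) (fact assms)+

lemma tangent_zero: "0 \<in> tangent A p"
  by (rule tangentI) (simp_all only: zero_fun_apply mult_zero_right add_0)

lemma tangent_plus:
  assumes "u \<in> tangent A p" "v \<in> tangent A p" shows "u + v \<in> tangent A p"
proof (rule tangentI, goal_cases)
  case (1 f)
  then show ?case using assms by (simp add: tangent_not_smooth)
next
  case (2 f h)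
  then show ?case using tangentD(1)[OF assms(1) 2(1,2)] tangentD(1)[OF assms(2) 2(1,2)] by simp
next
  case (3 f h)
  show ?case using tangentD(2)[OF assms(1) 3] tangentD(2)[OF assms(2) 3] by (simp only: plus_fun_apply; simp)
next
  case (4 f h)
  show ?case using tangentD(3)[OF assms(1) 4] tangentD(3)[OF assms(2) 4]
    by (simp only: plus_fun_apply; simp add: algebra_simps)
next
  case (5 c f)
  show ?case using tangentD(4)[OF assms(1) 5 5] tangentD(4)[OF assms(2) 5 5]
    by (simp only: plus_fun_apply; simp add: algebra_simps)
qed

lemma tangent_scaleR:
  assumes "v \<in> tangent A p" shows "c *\<^sub>R v \<in> tangent A p"
proof (rule tangentI, goal_cases)
  case (1 f)
  then show ?case using assms by (simp add: tangent_not_smooth scaleR_apply)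
next
  case (2 f h)
  then show ?case using tangentD(1)[OF assms 2(1,2)] by (simp add: scaleR_apply)
next
  case (3 f h)
  show ?case using tangentD(2)[OF assms 3] by (simp only: scaleR_apply; simp add: algebra_simps)
next
  case (4 f h)
  show ?case using tangentD(3)[OF assms 4] by (simp only: scaleR_apply; simp add: algebra_simps)
next
  case (5 d f)
  show ?case using tangentD(4)[OF assms 5 5] by (simp only: scaleR_apply[of c v]; simp)
qed

lemma tangent_diff: "u \<in> tangent A p \<Longrightarrow> v \<in> tangent A p \<Longrightarrow> u - v \<in> tangent A p"
  using tangent_plus[of u p "(-1) *\<^sub>R v"] tangent_scaleR[of v p "-1"] by simp

lemma tangent_lincomb: "(\<And>a. a \<in> I \<Longrightarrow> v a \<in> tangent A p) \<Longrightarrow> (\<Sum>a\<in>I. c a *\<^sub>R v a) \<in> tangent A p"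
  by (induct I rule: infinite_finite_induct) (auto simp: tangent_zero tangent_plus tangent_scaleR)

text \<open>\<open>spinor_deriv\<close> differentiates real and imaginary parts separately, so the
  complex constants in \<open>Gam_nth\<close> need a rule of their own.\<close>

lemma tangent_Re_Im:
  assumes v: "v \<in> tangent A p" and h: "smooth_near A p h"
  shows "v (\<lambda>q. Re (c * h q)) = Re c * v (\<lambda>q. Re (h q)) - Im c * v (\<lambda>q. Im (h q))"
    and "v (\<lambda>q. Im (c * h q)) = Re c * v (\<lambda>q. Im (h q)) + Im c * v (\<lambda>q. Re (h q))"
proof -
  note s = smooth_near_linear[OF bounded_linear_Re h] smooth_near_linear[OF bounded_linear_Im h]
  have "v (\<lambda>q. Re c * Re (h q) + (- Im c) * Im (h q)) = Re c * v (\<lambda>q. Re (h q)) + (- Im c) * v (\<lambda>q. Im (h q))"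
    using s by (simp only: tangent_add[OF v] tangent_cmult[OF v] smooth_near_cmult)
  then show "v (\<lambda>q. Re (c * h q)) = Re c * v (\<lambda>q. Re (h q)) - Im c * v (\<lambda>q. Im (h q))" by simp
  have "v (\<lambda>q. Re c * Im (h q) + Im c * Re (h q)) = Re c * v (\<lambda>q. Im (h q)) + Im c * v (\<lambda>q. Re (h q))"
    using s by (simp only: tangent_add[OF v] tangent_cmult[OF v] smooth_near_cmult)
  then show "v (\<lambda>q. Im (c * h q)) = Re c * v (\<lambda>q. Im (h q)) + Im c * v (\<lambda>q. Re (h q))" by simp
qed

lemma smooth_near_component: "smooth_near A p \<psi> \<Longrightarrow> smooth_near A p (\<lambda>q. (\<psi> q :: spinor) $ S)"
  by (rule smooth_near_linear[OF bounded_linear_vec_nth])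

lemma spinor_deriv_Gam:
  assumes "v \<in> tangent A p" "smooth_near A p \<psi>"
  shows "spinor_deriv v (\<lambda>q. Gam a (\<psi> q)) = Gam a (spinor_deriv v \<psi>)"
proof -
  have "spinor_deriv v (\<lambda>q. Gam a (\<psi> q)) $ S = Gam a (spinor_deriv v \<psi>) $ S" for S
    unfolding spinor_deriv_def Gam_nth vec_lambda_beta
      tangent_Re_Im[OF assms(1) smooth_near_component[OF assms(2)]]
    by (simp add: complex_eq_iff)
  then show ?thesis by (simp add: vec_eq_iff)
qed

lemma tangent_inner:
  assumes v: "v \<in> tangent A p" and s: "smooth_near A p \<psi>" "smooth_near A p \<xi>"
  shows "v (\<lambda>q. inner (\<psi> q) (\<xi> q)) = inner (spinor_deriv v \<psi>) (\<xi> p) + inner (\<psi> p) (spinor_deriv v \<xi>)"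
proof -
  have c: "smooth_near A p (\<lambda>q. Re (\<theta> q $ S))" "smooth_near A p (\<lambda>q. Im (\<theta> q $ S))"
    if "smooth_near A p \<theta>" for S and \<theta> :: "'m \<Rightarrow> spinor"
    using smooth_near_linear[OF bounded_linear_Re] smooth_near_linear[OF bounded_linear_Im]
      smooth_near_component[OF that] by blast+
  note c = c[OF s(1)] c[OF s(2)]
  have "v (\<lambda>q. inner (\<psi> q) (\<xi> q)) =
      v (\<lambda>q. \<Sum>S\<in>UNIV. Re (\<psi> q $ S) * Re (\<xi> q $ S) + Im (\<psi> q $ S) * Im (\<xi> q $ S))"
    by (simp add: inner_vec_def inner_complex_def)
  also have "\<dots> = (\<Sum>S\<in>UNIV. v (\<lambda>q. Re (\<psi> q $ S) * Re (\<xi> q $ S) + Im (\<psi> q $ S) * Im (\<xi> q $ S)))"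
    by (rule tangent_sum[OF v]) (intro smooth_near_add smooth_near_mult c)
  also have "\<dots> = (\<Sum>S\<in>UNIV. inner (spinor_deriv v \<psi> $ S) (\<xi> p $ S) + inner (\<psi> p $ S) (spinor_deriv v \<xi> $ S))"
    by (rule sum.cong) (simp_all add: tangent_add[OF v] tangent_mult[OF v] smooth_near_mult c
        spinor_deriv_def inner_complex_def)
  finally show ?thesis by (simp add: inner_vec_def sum.distrib)
qed

subsection \<open>Functions with vanishing differential\<close>

text \<open>Coordinate derivatives as derivations; the value 0 on functions not smooth near
  \<open>p\<close> is the normalisation that \<open>tangent\<close> imposes.\<close>

definition coordinate_vector :: "'m set \<Rightarrow> ('m \<Rightarrow> real^8) \<Rightarrow> 'm \<Rightarrow> real^8 \<Rightarrow> 'm tvec" where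
  "coordinate_vector V \<phi> p b f =
     (if smooth_near A p f then frechet_derivative (f \<circ> inv_into V \<phi>) (at (\<phi> p)) b else 0)"

lemma smooth_near_differentiable:
  assumes "(V, \<phi>) \<in> A" "p \<in> V" "smooth_near A p f"
  shows "(f \<circ> inv_into V \<phi>) differentiable (at (\<phi> p))"
proof -
  obtain W where "p \<in> W" "smooth_fun A W f" using assms unfolding smooth_near_def by blast
  then have "Ck_on (Suc 0) (\<phi> ` (V \<inter> W)) (f \<circ> inv_into V \<phi>)" "\<phi> p \<in> \<phi> ` (V \<inter> W)"
    using assms unfolding smooth_fun_def smooth_on_def by blast+
  then show ?thesis unfolding Ck_on.simps by blast
qed

lemma coordinate_vector_tangent:
  assumes V: "(V, \<phi>) \<in> A" "p \<in> V"
  shows "coordinate_vector V \<phi> p b \<in> tangent A p"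
proof -
  let ?F = "\<lambda>f. f \<circ> inv_into V \<phi>" and ?x = "\<phi> p"
  have x: "inv_into V \<phi> ?x = p" by (rule inv_into_f_f[OF chart_inj[OF atlas V(1)] V(2)])
  have D: "(?F f has_derivative frechet_derivative (?F f) (at ?x)) (at ?x)" if "smooth_near A p f" for f :: "'m \<Rightarrow> real"
    by (rule iffD1[OF frechet_derivative_works smooth_near_differentiable[OF V that]])
  have germ: "frechet_derivative (?F f) (at ?x) b = frechet_derivative (?F h) (at ?x) b"
    if ev: "\<forall>\<^sub>F q in nhds p. f q = h q" and sm: "smooth_near A p f" for f h :: "'m \<Rightarrow> real"
  proof -
    obtain W where W: "open W" "p \<in> W" "\<And>q. q \<in> W \<Longrightarrow> f q = h q" using ev unfolding eventually_nhds by blast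
    have "?F f y = ?F h y" if "y \<in> \<phi> ` (V \<inter> W)" for y
      using that W chart_inj[OF atlas V(1)] by auto
    then have "frechet_derivative (?F f) (at ?x) = frechet_derivative (?F h) (at ?x)"
      using W V chart_image_open[OF atlas V(1) W(1)]
      by (intro frechet_derivative_transform_within_open[OF smooth_near_differentiable[OF V sm]]) auto
    then show ?thesis by simp
  qed
  have add: "frechet_derivative (?F (f + h)) (at ?x) b =
      frechet_derivative (?F f) (at ?x) b + frechet_derivative (?F h) (at ?x) b"
    if "smooth_near A p f" "smooth_near A p h" for f h :: "'m \<Rightarrow> real"
  proof -
    have "?F (f + h) = (\<lambda>x. ?F f x + ?F h x)" by (rule ext) (simp only: o_apply plus_fun_apply)
    then show ?thesis
      using fun_cong[OF frechet_derivative_at[OF has_derivative_add[OF D[OF that(1)] D[OF that(2)]]], of b]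
      by (simp only:)
  qed
  have mult: "frechet_derivative (?F (f * h)) (at ?x) b =
      f p * frechet_derivative (?F h) (at ?x) b + h p * frechet_derivative (?F f) (at ?x) b"
    if "smooth_near A p f" "smooth_near A p h" for f h :: "'m \<Rightarrow> real"
  proof -
    have "?F (f * h) = (\<lambda>x. ?F f x * ?F h x)" by (rule ext) (simp only: o_apply times_fun_apply)
    then have "frechet_derivative (?F (f * h)) (at ?x) b =
        ?F f ?x * frechet_derivative (?F h) (at ?x) b + frechet_derivative (?F f) (at ?x) b * ?F h ?x"
      using fun_cong[OF frechet_derivative_at[OF has_derivative_mult[OF D[OF that(1)] D[OF that(2)]]], of b]
      by (simp only:)
    then show ?thesis by (simp only: o_apply x mult.commute)
  qed
  have cmult: "frechet_derivative (?F (c *\<^sub>R f)) (at ?x) b = c * frechet_derivative (?F f) (at ?x) b"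
    if "smooth_near A p f" for f :: "'m \<Rightarrow> real" and c :: real
  proof -
    have "?F (c *\<^sub>R f) = (\<lambda>x. c * ?F f x)" by (rule ext) (simp add: scaleR_apply)
    then show ?thesis
      using fun_cong[OF frechet_derivative_at[OF bounded_linear.has_derivative[OF bounded_linear_mult_right[of c] D[OF that]]], of b]
      by (simp only:)
  qed
  have smooth: "smooth_near A p (f + h)" "smooth_near A p (f * h)" "smooth_near A p (c *\<^sub>R f)"
    if "smooth_near A p f" "smooth_near A p h" for f h :: "'m \<Rightarrow> real" and c :: real
    using smooth_near_add[OF that] smooth_near_mult[OF that] smooth_near_cmult[OF that(1), of c]
    by (simp_all add: plus_fun_def times_fun_def scaleR_fun_def)
  show ?thesis
  proof (rule tangentI, goal_cases)
    case (1 f)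
    then show ?case by (simp add: coordinate_vector_def)
  next
    case (2 f h)
    then show ?case using germ[OF 2(3,1)] by (simp add: coordinate_vector_def)
  next
    case (3 f h)
    show ?case unfolding coordinate_vector_def using 3 smooth(1)[OF 3] add[OF 3] by simp
  next
    case (4 f h)
    show ?case unfolding coordinate_vector_def using 4 smooth(2)[OF 4] mult[OF 4] by simp
  next
    case (5 c f)
    show ?case unfolding coordinate_vector_def using 5 smooth(3)[OF 5 5, of c] cmult[OF 5, of c] by simp
  qed
qed

text \<open>Coordinate vectors force the derivative of \<open>f\<close> in a chart to vanish. As
  balls are convex, \<open>f\<close> is constant on the preimage of a ball, hence locally constant,
  and connectedness does the rest.\<close>

lemma constant_if_derivations_vanish:
  fixes f :: "'m \<Rightarrow> real"
  assumes con: "connected (UNIV :: 'm set)" and f: "smooth_fun A UNIV f"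
    and zero: "\<And>p v. v \<in> tangent A p \<Longrightarrow> v f = 0"
  shows "f p = f q"
proof -
  have "\<exists>W. open W \<and> p \<in> W \<and> (\<forall>q\<in>W. f q = f p)" for p
  proof -
    have "p \<in> (\<Union>(V, \<phi>)\<in>A. V)" using atlas unfolding smooth_atlas_def by simp
    then obtain V \<phi> where V: "(V, \<phi>) \<in> A" "p \<in> V" by auto
    note inj = chart_inj[OF atlas V(1)] and V_open = chart_open[OF atlas V(1)]
    have "open (\<phi> ` V)" using chart_image_open[OF atlas V(1), of UNIV] by simp
    then obtain e where e: "e > 0" "ball (\<phi> p) e \<subseteq> \<phi> ` V" using V open_contains_ball by blast
    let ?f = "f \<circ> inv_into V \<phi>"
    have D: "(?f has_derivative (\<lambda>h. 0)) (at x within ball (\<phi> p) e)" if x: "x \<in> ball (\<phi> p) e" for x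
    proof -
      obtain r where r: "r \<in> V" "x = \<phi> r" using e x by auto
      have sm: "smooth_near A r f" using f smooth_nearI[of UNIV] by simp
      have "frechet_derivative ?f (at x) b = 0" for b
        using zero[OF coordinate_vector_tangent[OF V(1) r(1)]] sm r by (simp add: coordinate_vector_def)
      then have "frechet_derivative ?f (at x) = (\<lambda>h. 0)" by auto
      then have "(?f has_derivative (\<lambda>h. 0)) (at x)"
        using iffD1[OF frechet_derivative_works smooth_near_differentiable[OF V(1) r(1) sm]] r(2) by simp
      then show ?thesis by (rule has_derivative_at_withinI)
    qed
    have "\<exists>c. \<forall>x\<in>ball (\<phi> p) e. ?f x = c"
      by (rule has_derivative_zero_constant[OF convex_ball]) (rule D)
    then obtain c where c: "\<And>x. x \<in> ball (\<phi> p) e \<Longrightarrow> ?f x = c" by blast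
    define W where "W = V \<inter> \<phi> -` ball (\<phi> p) e"
    have "open W" unfolding W_def
      using continuous_open_preimage[OF chart_continuous[OF atlas V(1)] V_open open_ball] .
    moreover have "p \<in> W" using V e by (simp add: W_def)
    moreover have "f q = c" if "q \<in> W" for q using c[of "\<phi> q"] that inj by (simp add: W_def)
    ultimately show ?thesis by metis
  qed
  then have "f constant_on UNIV"
    by (intro locally_constant_imp_constant[OF con]) simp
  then show ?thesis unfolding constant_on_def by force
qed

end

section \<open>Bilinear vectors at a single point under the spin group\<close>

lemma Spin8_bilinear:
  assumes "s \<in> Spin8"
  obtains R where "orthogonal_transformation R"
    "\<And>w \<zeta>. cl1 (($) (R w)) (s \<zeta>) = s (cl1 (($) w) \<zeta>)"
    "\<And>\<zeta> \<xi>. (\<chi> k. inner (s \<zeta>) (Gam k (s \<xi>))) = R (\<chi> k. inner \<zeta> (Gam k \<xi>))"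
proof -
  obtain R where R: "orthogonal_transformation R"
      "\<And>w \<zeta>. cl1 (($) (R w)) (s \<zeta>) = s (cl1 (($) w) \<zeta>)"
    and iso: "\<And>\<zeta> \<xi>. inner (s \<zeta>) (s \<xi>) = inner \<zeta> \<xi>"
    using Spin8_rotation[OF assms] by blast
  have cl1: "inner \<zeta> (cl1 (($) y) \<xi>) = inner y (\<chi> k. inner \<zeta> (Gam k \<xi>))" for y \<zeta> \<xi>
    unfolding cl1_def inner_vec_def[of y] by (simp add: inner_sum_right)
  have "(\<chi> k. inner (s \<zeta>) (Gam k (s \<xi>))) = R (\<chi> k. inner \<zeta> (Gam k \<xi>))" for \<zeta> \<xi>
  proof -
    \<comment> \<open>Testing against vectors \<open>R y\<close> reduces the claim to the isometry
      of \<open>s\<close>, and \<open>R\<close> is onto, so these are all vectors.\<close>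
    have "inner (R y) (\<chi> k. inner (s \<zeta>) (Gam k (s \<xi>))) = inner (R y) (R (\<chi> k. inner \<zeta> (Gam k \<xi>)))" for y
      unfolding orthogonal_transformation_def[THEN iffD1, OF R(1), THEN conjunct2, rule_format]
      by (simp only: cl1[symmetric] R(2) iso)
    then have "inner z (\<chi> k. inner (s \<zeta>) (Gam k (s \<xi>))) = inner z (R (\<chi> k. inner \<zeta> (Gam k \<xi>)))" for z
      using orthogonal_transformation_surj[OF R(1)] by (metis surjD)
    then show ?thesis using vector_eq_ldot by blast
  qed
  then show ?thesis using that R by blast
qed

text \<open>Before \<open>s\<close> is applied, the bilinear vector of two elements of
  \<open>L\<close> has components only in \<open>I\<close>, and those gamma matrices preserve
  \<open>L\<close>. As \<open>s\<close> intertwines Clifford multiplication with a rotation of the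
  vector, this carries over to the image.\<close>

lemma stable_bilinear:
  assumes "clifford_stable I L" and s: "s \<in> Spin8" and "\<zeta> \<in> s ` L" "\<xi> \<in> s ` L" "\<theta> \<in> s ` L"
  shows "cl1 (\<lambda>k. inner \<zeta> (Gam k \<xi>)) \<theta> \<in> s ` L"
proof -
  obtain z x t where z: "z \<in> L" "x \<in> L" "t \<in> L" "\<zeta> = s z" "\<xi> = s x" "\<theta> = s t"
    using assms by blast
  obtain R where R: "\<And>w \<zeta>. cl1 (($) (R w)) (s \<zeta>) = s (cl1 (($) w) \<zeta>)"
    "(\<chi> k. inner (s z) (Gam k (s x))) = R (\<chi> k. inner z (Gam k x))"
    using Spin8_bilinear[OF s] by metis
  have "cl1 (\<lambda>k. inner \<zeta> (Gam k \<xi>)) \<theta> = cl1 (($) (\<chi> k. inner (s z) (Gam k (s x)))) (s t)"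
    by (simp add: z cl1_def)
  also have "\<dots> = s (cl1 (($) (\<chi> k. inner z (Gam k x))) t)" by (simp only: R)
  finally have eq: "cl1 (\<lambda>k. inner \<zeta> (Gam k \<xi>)) \<theta> = s (cl1 (($) (\<chi> k. inner z (Gam k x))) t)" .
  have "inner z (Gam k x) *\<^sub>R Gam k t \<in> L" for k
    using assms(1) z unfolding clifford_stable_def
    by (cases "k \<in> I") (auto intro: subspace_scale subspace_0)
  then have "cl1 (($) (\<chi> k. inner z (Gam k x))) t \<in> L"
    using assms(1) unfolding cl1_def clifford_stable_def by (auto intro: subspace_sum)
  then show ?thesis unfolding eq by blast
qed

text \<open>The bilinear vectors at a point span exactly as many dimensions as \<open>I\<close> has
  elements. For nonzero \<open>\<eta>\<close> in \<open>L\<close> and \<open>\<xi> a\<close> the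
  rescaled \<open>Gam a \<eta>\<close>, the bilinear vector is the basis vector \<open>a\<close>,
  and \<open>clifford_stable\<close> excludes other components. Completeness is put as a Parseval
  identity because inner products are what rotations and parallel fields preserve.\<close>

lemma stable_orthonormal:
  assumes st: "clifford_stable I L" and s: "s \<in> Spin8"
  shows "\<exists>\<eta> \<xi>. \<eta> \<in> s ` L \<and> (\<forall>a\<in>I. \<xi> a \<in> s ` L) \<and>
    (\<forall>a\<in>I. \<forall>b\<in>I. (\<Sum>k\<in>UNIV. inner (\<xi> a) (Gam k \<eta>) * inner (\<xi> b) (Gam k \<eta>)) = (if a = b then 1 else 0)) \<and>
    (\<forall>\<zeta>\<in>s ` L. \<forall>\<theta>\<in>s ` L. (\<Sum>k\<in>UNIV. (inner \<zeta> (Gam k \<theta>))\<^sup>2) =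
      (\<Sum>a\<in>I. (\<Sum>k\<in>UNIV. inner \<zeta> (Gam k \<theta>) * inner (\<xi> a) (Gam k \<eta>))\<^sup>2))"
proof -
  have L: "subspace L" using st by (simp add: clifford_stable_def)
  obtain \<eta> where \<eta>: "\<eta> \<in> L" "\<eta> \<noteq> 0"
    using st subspace_0[OF L] unfolding clifford_stable_def by blast
  obtain R where R: "orthogonal_transformation R"
    "\<And>\<zeta> \<xi>. (\<chi> k. inner (s \<zeta>) (Gam k (s \<xi>))) = R (\<chi> k. inner \<zeta> (Gam k \<xi>))"
    using Spin8_bilinear[OF s] by metis
  define \<xi> where "\<xi> a = (1 / inner \<eta> \<eta>) *\<^sub>R Gam a \<eta>" for a
  have \<xi>: "\<xi> a \<in> L" if "a \<in> I" for a
    using that st \<eta> unfolding \<xi>_def clifford_stable_def by (auto intro: subspace_scale)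
  have on: "inner (Gam a \<eta>) (Gam k \<eta>) = (if a = k then inner \<eta> \<eta> else 0)" for a k
  proof -
    have "inner (Gam a \<eta>) (Gam k \<eta>) + inner (Gam k \<eta>) (Gam a \<eta>)
        = inner \<eta> (Gam a (Gam k \<eta>) + Gam k (Gam a \<eta>))"
      by (simp add: inner_Gam inner_add_right)
    also have "\<dots> = (if a = k then 2 else 0) * inner \<eta> \<eta>"
      unfolding Gam_clifford by simp
    finally show ?thesis using inner_commute[of "Gam a \<eta>" "Gam k \<eta>"] by (simp split: if_splits)
  qed
  have ax: "(\<chi> k. inner (\<xi> a) (Gam k \<eta>)) = axis a 1" for a
    using \<eta>(2) by (auto simp: vec_eq_iff \<xi>_def on axis_def)
  have "(\<Sum>k\<in>UNIV. x k * y k) = inner (\<chi> k. x k) (\<chi> k. y k)" for x y :: "8 \<Rightarrow> real"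
    by (simp add: inner_vec_def)
  note dot = this
  have rot: "(\<Sum>k\<in>UNIV. inner (s z) (Gam k (s t)) * inner (s z') (Gam k (s t'))) =
      (\<Sum>k\<in>UNIV. inner z (Gam k t) * inner z' (Gam k t'))" for z t z' t'
    unfolding dot R(2) using R(1) by (simp add: orthogonal_transformation_def)
  have proj: "(\<Sum>k\<in>UNIV. inner z (Gam k t) * inner (\<xi> a) (Gam k \<eta>)) = inner z (Gam a t)" for z t a
    unfolding dot ax by (simp add: inner_axis)
  show ?thesis
  proof (intro exI conjI ballI)
    show "s \<eta> \<in> s ` L" using \<eta> by blast
    show "s (\<xi> a) \<in> s ` L" if "a \<in> I" for a using \<xi>[OF that] by blast
    show "(\<Sum>k\<in>UNIV. inner (s (\<xi> a)) (Gam k (s \<eta>)) * inner (s (\<xi> b)) (Gam k (s \<eta>))) = (if a = b then 1 else 0)" for a b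
      unfolding rot proj using ax[of a, unfolded vec_eq_iff, rule_format, of b] by (simp add: axis_def)
    fix \<zeta> \<theta> assume "\<zeta> \<in> s ` L" "\<theta> \<in> s ` L"
    then obtain z t where z: "z \<in> L" "t \<in> L" "\<zeta> = s z" "\<theta> = s t" by blast
    have "(\<Sum>k\<in>UNIV. (inner \<zeta> (Gam k \<theta>))\<^sup>2) = (\<Sum>k\<in>UNIV. (inner z (Gam k t))\<^sup>2)"
      unfolding z power2_eq_square rot ..
    also have "\<dots> = (\<Sum>k\<in>I. (inner z (Gam k t))\<^sup>2)"
      using st z unfolding clifford_stable_def by (intro sum.mono_neutral_right) auto
    finally show "(\<Sum>k\<in>UNIV. (inner \<zeta> (Gam k \<theta>))\<^sup>2) =
        (\<Sum>a\<in>I. (\<Sum>k\<in>UNIV. inner \<zeta> (Gam k \<theta>) * inner (s (\<xi> a)) (Gam k (s \<eta>)))\<^sup>2)"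
      unfolding z rot proj .
  qed
qed

text \<open>Gamma matrices are self-adjoint, so the adjoint reverses their order and skewness turns
  the reversal into a sign. The spin connection thus preserves the inner product.\<close>

lemma inner_cl2_skew:
  assumes "\<And>a b. f a b = - f b a"
  shows "inner (cl2 f \<zeta>) \<xi> = - inner \<zeta> (cl2 f \<xi>)"
proof -
  have "inner (cl2 f \<zeta>) \<xi> = (\<Sum>a\<in>UNIV. \<Sum>b\<in>UNIV. f a b * inner \<zeta> (Gam b (Gam a \<xi>)))"
    by (simp add: cl2_def inner_sum_left inner_Gam)
  also have "\<dots> = (\<Sum>b\<in>UNIV. \<Sum>a\<in>UNIV. - f b a * inner \<zeta> (Gam b (Gam a \<xi>)))"
    by (subst sum.swap) (simp only: assms[symmetric])
  finally show ?thesis by (simp add: cl2_def inner_sum_right sum_negf)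
qed

section \<open>Parallel spinors and their bilinears\<close>

locale spin_geometry = manifold A
  for A :: "'m::topological_space atlas" +
  fixes g :: "'m metric_tensor" and D :: "'m connection" and H :: "'m form3"
    and S :: "('m, 'i) spin_data"
  assumes metric: "riemannian_metric A g" and levi_civita: "levi_civita A g D"
    and three_form: "three_form A H" and spin: "spin_structure A g S"
begin

lemma linear_at_add:
  "linear_at A p \<alpha> \<Longrightarrow> u \<in> tangent A p \<Longrightarrow> v \<in> tangent A p \<Longrightarrow> \<alpha> (u + v) = \<alpha> u + \<alpha> v"
  by (simp add: linear_at_def)

lemma linear_at_scaleR: "linear_at A p \<alpha> \<Longrightarrow> u \<in> tangent A p \<Longrightarrow> \<alpha> (c *\<^sub>R u) = c *\<^sub>R \<alpha> u"
  by (simp add: linear_at_def)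

lemma linear_at_zero: "linear_at A p \<alpha> \<Longrightarrow> \<alpha> 0 = 0"
  using linear_at_scaleR[OF _ tangent_zero, of p \<alpha> 0] by simp

lemma linear_at_sum:
  assumes "linear_at A p \<alpha>" "\<And>a. a \<in> I \<Longrightarrow> v a \<in> tangent A p"
  shows "\<alpha> (\<Sum>a\<in>I. c a *\<^sub>R v a) = (\<Sum>a\<in>I. c a *\<^sub>R \<alpha> (v a))"
  using assms(2)
proof (induct I rule: infinite_finite_induct)
  case (insert a I)
  have "(\<Sum>a\<in>I. c a *\<^sub>R v a) \<in> tangent A p" "v a \<in> tangent A p"
    using insert.prems by (auto intro: tangent_lincomb)
  then have "\<alpha> (c a *\<^sub>R v a + (\<Sum>a\<in>I. c a *\<^sub>R v a)) = c a *\<^sub>R \<alpha> (v a) + \<alpha> (\<Sum>a\<in>I. c a *\<^sub>R v a)"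
    by (simp only: linear_at_add[OF assms(1)] linear_at_scaleR[OF assms(1)] tangent_scaleR)
  moreover have "\<alpha> (\<Sum>a\<in>I. c a *\<^sub>R v a) = (\<Sum>a\<in>I. c a *\<^sub>R \<alpha> (v a))"
    by (rule insert.hyps(3)) (use insert.prems in blast)
  ultimately show ?case by (simp only: sum.insert[OF insert.hyps(1,2)])
qed (simp_all add: linear_at_zero[OF assms(1)])

context
  fixes p u assumes u: "u \<in> tangent A p"
begin

lemma g_linear: "linear_at A p (g p u)"
  using metric u unfolding riemannian_metric_def by blast

lemma g_commute: "v \<in> tangent A p \<Longrightarrow> g p u v = g p v u"
  using metric u unfolding riemannian_metric_def by blast

lemma g_pos: "u \<noteq> 0 \<Longrightarrow> 0 < g p u u"
  using metric u unfolding riemannian_metric_def by blast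

lemma H_linear: "v \<in> tangent A p \<Longrightarrow> linear_at A p (H p u v)"
  using three_form u unfolding three_form_def by blast

lemma H_swap:
  assumes "v \<in> tangent A p" "w \<in> tangent A p"
  shows "H p u v w = - H p v u w" "H p u v w = - H p u w v"
  using three_form u assms unfolding three_form_def by blast+

text \<open>Linearity of \<open>H\<close> is given in the last slot; cyclic rotation, an even
  permutation, moves any slot there without a sign.\<close>

lemma H_rotate:
  assumes "v \<in> tangent A p" "w \<in> tangent A p"
  shows "H p u v w = H p v w u"
proof -
  have "H p v u w = - H p v w u"
    using three_form u assms unfolding three_form_def by blast
  then show ?thesis using H_swap[OF assms] by simp
qed

end

abbreviation "E i a p \<equiv> frame S i a p"

lemma patch_open: "open (patch S i)"
  using spin unfolding spin_structure_def by blast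

lemma patch_cover: "\<exists>i. p \<in> patch S i"
  using spin unfolding spin_structure_def by blast

lemma frame_field: "frame S i a \<in> vector_fields A (patch S i)"
  using spin unfolding spin_structure_def orthonormal_frame_def by blast

lemma
  assumes "p \<in> patch S i"
  shows frame_tangent: "E i a p \<in> tangent A p"
    and frame_orthonormal: "g p (E i a p) (E i b p) = (if a = b then 1 else 0)"
    and frame_expand: "v \<in> tangent A p \<Longrightarrow> (\<Sum>a\<in>UNIV. g p (E i a p) v *\<^sub>R E i a p) = v"
proof -
  have "orthonormal_basis_at A g p (\<lambda>k. E i k p)"
    using spin assms unfolding spin_structure_def orthonormal_frame_def by blast
  then show "E i a p \<in> tangent A p" "g p (E i a p) (E i b p) = (if a = b then 1 else 0)"
    "v \<in> tangent A p \<Longrightarrow> (\<Sum>a\<in>UNIV. g p (E i a p) v *\<^sub>R E i a p) = v"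
    unfolding orthonormal_basis_at_def by simp_all
qed

lemma linear_at_frame:
  assumes "p \<in> patch S i" "v \<in> tangent A p" "linear_at A p \<alpha>"
  shows "\<alpha> v = (\<Sum>a\<in>UNIV. g p (E i a p) v *\<^sub>R \<alpha> (E i a p))"
proof -
  have "\<alpha> (\<Sum>a\<in>UNIV. g p (E i a p) v *\<^sub>R E i a p) = (\<Sum>a\<in>UNIV. g p (E i a p) v *\<^sub>R \<alpha> (E i a p))"
    by (rule linear_at_sum[OF assms(3)]) (rule frame_tangent[OF assms(1)])
  then show ?thesis by (simp only: frame_expand[OF assms(1,2)])
qed

lemma g_frame:
  assumes "p \<in> patch S i" "u \<in> tangent A p" "v \<in> tangent A p"
  shows "g p u v = (\<Sum>a\<in>UNIV. g p (E i a p) u * g p (E i a p) v)"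
  using linear_at_frame[OF assms(1,3) g_linear[OF assms(2)]]
    g_commute[OF assms(2) frame_tangent[OF assms(1)]]
  by (simp add: mult.commute)

lemma tangent_eqI:
  assumes "p \<in> patch S i" "u \<in> tangent A p" "v \<in> tangent A p" "\<And>a. g p (E i a p) u = g p (E i a p) v"
  shows "u = v"
proof -
  have "u = (\<Sum>a\<in>UNIV. g p (E i a p) u *\<^sub>R E i a p)"
    by (rule frame_expand[OF assms(1,2), symmetric])
  also have "\<dots> = v"
    unfolding assms(4) by (rule frame_expand[OF assms(1,3)])
  finally show ?thesis .
qed

lemma sharp_unique:
  assumes "v \<in> tangent A p" "\<And>w. w \<in> tangent A p \<Longrightarrow> g p v w = \<alpha> w"
  shows "sharp A g p \<alpha> = v"
  unfolding sharp_def
proof (rule the_equality)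
  show "v \<in> tangent A p \<and> (\<forall>w\<in>tangent A p. g p v w = \<alpha> w)" using assms by blast
  fix x assume x: "x \<in> tangent A p \<and> (\<forall>w\<in>tangent A p. g p x w = \<alpha> w)"
  obtain i where i: "p \<in> patch S i" using patch_cover by blast
  show "x = v"
  proof (rule tangent_eqI[OF i])
    fix a
    note e = frame_tangent[OF i, of a]
    have "g p x (E i a p) = g p v (E i a p)" using assms x e by simp
    then show "g p (E i a p) x = g p (E i a p) v"
      using g_commute[OF e] x assms(1) by simp
  qed (use x assms in auto)
qed

lemma sharp:
  assumes "linear_at A p \<alpha>"
  shows "sharp A g p \<alpha> \<in> tangent A p" "w \<in> tangent A p \<Longrightarrow> g p (sharp A g p \<alpha>) w = \<alpha> w"
proof -
  obtain i where i: "p \<in> patch S i" using patch_cover by blast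
  define v where "v = (\<Sum>a\<in>UNIV. \<alpha> (E i a p) *\<^sub>R E i a p)"
  have v: "v \<in> tangent A p" unfolding v_def by (intro tangent_lincomb frame_tangent i)
  have gv: "g p v w = \<alpha> w" if w: "w \<in> tangent A p" for w
  proof -
    have "g p w v = (\<Sum>a\<in>UNIV. \<alpha> (E i a p) *\<^sub>R g p w (E i a p))"
      unfolding v_def by (rule linear_at_sum[OF g_linear[OF w]]) (rule frame_tangent[OF i])
    also have "\<dots> = (\<Sum>a\<in>UNIV. g p (E i a p) w *\<^sub>R \<alpha> (E i a p))"
      using g_commute[OF w frame_tangent[OF i]] by (simp add: mult.commute)
    also have "\<dots> = \<alpha> w" by (rule linear_at_frame[OF i w assms, symmetric])
    finally show ?thesis using g_commute[OF w v] by simp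
  qed
  have "sharp A g p \<alpha> = v" by (rule sharp_unique[OF v gv])
  then show "sharp A g p \<alpha> \<in> tangent A p" "w \<in> tangent A p \<Longrightarrow> g p (sharp A g p \<alpha>) w = \<alpha> w"
    using v gv by simp_all
qed

lemma H_vec:
  assumes u: "u \<in> tangent A p" and v: "v \<in> tangent A p"
  shows "H_vec A g H p u v \<in> tangent A p"
    "w \<in> tangent A p \<Longrightarrow> g p (H_vec A g H p u v) w = H p w u v"
proof -
  have "linear_at A p (\<lambda>z. H p z u v)"
  proof -
    have rot: "H p z u v = H p u v z" if "z \<in> tangent A p" for z
      by (rule H_rotate[OF that u v])
    note lin = H_linear[OF u v]
    show ?thesis
      unfolding linear_at_def
    proof (intro conjI ballI allI)
      fix x y assume x: "x \<in> tangent A p" and y: "y \<in> tangent A p"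
      show "H p (x + y) u v = H p x u v + H p y u v"
        unfolding rot[OF x] rot[OF y] rot[OF tangent_plus[OF x y]] by (rule linear_at_add[OF lin x y])
    next
      fix c x assume x: "x \<in> tangent A p"
      show "H p (c *\<^sub>R x) u v = c *\<^sub>R H p x u v"
        unfolding rot[OF x] rot[OF tangent_scaleR[OF x]] by (rule linear_at_scaleR[OF lin x])
    qed
  qed
  note lin = this
  show "H_vec A g H p u v \<in> tangent A p"
    unfolding H_vec_def by (rule sharp(1)[OF lin])
  show "g p (H_vec A g H p u v) w = H p w u v" if "w \<in> tangent A p"
    unfolding H_vec_def by (rule sharp(2)[OF lin that])
qed

lemma vector_fields_tangent: "X \<in> vector_fields A U \<Longrightarrow> p \<in> U \<Longrightarrow> X p \<in> tangent A p"
  unfolding vector_fields_def by blast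

lemma vector_fields_smooth:
  assumes "X \<in> vector_fields A U" "open W" "W \<subseteq> U" "smooth_fun A W f"
  shows "smooth_fun A W (\<lambda>p. X p f)"
  by (rule assms(1)[unfolded vector_fields_def mem_Collect_eq, THEN conjunct2, rule_format, OF assms(2-4)])

lemma vector_fields_subset:
  assumes "X \<in> vector_fields A U" "V \<subseteq> U" shows "X \<in> vector_fields A V"
  unfolding vector_fields_def
proof (intro CollectI conjI ballI allI impI)
  show "X p \<in> tangent A p" if "p \<in> V" for p using vector_fields_tangent[OF assms(1)] assms(2) that by blast
  show "smooth_fun A W (\<lambda>p. X p f)" if "open W" "W \<subseteq> V" "smooth_fun A W f" for W f
    by (rule vector_fields_smooth[OF assms(1) that(1) subset_trans[OF that(2) assms(2)] that(3)])
qed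

lemma g_smooth:
  assumes "open U" "X \<in> vector_fields A U" "Y \<in> vector_fields A U"
  shows "smooth_fun A U (\<lambda>p. g p (X p) (Y p))"
  by (rule metric[unfolded riemannian_metric_def, THEN conjunct2, rule_format, OF assms])

lemma affine: "affine_connection A D"
  using levi_civita unfolding levi_civita_def by blast

text \<open>\<open>affine_connection\<close> gives tangency for derivatives along vector fields, so
  the single vector \<open>v\<close> is first expanded in a local frame.\<close>

lemma D_tangent:
  assumes "open U" "Y \<in> vector_fields A U" "p \<in> U" "v \<in> tangent A p"
  shows "D p v Y \<in> tangent A p"
proof -
  obtain i where i: "p \<in> patch S i" using patch_cover by blast
  let ?V = "U \<inter> patch S i"
  have V: "open ?V" "Y \<in> vector_fields A ?V" "frame S i a \<in> vector_fields A ?V" "p \<in> ?V" for a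
    using assms i patch_open vector_fields_subset[OF assms(2)] vector_fields_subset[OF frame_field] by auto
  note aff = affine[unfolded affine_connection_def, rule_format, OF V(1,2)]
  have "linear_at A p (\<lambda>v. D p v Y)"
    by (rule aff[THEN conjunct1, rule_format, OF V(4)])
  from linear_at_frame[OF i assms(4) this]
  have eq: "D p v Y = (\<Sum>a\<in>UNIV. g p (E i a p) v *\<^sub>R D p (E i a p) Y)" .
  have "(\<lambda>p. D p (E i a p) Y) \<in> vector_fields A ?V" for a
    by (rule aff[THEN conjunct2, THEN conjunct1, rule_format, OF V(3)])
  then have "D p (E i a p) Y \<in> tangent A p" for a
    using vector_fields_tangent[OF _ V(4)] by blast
  then show ?thesis unfolding eq by (rule tangent_lincomb)
qed

abbreviation "N \<equiv> nabla_hat A g H D"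

lemma N_tangent:
  assumes "open U" "Y \<in> vector_fields A U" "p \<in> U" "v \<in> tangent A p"
  shows "N p v Y \<in> tangent A p"
  unfolding nabla_hat_def
  by (intro tangent_plus tangent_scaleR D_tangent[OF assms] H_vec assms vector_fields_tangent[OF assms(2,3)])

text \<open>The torsion adds half of \<open>H p (Y p) v (X p)\<close> and half of
  \<open>H p (X p) v (Y p)\<close>, which cancel by total antisymmetry.\<close>

lemma N_metric:
  assumes "open U" "X \<in> vector_fields A U" "Y \<in> vector_fields A U" "p \<in> U" and v: "v \<in> tangent A p"
  shows "v (\<lambda>q. g q (X q) (Y q)) = g p (N p v X) (Y p) + g p (X p) (N p v Y)"
proof -
  note X = vector_fields_tangent[OF assms(2,4)] and Y = vector_fields_tangent[OF assms(3,4)]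
  note DX = D_tangent[OF assms(1,2,4,5)] and DY = D_tangent[OF assms(1,3,4,5)]
  note HX = H_vec[OF v X] and HY = H_vec[OF v Y]
  have "g p (N p v X) (Y p) = g p (D p v X) (Y p) + (1/2) * H p (Y p) v (X p)"
    using g_commute[OF N_tangent[OF assms(1,2,4,5)] Y] g_commute[OF DX Y] g_commute[OF HX(1) Y] HX(2)[OF Y]
    unfolding nabla_hat_def
    by (simp add: linear_at_add[OF g_linear[OF Y] DX tangent_scaleR[OF HX(1)]] linear_at_scaleR[OF g_linear[OF Y] HX(1)])
  moreover have "g p (X p) (N p v Y) = g p (X p) (D p v Y) + (1/2) * H p (X p) v (Y p)"
    using g_commute[OF HY(1) X] HY(2)[OF X]
    unfolding nabla_hat_def
    by (simp add: linear_at_add[OF g_linear[OF X] DY tangent_scaleR[OF HY(1)]] linear_at_scaleR[OF g_linear[OF X] HY(1)])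
  moreover have "H p (Y p) v (X p) = - H p (X p) v (Y p)"
    using H_rotate[OF Y v X] H_swap(2)[OF v X Y] H_rotate[OF v Y X] H_rotate[OF v X Y] H_swap(1)[OF X v Y] by simp
  moreover have "v (\<lambda>q. g q (X q) (Y q)) = g p (D p v X) (Y p) + g p (X p) (D p v Y)"
    by (rule levi_civita[unfolded levi_civita_def, THEN conjunct2, rule_format, OF assms(1-4), THEN conjunct2,
          rule_format, OF v])
  ultimately show ?thesis by simp
qed

definition parallel_field :: "'m vfield \<Rightarrow> bool" where
  "parallel_field X \<longleftrightarrow> X \<in> vector_fields A UNIV \<and> (\<forall>p. \<forall>v\<in>tangent A p. N p v X = 0)"

lemma parallel_field_tangent: "parallel_field X \<Longrightarrow> X p \<in> tangent A p"
  unfolding parallel_field_def using vector_fields_tangent by blast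

lemma parallel_field_g_constant:
  assumes "connected (UNIV :: 'm set)" "parallel_field X" "parallel_field Y"
  shows "g p (X p) (Y p) = g q (X q) (Y q)"
proof (rule constant_if_derivations_vanish[OF assms(1), of "\<lambda>p. g p (X p) (Y p)"])
  have X: "X \<in> vector_fields A UNIV" and Y: "Y \<in> vector_fields A UNIV"
    using assms unfolding parallel_field_def by auto
  show "smooth_fun A UNIV (\<lambda>p. g p (X p) (Y p))" by (rule g_smooth[OF open_UNIV X Y])
  fix p v assume v: "v \<in> tangent A p"
  have "g p 0 (Y p) = 0" "g p (X p) 0 = 0"
    using linear_at_zero[OF g_linear] g_commute[OF tangent_zero] parallel_field_tangent assms by metis+
  moreover have "N p v X = 0" "N p v Y = 0" using assms v unfolding parallel_field_def by auto
  ultimately show "v (\<lambda>p. g p (X p) (Y p)) = 0"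
    using N_metric[OF open_UNIV X Y UNIV_I v] by simp
qed

text \<open>The connection matrix in the spin frame, exactly the two-form that
  \<open>spin_nabla\<close> inserts into \<open>cl2\<close>.\<close>

definition \<Omega> :: "'i \<Rightarrow> 'm \<Rightarrow> 'm tvec \<Rightarrow> 8 \<Rightarrow> 8 \<Rightarrow> real" where
  "\<Omega> i p v a b = g p (E i a p) (N p v (frame S i b))"

lemma \<Omega>_skew:
  assumes p: "p \<in> patch S i" and v: "v \<in> tangent A p"
  shows "\<Omega> i p v a b = - \<Omega> i p v b a"
proof -
  let ?f = "\<lambda>q. g q (E i a q) (E i b q)"
  have sm: "smooth_near A p ?f"
    by (rule smooth_nearI[OF patch_open p]) (rule g_smooth[OF patch_open frame_field frame_field])
  \<comment> \<open>Orthonormality holds only over the patch, so the two functions are compared as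
    germs.\<close>
  have "v ?f = v (\<lambda>q. if a = b then 1 else 0)"
    by (rule tangent_germ[OF v patch_open p _ sm smooth_near_const]) (rule frame_orthonormal)
  also have "\<dots> = 0" by (rule tangent_const[OF v])
  finally have "g p (N p v (frame S i a)) (E i b p) + g p (E i a p) (N p v (frame S i b)) = 0"
    using N_metric[OF patch_open frame_field frame_field p v] by simp
  then show ?thesis
    unfolding \<Omega>_def
    using g_commute[OF frame_tangent[OF p] N_tangent[OF patch_open frame_field p v], of b a] by simp
qed

text \<open>Metric compatibility for \<open>frame S i a\<close> and \<open>X\<close> replaces a
  Leibniz expansion of \<open>X\<close> in the frame; skewness then transposes the connection
  matrix.\<close>

lemma N_component:
  assumes X: "X \<in> vector_fields A UNIV" and p: "p \<in> patch S i" and v: "v \<in> tangent A p"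
  shows "g p (E i a p) (N p v X) = v (\<lambda>q. g q (E i a q) (X q)) + (\<Sum>b\<in>UNIV. \<Omega> i p v a b * g p (E i b p) (X p))"
proof -
  have X': "X \<in> vector_fields A (patch S i)" by (rule vector_fields_subset[OF X]) simp
  have "g p (N p v (frame S i a)) (X p) = (\<Sum>b\<in>UNIV. \<Omega> i p v b a * g p (E i b p) (X p))"
    unfolding \<Omega>_def
    by (rule g_frame[OF p N_tangent[OF patch_open frame_field p v] vector_fields_tangent[OF X' p]])
  also have "\<dots> = (\<Sum>b\<in>UNIV. - \<Omega> i p v a b * g p (E i b p) (X p))"
    by (rule sum.cong) (simp_all only: \<Omega>_skew[OF p v, of a])
  finally show ?thesis
    using N_metric[OF patch_open frame_field X' p v, of a] by (simp add: sum_negf)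
qed

abbreviation "parallel \<equiv> parallel_spinor A g N S"

lemma parallel_spinor_deriv:
  assumes "parallel \<epsilon>" "p \<in> patch S i" "v \<in> tangent A p"
  shows "spinor_deriv v (\<epsilon> i) = - ((1/4) *\<^sub>R cl2 (\<Omega> i p v) (\<epsilon> i p))"
proof -
  have "spin_nabla g N S \<epsilon> i p v = 0"
    using assms unfolding parallel_spinor_def by blast
  then show ?thesis unfolding spin_nabla_def \<Omega>_def by (simp add: eq_neg_iff_add_eq_0)
qed

lemma parallel_spinor_smooth: "parallel \<epsilon> \<Longrightarrow> smooth_fun A (patch S i) (\<epsilon> i)"
  unfolding parallel_spinor_def spinor_section_def by blast

lemma bounded_linear_Gam: "bounded_linear (Gam a)"
  using linear_Gam linear_conv_bounded_linear by blast

context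
  fixes \<epsilon>1 \<epsilon>2 assumes e1: "parallel \<epsilon>1" and e2: "parallel \<epsilon>2"
begin

abbreviation "bil i a p \<equiv> inner (\<epsilon>1 i p) (Gam a (\<epsilon>2 i p))"

text \<open>\<open>bilinear1\<close> evaluates in a patch picked by \<open>SOME\<close>. Every patch
  gives the same value, because the lift is isometric and intertwines the gamma matrices with the
  change of frame.\<close>

lemma bilinear1_eq:
  assumes p: "p \<in> patch S i" and v: "v \<in> tangent A p"
  shows "bilinear1 A g S \<epsilon>1 \<epsilon>2 p v = (\<Sum>a\<in>UNIV. g p (E i a p) v * bil i a p)"
proof -
  define j where "j = (SOME i. p \<in> patch S i)"
  have j: "p \<in> patch S j" unfolding j_def using p by (rule someI)
  define l where "l = lift S j i p"
  have trans: "\<epsilon> j p = l (\<epsilon> i p)" if "parallel \<epsilon>" for \<epsilon>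
    using that p j unfolding parallel_spinor_def spinor_section_def l_def by blast
  have lS: "l \<in> Spin8"
    and lG: "l (Gam b \<zeta>) = (\<Sum>a\<in>UNIV. g p (E j a p) (E i b p) *\<^sub>R Gam a (l \<zeta>))" for b \<zeta>
    using spin p j unfolding spin_structure_def l_def by blast+
  have lin: "linear l" and iso: "\<And>\<zeta> \<xi>. inner (l \<zeta>) (l \<xi>) = inner \<zeta> \<xi>"
    using Spin8_rotation[OF lS] by blast+
  have coef: "g p (E j a p) v = (\<Sum>b\<in>UNIV. g p (E i b p) v * g p (E j a p) (E i b p))" for a
    using linear_at_frame[OF p v g_linear[OF frame_tangent[OF j]]] by simp
  have cl: "cl1 (\<lambda>a. g p (E j a p) v) (l \<zeta>) = l (cl1 (\<lambda>a. g p (E i a p) v) \<zeta>)" for \<zeta>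
  proof -
    have "cl1 (\<lambda>a. g p (E j a p) v) (l \<zeta>) =
        (\<Sum>a\<in>UNIV. \<Sum>b\<in>UNIV. (g p (E i b p) v * g p (E j a p) (E i b p)) *\<^sub>R Gam a (l \<zeta>))"
      unfolding cl1_def by (subst coef) (simp add: scaleR_sum_left)
    also have "\<dots> = (\<Sum>b\<in>UNIV. g p (E i b p) v *\<^sub>R l (Gam b \<zeta>))"
      by (subst sum.swap) (simp add: lG scaleR_sum_right)
    finally show ?thesis by (simp add: cl1_def linear_sum[OF lin] linear_cmul[OF lin])
  qed
  have "bilinear1 A g S \<epsilon>1 \<epsilon>2 p v = inner (\<epsilon>1 j p) (cl1 (\<lambda>a. g p (E j a p) v) (\<epsilon>2 j p))"
    using v by (simp add: bilinear1_def j_def Let_def)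
  also have "\<dots> = inner (\<epsilon>1 i p) (cl1 (\<lambda>a. g p (E i a p) v) (\<epsilon>2 i p))"
    unfolding trans[OF e1] trans[OF e2] cl iso ..
  finally show ?thesis by (simp add: cl1_def inner_sum_right)
qed

lemma bilinear1_linear: "linear_at A p (bilinear1 A g S \<epsilon>1 \<epsilon>2 p)"
proof -
  obtain i where i: "p \<in> patch S i" using patch_cover by blast
  note fr = g_linear[OF frame_tangent[OF i]]
  show ?thesis
    unfolding linear_at_def
  proof (intro conjI ballI allI)
    fix u v assume u: "u \<in> tangent A p" and v: "v \<in> tangent A p"
    show "bilinear1 A g S \<epsilon>1 \<epsilon>2 p (u + v) = bilinear1 A g S \<epsilon>1 \<epsilon>2 p u + bilinear1 A g S \<epsilon>1 \<epsilon>2 p v"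
      by (simp add: bilinear1_eq[OF i] u v tangent_plus linear_at_add[OF fr u v] distrib_right sum.distrib)
  next
    fix c u assume u: "u \<in> tangent A p"
    show "bilinear1 A g S \<epsilon>1 \<epsilon>2 p (c *\<^sub>R u) = c *\<^sub>R bilinear1 A g S \<epsilon>1 \<epsilon>2 p u"
      by (simp add: bilinear1_eq[OF i] u tangent_scaleR linear_at_scaleR[OF fr u] sum_distrib_left mult.assoc)
  qed
qed

definition "bil_field = dual_field A g (bilinear1 A g S \<epsilon>1 \<epsilon>2)"

lemma bil_field_tangent: "bil_field p \<in> tangent A p"
  unfolding bil_field_def dual_field_def by (rule sharp[OF bilinear1_linear])

lemma bil_field_component:
  assumes p: "p \<in> patch S i" shows "g p (E i a p) (bil_field p) = bil i a p"
proof -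
  note e = frame_tangent[OF p, of a]
  have "g p (E i a p) (bil_field p) = bilinear1 A g S \<epsilon>1 \<epsilon>2 p (E i a p)"
    using g_commute[OF e bil_field_tangent] sharp(2)[OF bilinear1_linear e]
    by (simp add: bil_field_def dual_field_def)
  then show ?thesis
    by (simp add: bilinear1_eq[OF p e] frame_orthonormal[OF p] if_distrib[of "\<lambda>x. x * _"] cong: if_cong)
qed

lemma bil_smooth: "smooth_fun A (patch S i) (bil i a)"
  by (intro smooth_fun_bilinear[OF bounded_bilinear_inner patch_open]
      smooth_fun_linear[OF bounded_linear_Gam patch_open] parallel_spinor_smooth e1 e2)

lemma bil_field_smooth: "bil_field \<in> vector_fields A UNIV"
  unfolding vector_fields_def
proof (intro CollectI conjI ballI allI impI)
  show "bil_field p \<in> tangent A p" for p by (rule bil_field_tangent)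
  fix W and f :: "'m \<Rightarrow> real" assume W: "open W" "smooth_fun A W f"
  show "smooth_fun A W (\<lambda>p. bil_field p f)"
  proof (rule smooth_fun_local)
    fix p assume "p \<in> W"
    obtain i where i: "p \<in> patch S i" using patch_cover by blast
    let ?W = "W \<inter> patch S i"
    have o: "open ?W" using W patch_open by blast
    have "smooth_fun A ?W (\<lambda>q. E i a q f)" for a
      by (rule vector_fields_smooth[OF frame_field o]) (auto intro: smooth_fun_subset[OF _ W(2)])
    then have "smooth_fun A ?W (\<lambda>q. \<Sum>a\<in>UNIV. bil i a q * E i a q f)"
      by (intro smooth_fun_sum o smooth_fun_bilinear[OF bounded_bilinear_mult]
          smooth_fun_subset[OF _ bil_smooth]) auto
    moreover have "(\<Sum>a\<in>UNIV. bil i a q * E i a q f) = bil_field q f" if "q \<in> ?W" for q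
    proof -
      have "bil_field q f = (\<Sum>a\<in>UNIV. g q (E i a q) (bil_field q) *\<^sub>R E i a q) f"
        using that by (simp only: frame_expand[OF _ bil_field_tangent] Int_iff)
      then show ?thesis using that by (simp add: sum_apply scaleR_apply bil_field_component)
    qed
    ultimately have "smooth_fun A ?W (\<lambda>q. bil_field q f)"
      using smooth_fun_cong[OF o, of "\<lambda>q. \<Sum>a\<in>UNIV. bil i a q * E i a q f" "\<lambda>q. bil_field q f"] by blast
    then show "\<exists>W'. open W' \<and> p \<in> W' \<and> smooth_fun A W' (\<lambda>q. bil_field q f)"
      using o \<open>p \<in> W\<close> i by blast
  qed
qed

text \<open>Differentiating \<open>bil\<close> puts both spin connection terms into a commutator
  with \<open>Gam a\<close>. The factor 1/4 of the spin connection meets the 4 of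
  \<open>cl2_Gam_commutator\<close>, and the result cancels the frame term in
  \<open>N_component\<close>.\<close>

lemma bil_field_parallel: "parallel_field bil_field"
  unfolding parallel_field_def
proof (intro conjI allI ballI bil_field_smooth)
  fix p v assume v: "v \<in> tangent A p"
  obtain i where p: "p \<in> patch S i" using patch_cover by blast
  let ?O = "\<Omega> i p v"
  have skew: "?O a b = - ?O b a" for a b by (rule \<Omega>_skew[OF p v])
  have near: "smooth_near A p (\<epsilon>1 i)" "smooth_near A p (\<epsilon>2 i)"
    using parallel_spinor_smooth e1 e2 p smooth_nearI[OF patch_open] by blast+
  have nearG: "smooth_near A p (\<lambda>q. Gam a (\<epsilon>2 i q))" for a
    by (rule smooth_near_linear[OF bounded_linear_Gam near(2)])
  show "N p v bil_field = 0"
  proof (rule tangent_eqI[OF p _ tangent_zero])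
    show "N p v bil_field \<in> tangent A p" by (rule N_tangent[OF open_UNIV bil_field_smooth UNIV_I v])
    fix a
    have field: "bil_field \<in> vector_fields A (patch S i)"
      by (rule vector_fields_subset[OF bil_field_smooth]) simp
    have "v (\<lambda>q. g q (E i a q) (bil_field q)) = v (bil i a)"
      by (rule tangent_germ[OF v patch_open p])
        (intro bil_field_component smooth_nearI[OF patch_open p] g_smooth patch_open frame_field field bil_smooth; assumption)+
    also have "\<dots> = inner (spinor_deriv v (\<epsilon>1 i)) (Gam a (\<epsilon>2 i p)) + inner (\<epsilon>1 i p) (Gam a (spinor_deriv v (\<epsilon>2 i)))"
      using tangent_inner[OF v near(1) nearG] by (simp only: spinor_deriv_Gam[OF v near(2)])
    also have "\<dots> = - (1/4) * inner (\<epsilon>1 i p)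
        (Gam a (cl2 ?O (\<epsilon>2 i p)) - cl2 ?O (Gam a (\<epsilon>2 i p)))"
      unfolding parallel_spinor_deriv[OF e1 p v] parallel_spinor_deriv[OF e2 p v]
      using inner_cl2_skew[where f = ?O, OF skew, of "\<epsilon>1 i p" "Gam a (\<epsilon>2 i p)"]
      by (simp add: Gam_linear inner_diff_right diff_divide_distrib)
    also have "Gam a (cl2 ?O (\<epsilon>2 i p)) - cl2 ?O (Gam a (\<epsilon>2 i p)) = 4 *\<^sub>R cl1 (?O a) (\<epsilon>2 i p)"
      using cl2_Gam_commutator[where f = ?O and m = a and \<zeta> = "\<epsilon>2 i p", OF skew]
      by (simp add: algebra_simps)
    also have "- (1/4) * inner (\<epsilon>1 i p) (4 *\<^sub>R cl1 (?O a) (\<epsilon>2 i p)) = - (\<Sum>b\<in>UNIV. ?O a b * bil i b p)"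
      by (simp add: cl1_def inner_sum_right)
    finally have "g p (E i a p) (N p v bil_field) = 0"
      using N_component[OF bil_field_smooth p v, of a] by (simp add: bil_field_component[OF p])
    then show "g p (E i a p) (N p v bil_field) = g p (E i a p) 0"
      using linear_at_zero[OF g_linear[OF frame_tangent[OF p]]] by simp
  qed
qed

end

end

section \<open>The action of the bilinears\<close>

context spin_geometry
begin

lemma linear_at_diff:
  assumes "linear_at A p \<alpha>" "u \<in> tangent A p" "v \<in> tangent A p"
  shows "\<alpha> (u - v) = \<alpha> u - (\<alpha> v :: real)"
proof -
  have "u = (u - v) + v" by simp
  then have "\<alpha> u = \<alpha> ((u - v) + v)" by (rule arg_cong)
  also have "\<dots> = \<alpha> (u - v) + \<alpha> v" by (rule linear_at_add[OF assms(1) tangent_diff[OF assms(2,3)] assms(3)])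
  finally show ?thesis by linarith
qed

text \<open>The squared length of \<open>u - v\<close> is \<open>r - 2 * r + r\<close>. This will
  identify a bilinear field with its projection onto known fields.\<close>

lemma g_eqI:
  assumes u: "u \<in> tangent A p" and v: "v \<in> tangent A p" and "g p u u = r" "g p u v = r" "g p v v = r"
  shows "u = v"
proof (rule ccontr)
  assume "u \<noteq> v"
  note d = tangent_diff[OF u v]
  have "g p (u - v) (u - v) = g p (u - v) u - g p (u - v) v"
    by (rule linear_at_diff[OF g_linear[OF d] u v])
  also have "\<dots> = g p u (u - v) - g p v (u - v)"
    unfolding g_commute[OF d u] g_commute[OF d v] ..
  also have "\<dots> = (g p u u - g p u v) - (g p v u - g p v v)"
    unfolding linear_at_diff[OF g_linear[OF u] u v] linear_at_diff[OF g_linear[OF v] u v] ..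
  finally have "g p (u - v) (u - v) = 0" using assms g_commute[OF u v] by simp
  moreover have "u - v \<noteq> 0" using \<open>u \<noteq> v\<close> by (simp only: right_minus_eq not_False_eq_True)
  ultimately show False using g_pos[OF d] by simp
qed

text \<open>For parallel \<open>Z\<close> the Levi-Civita derivative along \<open>u\<close> is minus
  half of \<open>H_vec A g H p u (Z p)\<close>. Here both derivatives vanish, and torsion freeness
  yields the bracket.\<close>

lemma lie_bracket_parallel:
  assumes X: "parallel_field X" and Y: "parallel_field Y"
    and H0: "\<And>z. z \<in> tangent A p \<Longrightarrow> H p z (X p) (Y p) = 0"
  shows "lie_bracket A X Y p = 0"
proof -
  note x = parallel_field_tangent[OF X, of p] and y = parallel_field_tangent[OF Y, of p]
  have vf: "X \<in> vector_fields A UNIV" "Y \<in> vector_fields A UNIV"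
    using X Y unfolding parallel_field_def by auto
  have g0: "g p 0 w = 0" if "w \<in> tangent A p" for w
    using linear_at_zero[OF g_linear[OF that]] g_commute[OF that tangent_zero] by simp
  have H_vec_zero: "H_vec A g H p u v = 0" if "\<And>z. z \<in> tangent A p \<Longrightarrow> H p z u v = 0" for u v
    unfolding H_vec_def by (rule sharp_unique[OF tangent_zero]) (simp only: g0 that)
  have D: "D p u Z = 0" if "N p u Z = 0" "H_vec A g H p u (Z p) = 0" for u Z
    using that(1) unfolding nabla_hat_def that(2) scaleR_zero_right add_0_right .
  have "H p z (Y p) (X p) = 0" if "z \<in> tangent A p" for z
    using H_swap(2)[OF that y x] H0[OF that] by simp
  then have "D p (X p) Y = 0" "D p (Y p) X = 0"
    using X Y x y H0 by (auto intro!: D H_vec_zero simp: parallel_field_def)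
  moreover have "D p (X p) Y - D p (Y p) X = lie_bracket A X Y p"
    by (rule levi_civita[unfolded levi_civita_def, THEN conjunct2, rule_format, OF open_UNIV vf UNIV_I, THEN conjunct1])
  ultimately show ?thesis by (simp only: diff_0_right)
qed

text \<open>Every element of the image of \<open>L\<close> under \<open>s\<close> is the value at
  \<open>p\<close> of a parallel spinor, so the dilatino equation becomes an algebraic condition on
  the whole image, and \<open>contract_three_form_eq_0\<close> applies. Only the point
  \<open>p\<close> enters, so \<open>s\<close> may vary with it.\<close>

lemma bilinears_H_vanish:
  assumes st: "clifford_stable I L" and p: "p \<in> patch S i"
    and s: "s \<in> Spin8" and rep: "{\<epsilon> i p |\<epsilon>. parallel \<epsilon>} = s ` L"
    and dil: "\<And>\<epsilon>. parallel \<epsilon> \<Longrightarrow> dilatino H \<Phi> S \<epsilon>"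
    and par: "parallel \<epsilon>1" "parallel \<epsilon>2" "parallel \<epsilon>3" "parallel \<epsilon>4" and z: "z \<in> tangent A p"
  shows "H p z (bil_field \<epsilon>1 \<epsilon>2 p) (bil_field \<epsilon>3 \<epsilon>4 p) = 0"
proof -
  define h where "h a b c = H p (E i a p) (E i b p) (E i c p)" for a b c
  define x y where "x = bil_field \<epsilon>1 \<epsilon>2 p" and "y = bil_field \<epsilon>3 \<epsilon>4 p"
  note e = frame_tangent[OF p]
  have xt: "x \<in> tangent A p" and yt: "y \<in> tangent A p"
    unfolding x_def y_def using bil_field_tangent par by blast+
  have mem: "\<epsilon> i p \<in> s ` L" if "parallel \<epsilon>" for \<epsilon> using that rep by blast
  obtain \<eta> where "\<eta> \<in> L" "\<eta> \<noteq> 0"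
    using st subspace_0[of L] unfolding clifford_stable_def by blast
  moreover have "inner (s \<eta>) (s \<eta>) = inner \<eta> \<eta>" using Spin8_rotation[OF s] by blast
  ultimately have \<eta>: "s \<eta> \<in> s ` L" "s \<eta> \<noteq> 0" by auto
  have anti: "h a b c = - h b a c" "h a b c = - h a c b" for a b c
    unfolding h_def by (rule H_swap[OF e e e])+
  have "cl1 (\<lambda>a. E i a p \<Phi>) \<zeta> - (1/12) *\<^sub>R cl3 h \<zeta> = 0" if "\<zeta> \<in> s ` L" for \<zeta>
  proof -
    have "\<zeta> \<in> {\<epsilon> i p |\<epsilon>. parallel \<epsilon>}" using that rep by simp
    then obtain \<epsilon> where \<epsilon>: "\<zeta> = \<epsilon> i p" "parallel \<epsilon>" by blast
    then show ?thesis using dil[OF \<epsilon>(2)] p unfolding dilatino_def h_def by blast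
  qed
  note Q = this
  have vanish: "contract (\<lambda>k. bil \<epsilon>3 \<epsilon>4 i k p) (contract (\<lambda>k. bil \<epsilon>1 \<epsilon>2 i k p) h) c = 0" for c
    by (rule contract_three_form_eq_0[where L = "s ` L", OF anti Q stable_bilinear[OF st s] stable_bilinear[OF st s] \<eta>])
      (use mem par in blast)+
  have "H p x y (E i c p) = 0" for c
  proof -
    \<comment> \<open>To expand \<open>x\<close> and \<open>y\<close> in the frame, each is rotated
      into the last slot in turn.\<close>
    have 1: "H p (E i a p) y (E i c p) = (\<Sum>b\<in>UNIV. bil \<epsilon>3 \<epsilon>4 i b p * h a b c)" for a
    proof -
      have "H p (E i a p) y (E i c p) = H p (E i c p) (E i a p) y"
        using H_rotate[OF e yt e] H_rotate[OF yt e e] by simp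
      also have "\<dots> = (\<Sum>b\<in>UNIV. g p (E i b p) y *\<^sub>R H p (E i c p) (E i a p) (E i b p))"
        by (rule linear_at_frame[OF p yt H_linear[OF e e]])
      also have "\<dots> = (\<Sum>b\<in>UNIV. bil \<epsilon>3 \<epsilon>4 i b p * h a b c)"
        by (rule sum.cong) (simp_all add: y_def bil_field_component[OF par(3,4) p] h_def H_rotate[OF e e e, of c])
      finally show ?thesis .
    qed
    have "H p x y (E i c p) = H p y (E i c p) x" by (rule H_rotate[OF xt yt e])
    also have "\<dots> = (\<Sum>a\<in>UNIV. g p (E i a p) x *\<^sub>R H p y (E i c p) (E i a p))"
      by (rule linear_at_frame[OF p xt H_linear[OF yt e]])
    also have "\<dots> = (\<Sum>a\<in>UNIV. bil \<epsilon>1 \<epsilon>2 i a p * (\<Sum>b\<in>UNIV. bil \<epsilon>3 \<epsilon>4 i b p * h a b c))"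
      by (rule sum.cong) (simp_all add: x_def bil_field_component[OF par(1,2) p] H_rotate[OF e yt e, symmetric] 1)
    also have "\<dots> = (\<Sum>b\<in>UNIV. \<Sum>a\<in>UNIV. bil \<epsilon>3 \<epsilon>4 i b p * (bil \<epsilon>1 \<epsilon>2 i a p * h a b c))"
      by (subst sum.swap) (simp add: sum_distrib_left mult.left_commute)
    also have "\<dots> = contract (\<lambda>k. bil \<epsilon>3 \<epsilon>4 i k p) (contract (\<lambda>k. bil \<epsilon>1 \<epsilon>2 i k p) h) c"
      by (simp add: contract_apply sum_apply scaleR_apply sum_distrib_left)
    finally show ?thesis by (simp only: vanish)
  qed
  then have "H p x y z = 0"
    using linear_at_frame[OF p z H_linear[OF xt yt]] by simp
  then show ?thesis using H_rotate[OF z xt yt] by (simp add: x_def y_def)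
qed

text \<open>Bilinears chosen at one point extend to parallel fields, which stay orthonormal
  everywhere. \<open>e\<close> labels the directions in \<open>I\<close> by the coordinates of
  \<open>real^'d\<close>, so the dimension shows in the type.\<close>

lemma bilinears_action:
  fixes e :: "'d::finite \<Rightarrow> 8"
  assumes con: "connected (UNIV :: 'm set)" and st: "clifford_stable I L"
    and rep: "\<And>i p. p \<in> patch S i \<Longrightarrow> \<exists>s\<in>Spin8. {\<epsilon> i p |\<epsilon>. parallel \<epsilon>} = s ` L"
    and dil: "\<And>\<epsilon>. parallel \<epsilon> \<Longrightarrow> dilatino H \<Phi> S \<epsilon>"
    and e: "inj e" "range e = I"
  shows "\<exists>\<rho> :: real^'d \<Rightarrow> 'm vfield. euclidean_lie_action A g abelian_bracket \<rho> \<and>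
    range \<rho> = generated_lie_algebra A
      (dual_field A g ` span {bilinear1 A g S \<epsilon>1 \<epsilon>2 |\<epsilon>1 \<epsilon>2. parallel \<epsilon>1 \<and> parallel \<epsilon>2})"
proof -
  \<comment> \<open>Types are inhabited, so a base point exists.\<close>
  obtain p0 :: 'm where True by simp
  obtain i0 where p0: "p0 \<in> patch S i0" using patch_cover by blast
  obtain s where s: "s \<in> Spin8" and sL: "{\<epsilon> i0 p0 |\<epsilon>. parallel \<epsilon>} = s ` L" using rep[OF p0] by blast
  obtain \<eta> \<xi> where \<eta>: "\<eta> \<in> s ` L" and \<xi>: "\<forall>a\<in>I. \<xi> a \<in> s ` L"
    and on: "\<forall>a\<in>I. \<forall>b\<in>I.
      (\<Sum>k\<in>UNIV. inner (\<xi> a) (Gam k \<eta>) * inner (\<xi> b) (Gam k \<eta>)) = (if a = b then 1 else 0)"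
    and parseval: "\<forall>\<zeta>\<in>s ` L. \<forall>\<theta>\<in>s ` L. (\<Sum>k\<in>UNIV. (inner \<zeta> (Gam k \<theta>))\<^sup>2) =
      (\<Sum>a\<in>I. (\<Sum>k\<in>UNIV. inner \<zeta> (Gam k \<theta>) * inner (\<xi> a) (Gam k \<eta>))\<^sup>2)"
    using stable_orthonormal[OF st s] by (elim exE conjE)
  have "\<exists>\<epsilon>. parallel \<epsilon> \<and> \<epsilon> i0 p0 = \<zeta>" if "\<zeta> \<in> s ` L" for \<zeta>
    using that unfolding sL[symmetric] by blast
  note ex = this
  obtain \<epsilon>\<eta> where \<epsilon>\<eta>: "parallel \<epsilon>\<eta>" "\<epsilon>\<eta> i0 p0 = \<eta>" using ex[OF \<eta>] by blast
  have "\<forall>a\<in>I. \<exists>\<epsilon>. parallel \<epsilon> \<and> \<epsilon> i0 p0 = \<xi> a" using ex[OF \<xi>[rule_format]] by blast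
  then obtain \<epsilon>\<xi> where "\<forall>a\<in>I. parallel (\<epsilon>\<xi> a) \<and> \<epsilon>\<xi> a i0 p0 = \<xi> a"
    by (rule bchoice[THEN exE])
  then have \<epsilon>\<xi>: "parallel (\<epsilon>\<xi> a)" "\<epsilon>\<xi> a i0 p0 = \<xi> a" if "a \<in> I" for a
    using that by blast+
  have eI: "e j \<in> I" for j using e by blast
  define X where "X j = bil_field (\<epsilon>\<xi> (e j)) \<epsilon>\<eta>" for j
  have parX: "parallel_field (X j)" for j
    unfolding X_def by (rule bil_field_parallel[OF \<epsilon>\<xi>(1)[OF eI] \<epsilon>\<eta>(1)])
  have Xt: "X j p \<in> tangent A p" for j p by (rule parallel_field_tangent[OF parX])
  have dot: "g p0 (bil_field \<epsilon>1 \<epsilon>2 p0) (bil_field \<epsilon>3 \<epsilon>4 p0) =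
      (\<Sum>k\<in>UNIV. inner (\<epsilon>1 i0 p0) (Gam k (\<epsilon>2 i0 p0)) * inner (\<epsilon>3 i0 p0) (Gam k (\<epsilon>4 i0 p0)))"
    if "parallel \<epsilon>1" "parallel \<epsilon>2" "parallel \<epsilon>3" "parallel \<epsilon>4" for \<epsilon>1 \<epsilon>2 \<epsilon>3 \<epsilon>4
    using g_frame[OF p0 bil_field_tangent[OF that(1,2)] bil_field_tangent[OF that(3,4)]]
    by (simp only: bil_field_component[OF that(1,2) p0] bil_field_component[OF that(3,4) p0])
  have gX: "g p (X j p) (X k p) = (if j = k then 1 else 0)" for p j k
  proof -
    have "g p (X j p) (X k p) = g p0 (X j p0) (X k p0)"
      by (rule parallel_field_g_constant[OF con parX parX])
    also have "\<dots> = (if e j = e k then 1 else 0)"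
      unfolding X_def dot[OF \<epsilon>\<xi>(1)[OF eI] \<epsilon>\<eta>(1) \<epsilon>\<xi>(1)[OF eI] \<epsilon>\<eta>(1)] \<epsilon>\<eta>(2) \<epsilon>\<xi>(2)[OF eI] by (rule on[rule_format, OF eI eI])
    finally show ?thesis using e(1) by (simp add: inj_eq)
  qed
  define \<rho> :: "real^'d \<Rightarrow> 'm vfield" where "\<rho> x = (\<lambda>p. \<Sum>j\<in>UNIV. x $ j *\<^sub>R X j p)" for x
  have \<rho>_apply: "\<rho> x p f = (\<Sum>j\<in>UNIV. x $ j * X j p f)" for x p f
    by (simp only: \<rho>_def sum_apply scaleR_apply real_scaleR_def)
  have \<rho>_tangent: "\<rho> x p \<in> tangent A p" for x p
    unfolding \<rho>_def by (rule tangent_lincomb) (rule Xt)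
  have g\<rho>: "g p v (\<rho> y p) = (\<Sum>j\<in>UNIV. y $ j * g p v (X j p))" if "v \<in> tangent A p" for p v y
    unfolding \<rho>_def using linear_at_sum[OF g_linear[OF that], of UNIV "\<lambda>j. X j p" "\<lambda>j. y $ j"] Xt
    by (simp only: real_scaleR_def)
  have gX\<rho>: "g p (X j p) (\<rho> y p) = y $ j" for p j y
    by (simp add: g\<rho>[OF Xt] gX if_distrib[of "\<lambda>x. _ * x"] cong: if_cong)
  have isometry: "g p (\<rho> x p) (\<rho> y p) = inner x y" for p x y
  proof -
    have "g p (\<rho> x p) (X j p) = x $ j" for j
      using g_commute[OF \<rho>_tangent Xt] gX\<rho> by simp
    then show ?thesis using g\<rho>[OF \<rho>_tangent] by (simp add: inner_vec_def mult.commute)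
  qed
  have bil_range: "bil_field \<epsilon>1 \<epsilon>2 \<in> range \<rho>" if par: "parallel \<epsilon>1" "parallel \<epsilon>2" for \<epsilon>1 \<epsilon>2
  proof -
    let ?Y = "bil_field \<epsilon>1 \<epsilon>2"
    have parY: "parallel_field ?Y" by (rule bil_field_parallel[OF par])
    \<comment> \<open>Coordinates of the orthogonal projection at \<open>p0\<close>. By the Parseval
      identity the projection has full length there, and all inner products involved are constant,
      so \<open>g_eqI\<close> applies at every point.\<close>
    define c where "c = (\<chi> j. g p0 (X j p0) (?Y p0))"
    have "?Y p = \<rho> c p" for p
    proof (rule g_eqI[OF parallel_field_tangent[OF parY] \<rho>_tangent, where r = "inner c c"])
      have mem: "\<epsilon>1 i0 p0 \<in> s ` L" "\<epsilon>2 i0 p0 \<in> s ` L" using par sL by blast+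
      have cj: "g p (?Y p) (X j p) = c $ j" for j
        using parallel_field_g_constant[OF con parX parY, of p _ p0] g_commute[OF parallel_field_tangent[OF parY] Xt]
        by (simp add: c_def)
      have "g p (?Y p) (?Y p) = g p0 (?Y p0) (?Y p0)" by (rule parallel_field_g_constant[OF con parY parY])
      also have "\<dots> = (\<Sum>k\<in>UNIV. (inner (\<epsilon>1 i0 p0) (Gam k (\<epsilon>2 i0 p0)))\<^sup>2)"
        unfolding dot[OF par par] by (simp only: power2_eq_square)
      also have "\<dots> = (\<Sum>a\<in>I. (\<Sum>k\<in>UNIV. inner (\<epsilon>1 i0 p0) (Gam k (\<epsilon>2 i0 p0)) * inner (\<xi> a) (Gam k \<eta>))\<^sup>2)"
        by (rule parseval[rule_format, OF mem])
      also have "\<dots> = (\<Sum>j\<in>UNIV. (\<Sum>k\<in>UNIV. inner (\<epsilon>1 i0 p0) (Gam k (\<epsilon>2 i0 p0)) * inner (\<xi> (e j)) (Gam k \<eta>))\<^sup>2)"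
        unfolding e(2)[symmetric] by (simp add: sum.reindex[OF e(1)])
      also have "\<dots> = (\<Sum>j\<in>UNIV. (c $ j)\<^sup>2)"
      proof (rule sum.cong)
        fix j
        have "g p0 (X j p0) (?Y p0) =
            (\<Sum>k\<in>UNIV. inner (\<xi> (e j)) (Gam k \<eta>) * inner (\<epsilon>1 i0 p0) (Gam k (\<epsilon>2 i0 p0)))"
          unfolding X_def dot[OF \<epsilon>\<xi>(1)[OF eI] \<epsilon>\<eta>(1) par] \<epsilon>\<eta>(2) \<epsilon>\<xi>(2)[OF eI] ..
        then show "(\<Sum>k\<in>UNIV. inner (\<epsilon>1 i0 p0) (Gam k (\<epsilon>2 i0 p0)) * inner (\<xi> (e j)) (Gam k \<eta>))\<^sup>2 = (c $ j)\<^sup>2"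
          by (simp add: c_def mult.commute)
      qed (rule HOL.refl)
      finally show "g p (?Y p) (?Y p) = inner c c" by (simp add: inner_vec_def power2_eq_square)
      show "g p (?Y p) (\<rho> c p) = inner c c"
        using g\<rho>[OF parallel_field_tangent[OF parY]] by (simp add: cj inner_vec_def)
      show "g p (\<rho> c p) (\<rho> c p) = inner c c" by (rule isometry)
    qed
    then have "?Y = \<rho> c" by (rule ext)
    then show ?thesis by blast
  qed
  have linear: "linear \<rho>"
  proof (rule linearI; intro ext)
    fix x y p f show "\<rho> (x + y) p f = (\<rho> x + \<rho> y) p f"
      by (simp only: plus_fun_apply \<rho>_apply vector_add_component distrib_right sum.distrib)
  next
    fix c x p f show "\<rho> (c *\<^sub>R x) p f = (c *\<^sub>R \<rho> x) p f"
      by (simp only: scaleR_apply \<rho>_apply vector_scaleR_component sum_distrib_left real_scaleR_def mult.assoc)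
  qed
  have smoothX: "X j \<in> vector_fields A UNIV" for j using parX unfolding parallel_field_def by blast
  have field: "\<rho> x \<in> vector_fields A UNIV" for x
    unfolding vector_fields_def
  proof (intro CollectI conjI ballI allI impI)
    fix W and f :: "'m \<Rightarrow> real" assume W: "open W" "smooth_fun A W f"
    show "smooth_fun A W (\<lambda>p. \<rho> x p f)"
      unfolding \<rho>_apply
      by (intro smooth_fun_sum smooth_fun_linear[OF bounded_linear_mult_right] W vector_fields_smooth[OF smoothX]) simp
  qed (rule \<rho>_tangent)
  have bracketX: "lie_bracket A (X j) (X k) p = 0" for j k p
  proof (rule lie_bracket_parallel[OF parX parX])
    fix z assume z: "z \<in> tangent A p"
    obtain i where i: "p \<in> patch S i" using patch_cover by blast
    \<comment> \<open>The spin element belongs to the point \<open>p\<close> and need not be related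
      to the one used at \<open>p0\<close>.\<close>
    obtain t where t: "t \<in> Spin8" "{\<epsilon> i p |\<epsilon>. parallel \<epsilon>} = t ` L" using rep[OF i] by blast
    show "H p z (X j p) (X k p) = 0"
      unfolding X_def by (rule bilinears_H_vanish[OF st i t dil \<epsilon>\<xi>(1)[OF eI] \<epsilon>\<eta>(1) \<epsilon>\<xi>(1)[OF eI] \<epsilon>\<eta>(1) z])
  qed
  \<comment> \<open>The coefficients are constants, so no derivative falls on them and the bracket
    reduces to those of the \<open>X j\<close>.\<close>
  have bracket: "lie_bracket A (\<rho> x) (\<rho> y) = 0" for x y
  proof (intro ext)
    fix p f
    show "lie_bracket A (\<rho> x) (\<rho> y) p f = 0 p f"
    proof (cases "smooth_near A p f")
      case True
      then obtain W where W: "open W" "p \<in> W" "smooth_fun A W f" unfolding smooth_near_def by blast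
      have nearX: "smooth_near A p (\<lambda>q. X j q f)" for j
        by (rule smooth_nearI[OF W(1,2) vector_fields_smooth[OF smoothX W(1) subset_UNIV W(3)]])
      have second: "X j p (\<lambda>q. \<rho> y q f) = (\<Sum>k\<in>UNIV. y $ k * X j p (\<lambda>q. X k q f))" for j y
      proof -
        have "X j p (\<lambda>q. \<Sum>k\<in>UNIV. y $ k * X k q f) = (\<Sum>k\<in>UNIV. X j p (\<lambda>q. y $ k * X k q f))"
          by (rule tangent_sum[OF Xt]) (rule smooth_near_cmult[OF nearX])
        then show ?thesis by (simp only: \<rho>_apply tangent_cmult[OF Xt nearX])
      qed
      have comm: "X j p (\<lambda>q. X k q f) = X k p (\<lambda>q. X j q f)" for j k
        using fun_cong[OF bracketX[of j k p], of f] True by (simp add: lie_bracket_def)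
      have "\<rho> x p (\<lambda>q. \<rho> y q f) = (\<Sum>j\<in>UNIV. \<Sum>k\<in>UNIV. x $ j * (y $ k * X j p (\<lambda>q. X k q f)))"
        by (simp only: \<rho>_apply[of x] second sum_distrib_left)
      also have "\<dots> = (\<Sum>k\<in>UNIV. \<Sum>j\<in>UNIV. x $ j * (y $ k * X k p (\<lambda>q. X j q f)))"
        by (subst sum.swap) (simp only: comm)
      also have "\<dots> = \<rho> y p (\<lambda>q. \<rho> x q f)"
        by (simp only: \<rho>_apply[of y] second sum_distrib_left mult.left_commute)
      finally show ?thesis using True by (simp add: lie_bracket_def)
    qed (simp add: lie_bracket_def)
  qed
  have action: "euclidean_lie_action A g abelian_bracket \<rho>"
    unfolding euclidean_lie_action_def
  proof (intro conjI allI)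
    show "euclidean_lie_algebra (abelian_bracket :: real^'d \<Rightarrow> _)"
      by (auto simp: euclidean_lie_algebra_def abelian_bracket_def bilinear_def intro!: linearI)
    show "\<rho> (abelian_bracket x y) = lie_bracket A (\<rho> x) (\<rho> y)" for x y
      unfolding bracket abelian_bracket_def by (rule linear_0[OF linear])
  qed (use linear field isometry in auto)
  let ?B = "{bilinear1 A g S \<epsilon>1 \<epsilon>2 |\<epsilon>1 \<epsilon>2. parallel \<epsilon>1 \<and> parallel \<epsilon>2}"
  \<comment> \<open>Linearity of the forms is carried through the induction because
    \<open>sharp\<close> yields a genuine dual vector for linear forms, and that makes it additive
    here.\<close>
  have dual: "(\<forall>p. linear_at A p (\<kappa> p)) \<and> dual_field A g \<kappa> \<in> range \<rho>" if "\<kappa> \<in> span ?B" for \<kappa>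
    using that
  proof (induct rule: span_induct_alt)
    case base
    have g0: "g p 0 w = 0" if "w \<in> tangent A p" for p w
      using linear_at_zero[OF g_linear[OF that]] g_commute[OF that tangent_zero] by simp
    have "dual_field A g 0 p = \<rho> 0 p" for p
    proof -
      have "dual_field A g 0 p = 0"
        unfolding dual_field_def by (rule sharp_unique[OF tangent_zero]) (simp only: g0 zero_fun_apply)
      then show ?thesis by (simp only: linear_0[OF linear] zero_fun_apply)
    qed
    then have "dual_field A g 0 = \<rho> 0" by (rule ext)
    moreover have "linear_at A p (0 p :: 'm tvec \<Rightarrow> real)" for p
      unfolding linear_at_def by (simp only: zero_fun_apply) simp
    ultimately show ?case by blast
  next
    case (step r \<kappa> \<mu>)
    then obtain \<epsilon>1 \<epsilon>2 where par: "parallel \<epsilon>1" "parallel \<epsilon>2" and \<kappa>: "\<kappa> = bilinear1 A g S \<epsilon>1 \<epsilon>2" by blast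
    obtain x where x: "dual_field A g \<kappa> = \<rho> x"
      using bil_range[OF par] unfolding bil_field_def[OF par] \<kappa> by blast
    obtain y where y: "dual_field A g \<mu> = \<rho> y" using step(2) by blast
    have l\<kappa>: "linear_at A p (\<kappa> p)" for p unfolding \<kappa> by (rule bilinear1_linear[OF par])
    have l\<mu>: "linear_at A p (\<mu> p)" for p using step(2) by blast
    have app: "(r *\<^sub>R \<kappa> + \<mu>) p v = r * \<kappa> p v + \<mu> p v" for p v
      by (simp only: plus_fun_apply scaleR_apply real_scaleR_def)
    have "linear_at A p ((r *\<^sub>R \<kappa> + \<mu>) p)" for p
      using l\<kappa>[of p] l\<mu>[of p] unfolding linear_at_def app by (simp add: algebra_simps)
    moreover have "dual_field A g (r *\<^sub>R \<kappa> + \<mu>) p = \<rho> (r *\<^sub>R x + y) p" for p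
      unfolding dual_field_def
    proof (rule sharp_unique[OF \<rho>_tangent])
      fix w assume w: "w \<in> tangent A p"
      have "g p w (\<rho> (r *\<^sub>R x + y) p) = r * g p w (\<rho> x p) + g p w (\<rho> y p)"
        unfolding g\<rho>[OF w] by (simp add: distrib_right sum.distrib sum_distrib_left mult.assoc)
      moreover have "g p w (\<rho> x p) = \<kappa> p w"
        using sharp(2)[OF l\<kappa> w] g_commute[OF w \<rho>_tangent] fun_cong[OF x, of p] by (simp add: dual_field_def)
      moreover have "g p w (\<rho> y p) = \<mu> p w"
        using sharp(2)[OF l\<mu> w] g_commute[OF w \<rho>_tangent] fun_cong[OF y, of p] by (simp add: dual_field_def)
      ultimately show "g p (\<rho> (r *\<^sub>R x + y) p) w = (r *\<^sub>R \<kappa> + \<mu>) p w"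
        using g_commute[OF w \<rho>_tangent] app by simp
    qed
    then have "dual_field A g (r *\<^sub>R \<kappa> + \<mu>) = \<rho> (r *\<^sub>R x + y)" by (rule ext)
    ultimately show ?case by blast
  qed
  have sub: "subspace (range \<rho>)" by (rule linear_subspace_image[OF linear subspace_UNIV])
  have "range \<rho> = generated_lie_algebra A (dual_field A g ` span ?B)"
  proof (rule antisym)
    \<comment> \<open>All brackets vanish, so the image of \<open>\<rho>\<close> is itself one of
      the sets being intersected.\<close>
    have "\<forall>X\<in>range \<rho>. \<forall>Y\<in>range \<rho>. lie_bracket A X Y \<in> range \<rho>"
      using bracket subspace_0[OF sub] by auto
    then show "generated_lie_algebra A (dual_field A g ` span ?B) \<subseteq> range \<rho>"
      unfolding generated_lie_algebra_def using dual sub by (intro Inter_lower) blast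
    show "range \<rho> \<subseteq> generated_lie_algebra A (dual_field A g ` span ?B)"
      unfolding generated_lie_algebra_def
    proof (intro Inter_greatest subsetI)
      fix M Z assume "M \<in> {L. dual_field A g ` span ?B \<subseteq> L \<and> subspace L \<and> (\<forall>X\<in>L. \<forall>Y\<in>L. lie_bracket A X Y \<in> L)}"
        and "Z \<in> range \<rho>"
      then obtain x where M: "dual_field A g ` span ?B \<subseteq> M" "subspace M" and Z: "Z = \<rho> x" by blast
      \<comment> \<open>The \<open>X j\<close> are duals of bilinears, so each competing
        \<open>M\<close> contains their combinations.\<close>
      have "X j \<in> dual_field A g ` span ?B" for j
        unfolding X_def bil_field_def[OF \<epsilon>\<xi>(1)[OF eI] \<epsilon>\<eta>(1)]
        using \<epsilon>\<xi>(1)[OF eI] \<epsilon>\<eta>(1) by (blast intro: span_base)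
      then have "(\<Sum>j\<in>UNIV. x $ j *\<^sub>R X j) \<in> M"
        using M by (intro subspace_sum subspace_scale) blast+
      moreover have "\<rho> x = (\<Sum>j\<in>UNIV. x $ j *\<^sub>R X j)"
        by (intro ext) (simp only: \<rho>_apply sum_apply scaleR_apply real_scaleR_def)
      ultimately show "Z \<in> M" unfolding Z by simp
    qed
  qed
  then show ?thesis using action by blast
qed

end

section \<open>From the geometric hypotheses to the three holonomy cases\<close>

lemma simply_connected_imp_connected_topological:
  fixes M :: "'a::topological_space set"
  assumes "simply_connected M" shows "connected M"
proof (rule path_connected_imp_connected, unfold path_connected_component, intro ballI)
  fix a b assume "a \<in> M" "b \<in> M"
  \<comment> \<open>Constant loops at \<open>a\<close> and \<open>b\<close> are homotopic, and the
    track of one parameter value under the homotopy is a path joining them.\<close>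
  then have "homotopic_loops M (\<lambda>_. a) (\<lambda>_. b)"
    using assms by (simp add: simply_connected_def path_def pathstart_def pathfinish_def path_image_def image_constant_conv)
  from homotopic_loops_imp_path_component_value[OF this, of 0] show "path_component M a b" by simp
qed
text \<open>As parallel spinors are Killing, the two classes coincide, and the bilinears are those
  of the full space of parallel spinors, to which the pointwise representation applies.\<close>

lemma action_of_listed_spinors:
  fixes A :: "'m::topological_space atlas" and S :: "('m, 'i) spin_data" and e :: "'d::finite \<Rightarrow> 8"
    and B :: "('m, 'j, 'n::finite) gauge_data"
  assumes "oriented_smooth_atlas A" "simply_connected (UNIV :: 'm set)" "riemannian_metric A g"
    "levi_civita A g D" "three_form A H" "spin_structure A g S"
    and killing: "\<And>\<epsilon>. parallel_spinor A g (nabla_hat A g H D) S \<epsilon> \<Longrightarrow> killing_spinor A g H \<Phi> D S B \<epsilon>"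
    and rep: "parallel_spinors_represented_by A g (nabla_hat A g H D) S L"
    and "clifford_stable I (listed_spinors L)" "inj e" "range e = I"
  shows "\<exists>\<rho> :: real^'d \<Rightarrow> 'm vfield. euclidean_lie_action A g abelian_bracket \<rho> \<and>
    range \<rho> = generated_lie_algebra A (dual_field A g ` one_form_bilinears A g H \<Phi> D S B)"
proof -
  interpret spin_geometry A g D H S
    using assms by unfold_locales (auto simp: oriented_smooth_atlas_def)
  have "killing_spinor A g H \<Phi> D S B = parallel"
    using killing by (auto simp: killing_spinor_def)
  then have "one_form_bilinears A g H \<Phi> D S B =
      span {bilinear1 A g S \<epsilon>1 \<epsilon>2 |\<epsilon>1 \<epsilon>2. parallel \<epsilon>1 \<and> parallel \<epsilon>2}"
    by (simp only: one_form_bilinears_def)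
  moreover have "dilatino H \<Phi> S \<epsilon>" if "parallel \<epsilon>" for \<epsilon>
    using killing[OF that] by (simp add: killing_spinor_def)
  ultimately show ?thesis
    using bilinears_action[OF simply_connected_imp_connected_topological[OF assms(2)] assms(9) _ _ assms(10,11), of \<Phi>]
      rep unfolding parallel_spinors_represented_by_def by simp
qed

theorem theorem4p2:
  fixes A :: "'m::{t2_space, second_countable_topology} atlas"
    and g :: "'m metric_tensor"
    and D :: "'m connection"
    and H :: "'m form3"
    and \<Phi> :: "'m \<Rightarrow> real"
    and S :: "('m, 'i) spin_data"
    and K :: "(real^'n^'n) set"
    and B :: "('m, 'j, 'n::finite) gauge_data"
  defines "N \<equiv> nabla_hat A g H D"
    and "\<BB> \<equiv> one_form_bilinears A g H \<Phi> D S B"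
    and "\<gg> \<equiv> generated_lie_algebra A (dual_field A g ` one_form_bilinears A g H \<Phi> D S B)"
  assumes "oriented_smooth_atlas A"
    and "simply_connected (UNIV :: 'm set)"
    and "riemannian_metric A g"
    and "levi_civita A g D"
    and "three_form A H"
    and "smooth_fun A UNIV \<Phi>"
    and "spin_structure A g S"
    and "linear_lie_group K"
    and "gauge_connection A K B"
    and "\<And>\<epsilon>. parallel_spinor A g N S \<epsilon> \<Longrightarrow> killing_spinor A g H \<Phi> D S B \<epsilon>"
    and "\<And>\<kappa>1 \<kappa>2. \<kappa>1 \<in> \<BB> \<Longrightarrow> \<kappa>2 \<in> \<BB> \<Longrightarrow> double_contraction_vanishes A g H \<kappa>1 \<kappa>2"
  shows "(holonomy_group_is A g N G2_in_SO8 \<and>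
      parallel_spinors_represented_by A g N S
        {e_wedge {} + e_wedge {1,2,3,4}, e_wedge {1} + e_wedge {2,3,4}} \<longrightarrow>
      (\<exists>\<rho> :: real^1 \<Rightarrow> 'm vfield. euclidean_lie_action A g abelian_bracket \<rho> \<and> range \<rho> = \<gg>))
    \<and> (holonomy_group_is A g N SU3_in_SO8 \<and>
      parallel_spinors_represented_by A g N S {e_wedge {}, e_wedge {1}} \<longrightarrow>
      (\<exists>\<rho> :: real^2 \<Rightarrow> 'm vfield. euclidean_lie_action A g abelian_bracket \<rho> \<and> range \<rho> = \<gg>))
    \<and> (holonomy_group_is A g N SU2_in_SO8 \<and>
      parallel_spinors_represented_by A g N S {e_wedge {}, e_wedge {1,2}, e_wedge {1}, e_wedge {2}} \<longrightarrow>
      (\<exists>\<rho> :: real^4 \<Rightarrow> 'm vfield. euclidean_lie_action A g abelian_bracket \<rho> \<and> range \<rho> = \<gg>))"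
proof (intro conjI impI)
  note action = action_of_listed_spinors[OF assms(4,5,6,7,8,10)]
  note killing = assms(13)[unfolded N_def]
  \<comment> \<open>Distinctness of indices modulo 8 is read off from \<open>pos\<close>.\<close>
  have pos_neq: "pos a \<noteq> pos b \<Longrightarrow> a \<noteq> b" for a b :: 8 by blast
  have [simp]: "(1::8) \<noteq> 2" "(1::8) \<noteq> 5" "(1::8) \<noteq> 6" "(2::8) \<noteq> 5" "(2::8) \<noteq> 6" "(5::8) \<noteq> 6"
    by (rule pos_neq; simp)+
  {
    assume "holonomy_group_is A g N G2_in_SO8 \<and> parallel_spinors_represented_by A g N S
        {e_wedge {} + e_wedge {1,2,3,4}, e_wedge {1} + e_wedge {2,3,4}}"
    then show "\<exists>\<rho> :: real^1 \<Rightarrow> 'm vfield. euclidean_lie_action A g abelian_bracket \<rho> \<and> range \<rho> = \<gg>"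
      unfolding N_def \<gg>_def by (intro action[OF killing _ G2_stable, of "\<lambda>_. 1"]) (auto simp: inj_def)
  next
    assume rep: "holonomy_group_is A g N SU3_in_SO8 \<and> parallel_spinors_represented_by A g N S
        {e_wedge {}, e_wedge {1}}"
    \<comment> \<open>Directions 1 and 5 are the two real directions over the first complex
      one.\<close>
    have inj: "inj (\<lambda>j::2. if j = 1 then 1 else 5 :: 8)"
      unfolding inj_def forall_2 by simp
    have range: "range (\<lambda>j::2. if j = 1 then 1 else 5 :: 8) = {1,5}"
      by (simp add: UNIV_2 insert_commute)
    show "\<exists>\<rho> :: real^2 \<Rightarrow> 'm vfield. euclidean_lie_action A g abelian_bracket \<rho> \<and> range \<rho> = \<gg>"
      unfolding N_def \<gg>_def by (intro action[OF killing _ SU3_stable inj range]) (simp_all add: rep[unfolded N_def])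
  next
    assume rep: "holonomy_group_is A g N SU2_in_SO8 \<and> parallel_spinors_represented_by A g N S
        {e_wedge {}, e_wedge {1,2}, e_wedge {1}, e_wedge {2}}"
    \<comment> \<open>The first two complex directions give the real directions 1, 5 and 2,
      6.\<close>
    have inj: "inj (\<lambda>j::4. if j = 1 then 1 else if j = 2 then 2 else if j = 3 then 5 else 6 :: 8)"
      unfolding inj_def forall_4 by simp
    have range: "range (\<lambda>j::4. if j = 1 then 1 else if j = 2 then 2 else if j = 3 then 5 else 6 :: 8) = {1,2,5,6}"
      unfolding UNIV_4 image_insert image_empty by simp
    show "\<exists>\<rho> :: real^4 \<Rightarrow> 'm vfield. euclidean_lie_action A g abelian_bracket \<rho> \<and> range \<rho> = \<gg>"
      unfolding N_def \<gg>_def by (intro action[OF killing _ SU2_stable inj range]) (simp_all add: rep[unfolded N_def])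
  }
qed

end
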